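(* Let $X\subset\mathbb{P}^5$ be an irreducible, smooth, non-degenerate threefold. If there is a line $L\subset X$ such that the projection $\pi_L:X\dashrightarrow\mathbb{P}^3$ from the centre $L$ is birational, then $X$ is isomorphic to a blowing-down of $\widetilde{\mathbb{P}}^3$, the blowing-up of $\mathbb{P}^3$ along $B:=\mathrm{Bs}(|\Sigma|)$, where $|\Sigma|$ is the linear system of surfaces in $\mathbb{P}^3$ defining $\pi_L^{-1}:\mathbb{P}^3\dashrightarrow X\subset\mathbb{P}^5$.
   Context: The base field is algebraically closed of characteristic zero. $\mathrm{Bs}(|\Sigma|)$ denotes the (scheme-theoretic) base locus. "$X$ is a blowing-down of $\widetilde{\mathbb{P}}^3$" means that $\widetilde{\mathbb{P}}^3$ is isomorphic to a blowing-up of $X$ along a closed subvariety. *)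

theory Defs
  imports
    "HOL-Analysis.Abstract_Topology"
    "HOL-Computational_Algebra.Polynomial"
    "HOL-Library.Poly_Mapping"
    "HOL-Library.Function_Algebras"
    "HOL-Library.Extended_Nat"
begin

section \<open>Polynomials and forms\<close>

text \<open>Polynomials in the variables \<open>x\<^sub>0, x\<^sub>1, x\<^sub>2, \<dots>\<close>: finitely supported functions from
  exponent vectors to coefficients, with the ring structure of the library.\<close>

type_synonym 'k mpol = "(nat \<Rightarrow>\<^sub>0 nat) \<Rightarrow>\<^sub>0 'k"

definition eval_monom :: "(nat \<Rightarrow>\<^sub>0 nat) \<Rightarrow> (nat \<Rightarrow> 'k::comm_ring_1) \<Rightarrow> 'k" where
  "eval_monom m v = (\<Prod>i\<in>Poly_Mapping.keys m. v i ^ Poly_Mapping.lookup m i)"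

definition peval :: "'k::comm_ring_1 mpol \<Rightarrow> (nat \<Rightarrow> 'k) \<Rightarrow> 'k" where
  "peval F v = (\<Sum>m\<in>Poly_Mapping.keys F. Poly_Mapping.lookup F m * eval_monom m v)"

text \<open>The value at \<open>v\<close> of the partial derivative of \<open>F\<close> with respect to \<open>x\<^sub>i\<close>.\<close>

definition partial_at :: "nat \<Rightarrow> 'k::comm_ring_1 mpol \<Rightarrow> (nat \<Rightarrow> 'k) \<Rightarrow> 'k" where
  "partial_at i F v = (\<Sum>m\<in>Poly_Mapping.keys F. Poly_Mapping.lookup F m * of_nat (Poly_Mapping.lookup m i) *
     v i ^ (Poly_Mapping.lookup m i - 1) * (\<Prod>j\<in>Poly_Mapping.keys m - {i}. v j ^ Poly_Mapping.lookup m j))"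

definition monom_degree :: "(nat \<Rightarrow>\<^sub>0 nat) \<Rightarrow> nat" where
  "monom_degree m = (\<Sum>i\<in>Poly_Mapping.keys m. Poly_Mapping.lookup m i)"

definition homogeneous :: "nat \<Rightarrow> 'k::comm_ring_1 mpol \<Rightarrow> bool" where
  "homogeneous d F \<longleftrightarrow> (\<forall>m\<in>Poly_Mapping.keys F. monom_degree m = d)"

text \<open>The vector space of forms of degree \<open>d\<close> in \<open>x\<^sub>0, \<dots>, x\<^sub>n\<close> (including \<open>0\<close>).\<close>

definition forms :: "nat \<Rightarrow> nat \<Rightarrow> 'k::comm_ring_1 mpol set" where
  "forms n d = {F. homogeneous d F \<and> (\<forall>m\<in>Poly_Mapping.keys F. Poly_Mapping.keys m \<subseteq> {..n})}"

text \<open>The linear span of \<open>f\<^sub>0, \<dots>, f\<^sub>m\<close>; \<open>single 0 c\<close> is the constant polynomial \<open>c\<close>.\<close>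

definition linear_system :: "nat \<Rightarrow> (nat \<Rightarrow> 'k::comm_ring_1 mpol) \<Rightarrow> 'k mpol set" where
  "linear_system m f = {(\<Sum>i\<le>m. Poly_Mapping.single 0 (c i) * f i) | c. True}"

lemma peval_superset:
  assumes "finite A" "Poly_Mapping.keys F \<subseteq> A"
  shows "peval F v = (\<Sum>m\<in>A. Poly_Mapping.lookup F m * eval_monom m v)"
  unfolding peval_def using assms
  by (intro sum.mono_neutral_left) (auto simp: in_keys_iff)

lemma peval_0 [simp]: "peval 0 v = 0"
  by (simp add: peval_def)

lemma peval_add: "peval (F + G) v = peval F v + peval G v"
proof -
  let ?A = "Poly_Mapping.keys F \<union> Poly_Mapping.keys G"
  have "peval (F + G) v = (\<Sum>m\<in>?A. Poly_Mapping.lookup (F + G) m * eval_monom m v)"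
    by (intro peval_superset) (use Poly_Mapping.keys_add[of F G] in auto)
  also have "\<dots> = (\<Sum>m\<in>?A. Poly_Mapping.lookup F m * eval_monom m v) + (\<Sum>m\<in>?A. Poly_Mapping.lookup G m * eval_monom m v)"
    by (simp add: lookup_add algebra_simps sum.distrib)
  also have "\<dots> = peval F v + peval G v"
    by (subst (1 2) peval_superset[of ?A]) auto
  finally show ?thesis .
qed

lemma peval_single: "peval (Poly_Mapping.single m c) v = c * eval_monom m v"
  by (cases "c = 0") (simp_all add: peval_def)

lemma peval_1 [simp]: "peval 1 v = 1"
  using peval_single[of 0 1 v] by (simp add: eval_monom_def)

lemma eval_monom_add: "eval_monom (a + b) v = eval_monom a v * eval_monom b v"
proof -
  let ?A = "Poly_Mapping.keys a \<union> Poly_Mapping.keys b"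
  have *: "eval_monom m v = (\<Prod>i\<in>?A. v i ^ Poly_Mapping.lookup m i)" if "Poly_Mapping.keys m \<subseteq> ?A" for m
    unfolding eval_monom_def using that by (intro prod.mono_neutral_left) (auto simp: in_keys_iff)
  show ?thesis
    using Poly_Mapping.keys_add[of a b]
    by (simp add: * lookup_add power_add prod.distrib)
qed

lemma monom_degree_add: "monom_degree (a + b) = monom_degree a + monom_degree b"
proof -
  let ?A = "Poly_Mapping.keys a \<union> Poly_Mapping.keys b"
  have *: "monom_degree m = (\<Sum>i\<in>?A. Poly_Mapping.lookup m i)" if "Poly_Mapping.keys m \<subseteq> ?A" for m
    unfolding monom_degree_def using that by (intro sum.mono_neutral_left) (auto simp: in_keys_iff)
  show ?thesis
    using Poly_Mapping.keys_add[of a b] by (simp add: * lookup_add sum.distrib)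
qed

lemma mpol_induct [case_names zero single add]:
  fixes F :: "'k::comm_ring_1 mpol"
  assumes z: "P 0" and s: "\<And>m c. P (Poly_Mapping.single m c)"
    and a: "\<And>F G. P F \<Longrightarrow> P G \<Longrightarrow> P (F + G)"
  shows "P F"
proof (induction F rule: Poly_Mapping.update_induct)
  case const
  show ?case by (rule z)
next
  case (update F m c)
  have "Poly_Mapping.update m c F = F + Poly_Mapping.single m c"
    using update.hyps
    by (intro poly_mapping_eqI)
      (auto simp: lookup_update lookup_add lookup_single in_keys_iff when_def)
  then show ?case using a[OF update.IH s] by simp
qed

lemma peval_mult: "peval (F * G) v = peval F v * peval G v"
proof (induction F rule: mpol_induct)
  case (single m c)
  show ?case
    by (induction G rule: mpol_induct)
      (simp_all add: mult_single peval_single eval_monom_add distrib_left peval_add)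
qed (simp_all add: distrib_right peval_add)

lemma homogeneous_mult:
  assumes "homogeneous d F" "homogeneous e G"
  shows "homogeneous (d + e) (F * G)"
  unfolding homogeneous_def
proof
  fix m assume "m \<in> Poly_Mapping.keys (F * G)"
  then obtain a b where "m = a + b" "a \<in> Poly_Mapping.keys F" "b \<in> Poly_Mapping.keys G"
    using Poly_Mapping.keys_mult by blast
  then show "monom_degree m = d + e"
    using assms by (simp add: homogeneous_def monom_degree_add)
qed

lemma homogeneous_1: "homogeneous 0 1"
  by (simp add: homogeneous_def monom_degree_def)

section \<open>Projective space and the Zariski topology\<close>

definition scale_vec :: "'k::field \<Rightarrow> (nat \<Rightarrow> 'k) \<Rightarrow> nat \<Rightarrow> 'k" where
  "scale_vec c v = (\<lambda>i. c * v i)"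

global_interpretation vec: vector_space "scale_vec :: 'k::field \<Rightarrow> (nat \<Rightarrow> 'k) \<Rightarrow> nat \<Rightarrow> 'k"
  by unfold_locales (auto simp: scale_vec_def fun_eq_iff algebra_simps)

text \<open>\<open>coords n\<close> is \<open>k\<^bsup>n+1\<^esup>\<close>, as sequences vanishing beyond index \<open>n\<close>. A point of \<open>\<bbbP>\<^sup>n\<close> is the
  set of all its homogeneous coordinate vectors. With this encoding \<open>\<bbbP>\<^sup>n\<close> is literally a linear
  subspace of \<open>\<bbbP>\<^bsup>n+1\<^esup>\<close>, and the notions below do not depend on the ambient \<open>n\<close>.\<close>

type_synonym 'k point = "(nat \<Rightarrow> 'k) set"

definition coords :: "nat \<Rightarrow> (nat \<Rightarrow> 'k::field) set" where
  "coords n = {v. \<forall>i>n. v i = 0}"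

definition pt :: "(nat \<Rightarrow> 'k::field) \<Rightarrow> 'k point" where
  "pt v = {scale_vec c v | c. c \<noteq> 0}"

definition proj :: "nat \<Rightarrow> 'k::field point set" where
  "proj n = {pt v | v. v \<in> coords n \<and> v \<noteq> 0}"

definition zero_at :: "'k::field mpol \<Rightarrow> 'k point \<Rightarrow> bool" where
  "zero_at F p \<longleftrightarrow> (\<forall>v\<in>p. peval F v = 0)"

definition nonzero_at :: "'k::field mpol \<Rightarrow> 'k point \<Rightarrow> bool" where
  "nonzero_at F p \<longleftrightarrow> (\<forall>v\<in>p. peval F v \<noteq> 0)"

text \<open>The Zariski topology of \<open>X \<subseteq> \<bbbP>\<^sup>n\<close>: closed sets are the common zero sets in \<open>X\<close> of sets
  of forms. (Forms in further variables are allowed; they restrict to forms in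
  \<open>x\<^sub>0, \<dots>, x\<^sub>n\<close> on \<open>\<bbbP>\<^sup>n\<close>.)\<close>

definition zariski :: "'k::field point set \<Rightarrow> 'k point topology" where
  "zariski X = topology (\<lambda>U. \<exists>S. (\<forall>F\<in>S. \<exists>d. homogeneous d F) \<and>
     U = {p\<in>X. \<exists>F\<in>S. nonzero_at F p})"

lemma openin_zariski:
  "openin (zariski X) U \<longleftrightarrow> (\<exists>S. (\<forall>F\<in>S. \<exists>d. homogeneous d F) \<and>
     U = {p\<in>X. \<exists>F\<in>S. nonzero_at F p})"
proof -
  define hom where "hom S \<longleftrightarrow> (\<forall>F\<in>S. \<exists>d. homogeneous d F)" for S :: "'a mpol set"
  define D where "D S = {p\<in>X. \<exists>F\<in>S. nonzero_at F p}" for S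
  have nz: "nonzero_at (F * G) p \<longleftrightarrow> nonzero_at F p \<and> nonzero_at G p" for F G :: "'a mpol" and p
    by (auto simp: nonzero_at_def peval_mult)
  have "istopology (\<lambda>U. \<exists>S. hom S \<and> U = D S)"
    unfolding istopology_def
  proof (intro conjI allI impI)
    fix U V assume "\<exists>S. hom S \<and> U = D S" "\<exists>S. hom S \<and> V = D S"
    then obtain S T where S: "hom S" "U = D S" and T: "hom T" "V = D T" by blast
    define R where "R = (\<lambda>(F, G). F * G) ` (S \<times> T)"
    have "hom R"
      unfolding hom_def
    proof
      fix H assume "H \<in> R"
      then obtain F G where H: "H = F * G" "F \<in> S" "G \<in> T"
        unfolding R_def by auto
      obtain d e where "homogeneous d F" "homogeneous e G"
        using S(1) T(1) H(2,3) unfolding hom_def by blast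
      then show "\<exists>d. homogeneous d H"
        unfolding H(1) using homogeneous_mult by blast
    qed
    moreover have "D S \<inter> D T = D R"
      unfolding D_def R_def by (auto simp: nz)
    ultimately show "\<exists>R. hom R \<and> U \<inter> V = D R"
      using S(2) T(2) by metis
  next
    fix \<K> assume K: "\<forall>K\<in>\<K>. \<exists>S. hom S \<and> K = D S"
    define R where "R = \<Union>{S. hom S \<and> D S \<in> \<K>}"
    have "hom R"
      unfolding hom_def R_def by blast
    moreover have "\<Union>\<K> = D R"
    proof (rule set_eqI, rule iffI)
      fix p assume "p \<in> \<Union>\<K>"
      then obtain K where 1: "K \<in> \<K>" "p \<in> K" by (rule UnionE)
      then obtain S where 2: "hom S" "K = D S" using K by metis
      then have "S \<subseteq> R" using 1(1) unfolding R_def by (simp add: Union_upper)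
      then show "p \<in> D R" using 1(2) unfolding 2(2) D_def by (simp add: subset_iff) metis
    next
      fix p assume "p \<in> D R"
      then obtain S F where 1: "hom S" "D S \<in> \<K>" "F \<in> S" "p \<in> X" "nonzero_at F p"
        unfolding R_def D_def by auto
      then have "p \<in> D S" unfolding D_def by auto
      then show "p \<in> \<Union>\<K>" using 1(2) by (rule UnionI[rotated])
    qed
    ultimately show "\<exists>S. hom S \<and> \<Union>\<K> = D S" by metis
  qed
  then show ?thesis
    unfolding zariski_def hom_def D_def by (simp only: topology_inverse')
qed

lemma topspace_zariski [simp]: "topspace (zariski X) = X"
proof
  show "topspace (zariski X) \<subseteq> X"
    using openin_topspace[of "zariski X"] unfolding openin_zariski by blast
  have "openin (zariski X) X"
    unfolding openin_zariski
    by (intro exI[of _ "{1}"]) (auto simp: nonzero_at_def intro: homogeneous_1)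
  then show "X \<subseteq> topspace (zariski X)"
    by (rule openin_subset)
qed

definition irreducible_in :: "'a topology \<Rightarrow> 'a set \<Rightarrow> bool" where
  "irreducible_in T S \<longleftrightarrow> S \<noteq> {} \<and> S \<subseteq> topspace T \<and>
     (\<forall>A B. closedin T A \<and> closedin T B \<and> S \<subseteq> A \<union> B \<longrightarrow> S \<subseteq> A \<or> S \<subseteq> B)"

text \<open>The supremum of the lengths \<open>n\<close> of chains \<open>Z\<^sub>0 \<subset> \<dots> \<subset> Z\<^sub>n\<close> of irreducible closed subsets.\<close>

definition krull_dim :: "'a topology \<Rightarrow> enat" where
  "krull_dim T = Sup {enat n | n. \<exists>Z. (\<forall>i\<le>n. closedin T (Z i) \<and> irreducible_in T (Z i)) \<and>
     (\<forall>i<n. Z i \<subset> Z (Suc i))}"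

text \<open>Quasi-projective algebraic sets (reduced, possibly reducible).\<close>

definition quasi_projective :: "'k::field point set \<Rightarrow> bool" where
  "quasi_projective X \<longleftrightarrow> (\<exists>n Z. closedin (zariski (proj n)) Z \<and> openin (zariski Z) X)"

section \<open>Linear subspaces, non-degeneracy, smoothness\<close>

definition proj_line :: "nat \<Rightarrow> 'k::field point set \<Rightarrow> bool" where
  "proj_line n L \<longleftrightarrow> (\<exists>W. vec.subspace W \<and> W \<subseteq> coords n \<and> vec.dim W = 2 \<and>
     L = {pt v | v. v \<in> W \<and> v \<noteq> 0})"

definition nondegenerate :: "nat \<Rightarrow> 'k::field point set \<Rightarrow> bool" where
  "nondegenerate n X \<longleftrightarrow> (\<forall>F\<in>forms n 1. (\<forall>p\<in>X. zero_at F p) \<longrightarrow> F = 0)"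

text \<open>The affine cone over the embedded projective tangent space of \<open>X\<close> at the point \<open>[v]\<close>: the
  kernel of the Jacobian matrix at \<open>v\<close> of the homogeneous ideal of \<open>X\<close>.\<close>

definition tangent_cone_space :: "nat \<Rightarrow> 'k::field point set \<Rightarrow> (nat \<Rightarrow> 'k) \<Rightarrow> (nat \<Rightarrow> 'k) set" where
  "tangent_cone_space n X v = {w\<in>coords n. \<forall>d. \<forall>F\<in>forms n d. (\<forall>p\<in>X. zero_at F p) \<longrightarrow>
     (\<Sum>i\<le>n. partial_at i F v * w i) = 0}"

text \<open>Jacobian criterion, for an irreducible closed \<open>X \<subseteq> \<bbbP>\<^sup>n\<close>.\<close>

definition smooth :: "nat \<Rightarrow> 'k::field point set \<Rightarrow> bool" where
  "smooth n X \<longleftrightarrow> (\<forall>p\<in>X. \<forall>v\<in>p.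
     enat (vec.dim (tangent_cone_space n X v)) = krull_dim (zariski X) + 1)"

section \<open>Regular maps and rational maps\<close>

text \<open>\<open>form_map m F\<close> sends \<open>[v]\<close> to \<open>[F\<^sub>0(v) : \<dots> : F\<^sub>m(v)]\<close>. For forms of one common degree, not
  all zero at \<open>[v]\<close>, the sets in the union coincide; if all vanish the value is \<open>{0}\<close>, which is not
  a point of any \<open>\<bbbP>\<^sup>m\<close>.\<close>

definition form_map :: "nat \<Rightarrow> (nat \<Rightarrow> 'k::field mpol) \<Rightarrow> 'k point \<Rightarrow> 'k point" where
  "form_map m F p = (\<Union>v\<in>p. pt (\<lambda>i. if i \<le> m then peval (F i) v else 0))"

definition regular_map :: "'k::field point set \<Rightarrow> 'k point set \<Rightarrow> ('k point \<Rightarrow> 'k point) \<Rightarrow> bool" where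
  "regular_map X Y \<phi> \<longleftrightarrow> \<phi> ` X \<subseteq> Y \<and>
     (\<forall>p\<in>X. \<exists>U d m F. openin (zariski X) U \<and> p \<in> U \<and> (\<forall>i\<le>m. homogeneous d (F i)) \<and>
        (\<forall>q\<in>U. \<phi> q = form_map m F q))"

definition isomorphic :: "'k::field point set \<Rightarrow> 'k point set \<Rightarrow> bool" where
  "isomorphic X Y \<longleftrightarrow> (\<exists>\<phi> \<psi>. regular_map X Y \<phi> \<and> regular_map Y X \<psi> \<and>
     (\<forall>x\<in>X. \<psi> (\<phi> x) = x) \<and> (\<forall>y\<in>Y. \<phi> (\<psi> y) = y))"

text \<open>A rational map between irreducible \<open>X\<close> and \<open>Y\<close> is given by a representative \<open>(U, \<phi>)\<close>,
  regular on the non-empty open \<open>U \<subseteq> X\<close>.\<close>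

definition rational_map ::
  "'k::field point set \<Rightarrow> 'k point set \<Rightarrow> 'k point set \<Rightarrow> ('k point \<Rightarrow> 'k point) \<Rightarrow> bool" where
  "rational_map X Y U \<phi> \<longleftrightarrow> openin (zariski X) U \<and> U \<noteq> {} \<and> regular_map U Y \<phi>"

text \<open>Both composites are defined somewhere and equal the identity as rational maps.\<close>

definition rational_inverse ::
  "'k::field point set \<Rightarrow> 'k point set \<Rightarrow> 'k point set \<Rightarrow> ('k point \<Rightarrow> 'k point) \<Rightarrow>
   'k point set \<Rightarrow> ('k point \<Rightarrow> 'k point) \<Rightarrow> bool" where
  "rational_inverse X Y U \<phi> V \<psi> \<longleftrightarrow> rational_map X Y U \<phi> \<and> rational_map Y X V \<psi> \<and>
     (\<exists>x\<in>U. \<phi> x \<in> V) \<and> (\<forall>x\<in>U. \<phi> x \<in> V \<longrightarrow> \<psi> (\<phi> x) = x) \<and>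
     (\<exists>y\<in>V. \<psi> y \<in> U) \<and> (\<forall>y\<in>V. \<psi> y \<in> U \<longrightarrow> \<phi> (\<psi> y) = y)"

definition birational ::
  "'k::field point set \<Rightarrow> 'k point set \<Rightarrow> 'k point set \<Rightarrow> ('k point \<Rightarrow> 'k point) \<Rightarrow> bool" where
  "birational X Y U \<phi> \<longleftrightarrow> (\<exists>V \<psi>. rational_inverse X Y U \<phi> V \<psi>)"

text \<open>\<open>form_map m l\<close> is a projection of \<open>\<bbbP>\<^sup>n\<close> to \<open>\<bbbP>\<^sup>m\<close> from the centre \<open>L\<close>: the \<open>l\<^sub>i\<close> are linearly
  independent linear forms cutting out \<open>L\<close>. (It is determined by \<open>L\<close> up to a choice of coordinates
  on the target.)\<close>

definition projection_forms ::
  "nat \<Rightarrow> nat \<Rightarrow> 'k::field point set \<Rightarrow> (nat \<Rightarrow> 'k mpol) \<Rightarrow> bool" where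
  "projection_forms n m L l \<longleftrightarrow> (\<forall>i\<le>m. l i \<in> forms n 1) \<and>
     (\<forall>c. (\<Sum>i\<le>m. Poly_Mapping.single 0 (c i) * l i) = 0 \<longrightarrow> (\<forall>i\<le>m. c i = 0)) \<and>
     L = {p\<in>proj n. \<forall>i\<le>m. zero_at (l i) p}"

text \<open>The rational map \<open>(V, \<psi>)\<close> from \<open>\<bbbP>\<^sup>n\<close> to a subvariety of \<open>\<bbbP>\<^sup>m\<close> is \<open>[f\<^sub>0 : \<dots> : f\<^sub>m]\<close> with forms
  \<open>f\<^sub>i\<close> of the same degree \<open>d\<close> and without common factor; this makes the linear system spanned by
  the \<open>f\<^sub>i\<close> the (unique) one without fixed components that defines \<open>\<psi>\<close>.\<close>

definition defined_by_forms ::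
  "nat \<Rightarrow> nat \<Rightarrow> nat \<Rightarrow> (nat \<Rightarrow> 'k::field mpol) \<Rightarrow> 'k point set \<Rightarrow> ('k point \<Rightarrow> 'k point) \<Rightarrow> bool" where
  "defined_by_forms n m d f V \<psi> \<longleftrightarrow> (\<forall>i\<le>m. f i \<in> forms n d) \<and>
     (\<forall>g. (\<forall>i\<le>m. g dvd f i) \<longrightarrow> g dvd 1) \<and>
     (\<exists>U. openin (zariski V) U \<and> U \<noteq> {} \<and> (\<forall>p\<in>U. \<psi> p = form_map m f p))"

section \<open>Ideal sheaves and blowing-up\<close>

text \<open>Sheaves of functions on \<open>X\<close> are maps from open sets to sets of functions. Sections over
  \<open>U\<close> are represented by functions on all points, whose values outside \<open>U\<close> are irrelevant.\<close>

type_synonym 'k function_sheaf = "'k point set \<Rightarrow> ('k point \<Rightarrow> 'k) set"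

text \<open>\<open>s\<close> is the quotient \<open>F/H\<close> of two forms of the same degree on \<open>V\<close>, with \<open>H\<close> nowhere zero.\<close>

definition is_quotient_on ::
  "'k::field mpol \<Rightarrow> 'k mpol \<Rightarrow> 'k point set \<Rightarrow> ('k point \<Rightarrow> 'k) \<Rightarrow> bool" where
  "is_quotient_on F H V s \<longleftrightarrow> (\<exists>d. homogeneous d F \<and> homogeneous d H) \<and>
     (\<forall>q\<in>V. nonzero_at H q \<and> (\<forall>v\<in>q. s q = peval F v / peval H v))"

definition structure_sheaf :: "'k::field point set \<Rightarrow> 'k function_sheaf" where
  "structure_sheaf X U = {s. \<forall>p\<in>U. \<exists>V F H. openin (zariski X) V \<and> p \<in> V \<and> V \<subseteq> U \<and>
     is_quotient_on F H V s}"

text \<open>The ideal sheaf on \<open>X\<close> generated by local sections: \<open>G V\<close> is the set of given generators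
  over \<open>V\<close>.\<close>

definition generated_ideal :: "'k::field point set \<Rightarrow> 'k function_sheaf \<Rightarrow> 'k function_sheaf" where
  "generated_ideal X G U = {s. \<forall>p\<in>U. \<exists>V T a. openin (zariski X) V \<and> p \<in> V \<and> V \<subseteq> U \<and>
     finite T \<and> T \<subseteq> G V \<and> (\<forall>g\<in>T. a g \<in> structure_sheaf X V) \<and>
     (\<forall>q\<in>V. s q = (\<Sum>g\<in>T. a g q * g q))}"

text \<open>The ideal sheaf of the closed subset \<open>Z\<close> of \<open>X\<close> with its reduced structure.\<close>

definition ideal_of_subvariety ::
  "'k::field point set \<Rightarrow> 'k point set \<Rightarrow> 'k function_sheaf" where
  "ideal_of_subvariety X Z U = {s\<in>structure_sheaf X U. \<forall>q\<in>U \<inter> Z. s q = 0}"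

text \<open>The ideal sheaf of the scheme-theoretic base locus in \<open>\<bbbP>\<^sup>n\<close> of a linear system \<open>\<Sigma>\<close> of forms:
  the common zero scheme of the members of \<open>\<Sigma>\<close>, with its possibly non-reduced structure.\<close>

definition base_ideal :: "nat \<Rightarrow> 'k::field mpol set \<Rightarrow> 'k function_sheaf" where
  "base_ideal n \<Sigma> = generated_ideal (proj n) (\<lambda>V. {s. \<exists>F\<in>\<Sigma>. \<exists>H. is_quotient_on F H V s})"

text \<open>The inverse image ideal sheaf of \<open>I\<close> under \<open>\<phi> : W \<rightarrow> X\<close>, usually written
  \<open>\<phi>\<^bsup>-1\<^esup>I \<cdot> \<O>\<^sub>W\<close>.\<close>

definition inverse_image_ideal ::
  "'k::field point set \<Rightarrow> 'k point set \<Rightarrow> ('k point \<Rightarrow> 'k point) \<Rightarrow> 'k function_sheaf \<Rightarrow>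
   'k function_sheaf" where
  "inverse_image_ideal W X \<phi> I = generated_ideal W (\<lambda>V. {s. \<exists>U b. openin (zariski X) U \<and>
     \<phi> ` V \<subseteq> U \<and> b \<in> I U \<and> (\<forall>q\<in>V. s q = b (\<phi> q))})"

text \<open>\<open>J\<close> is an invertible sheaf: locally, multiplication by some section \<open>h\<close> is an isomorphism from
  the structure sheaf to \<open>J\<close>.\<close>

definition invertible_ideal :: "'k::field point set \<Rightarrow> 'k function_sheaf \<Rightarrow> bool" where
  "invertible_ideal W J \<longleftrightarrow> (\<forall>p\<in>W. \<exists>V h. openin (zariski W) V \<and> p \<in> V \<and>
     (\<forall>V'. openin (zariski W) V' \<and> V' \<subseteq> V \<longrightarrow>
        J V' = {s. \<exists>a\<in>structure_sheaf W V'. \<forall>q\<in>V'. s q = a q * h q} \<and>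
        (\<forall>a\<in>structure_sheaf W V'. (\<forall>q\<in>V'. a q * h q = 0) \<longrightarrow> (\<forall>q\<in>V'. a q = 0))))"

text \<open>\<open>\<pi> : Y \<rightarrow> X\<close> is the blowing-up of \<open>X\<close> along the closed subscheme with ideal sheaf \<open>I\<close>,
  by its universal property: \<open>\<pi>\<close> makes the inverse image of \<open>I\<close> invertible, and every morphism doing
  so factors uniquely through \<open>\<pi>\<close>. The test objects are the quasi-projective algebraic sets. The
  usual blowing-up of a quasi-projective algebraic set is again one and has the universal property
  with respect to all schemes, so it is the object (unique up to isomorphism) characterised here.\<close>

definition is_blowup ::
  "'k::field point set \<Rightarrow> 'k function_sheaf \<Rightarrow> 'k point set \<Rightarrow> ('k point \<Rightarrow> 'k point) \<Rightarrow> bool" where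
  "is_blowup X I Y \<pi> \<longleftrightarrow> quasi_projective X \<and> quasi_projective Y \<and> regular_map Y X \<pi> \<and>
     invertible_ideal Y (inverse_image_ideal Y X \<pi> I) \<and>
     (\<forall>W \<phi>. quasi_projective W \<and> regular_map W X \<phi> \<and>
         invertible_ideal W (inverse_image_ideal W X \<phi> I) \<longrightarrow>
        (\<exists>\<psi>. regular_map W Y \<psi> \<and> (\<forall>w\<in>W. \<pi> (\<psi> w) = \<phi> w)) \<and>
        (\<forall>\<psi> \<psi>'. regular_map W Y \<psi> \<and> (\<forall>w\<in>W. \<pi> (\<psi> w) = \<phi> w) \<and>
                 regular_map W Y \<psi>' \<and> (\<forall>w\<in>W. \<pi> (\<psi>' w) = \<phi> w) \<longrightarrow>
            (\<forall>w\<in>W. \<psi> w = \<psi>' w)))"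

text \<open>\<open>X\<close> is a blowing-down of \<open>P\<close>: \<open>P\<close> is isomorphic to a blowing-up of \<open>X\<close> along a closed
  subvariety (irreducible and reduced).\<close>

definition blowing_down :: "'k::field point set \<Rightarrow> 'k point set \<Rightarrow> bool" where
  "blowing_down X P \<longleftrightarrow> (\<exists>Z Y \<rho>. closedin (zariski X) Z \<and> irreducible_in (zariski X) Z \<and>
     is_blowup X (ideal_of_subvariety X Z) Y \<rho> \<and> isomorphic P Y)"

end

theory Submission
  imports Defs "HOL-Analysis.Abstract_Limits"
begin

text \<open>The blowing-up of a closed \<open>X \<subseteq> \<bbbP>\<^sup>n\<close> along the subscheme cut out by forms \<open>f\<^sub>0, \<dots>, f\<^sub>m\<close> of one
  degree is the closure, in \<open>X \<times> \<bbbP>\<^sup>m\<close>, of the graph of \<open>[f\<^sub>0 : \<dots> : f\<^sub>m]\<close>. The line \<open>L\<close> is cut out on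
  \<open>X\<close> by the four linear forms defining \<open>\<pi>\<^sub>L\<close>, so the blowing-up of \<open>X\<close> along \<open>L\<close> is the closure of the
  graph of \<open>\<pi>\<^sub>L\<close>; the blowing-up of \<open>\<bbbP>\<^sup>3\<close> along the base scheme of \<open>\<Sigma>\<close> is the closure of the graph of
  \<open>\<pi>\<^sub>L\<^sup>-\<^sup>1\<close>. Exchanging the factors identifies the two, because the graphs of mutually inverse
  birational maps agree on a dense open subset.\<close>

section \<open>Forms as functions\<close>

text \<open>The universal property is tested on arbitrary quasi-projective sets \<open>W\<close>,
  possibly reducible, so agreement on a dense open set must be replaced by something local and
  algebraic. This is the role of the generator \<open>h\<close> of an invertible inverse image
  ideal: it is a nonzerodivisor, and off its zeros the lift to the graph closure is forced.
  Membership of the lift in the closure, independence of local choices and uniqueness are all proved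
  in one way: multiply a regular function by \<open>h\<close>, see that the product vanishes, cancel
  \<open>h\<close>.

  An ideal enters only through being generated by the dehomogenised forms f_j / x_i^d. For the base
  scheme this is a matter of clearing denominators. For the line it is a theorem: the blowing-down
  uses the reduced structure of \<open>L\<close>, so every regular function vanishing on
  \<open>L\<close> has to be a combination of the four linear forms, and this uses that
  \<open>L\<close> is linear.

  Forms are replaced by their value functions, because points, zero sets and regular functions only
  see values and because substitution, needed for composing maps and for Segre coordinates, is then
  composition of functions.\<close>

definition is_form :: "nat \<Rightarrow> ((nat \<Rightarrow> 'k::field) \<Rightarrow> 'k) \<Rightarrow> bool" where
  "is_form d g \<longleftrightarrow> (\<exists>F. homogeneous d F \<and> g = peval F)"

lemma is_form_peval: "homogeneous d F \<Longrightarrow> is_form d (peval F)"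
  unfolding is_form_def by blast

lemma is_form_zero [simp]: "is_form d (\<lambda>v. 0)"
  unfolding is_form_def by (rule exI[of _ 0]) (auto simp: homogeneous_def)

lemma is_form_const [simp]: "is_form 0 (\<lambda>v. c)"
  unfolding is_form_def
  by (rule exI[of _ "Poly_Mapping.single 0 c"])
    (auto simp: homogeneous_def monom_degree_def peval_single eval_monom_def)

lemma is_form_var [simp]: "is_form (Suc 0) (\<lambda>v. v i)"
  unfolding is_form_def
  by (rule exI[of _ "Poly_Mapping.single (Poly_Mapping.single i 1) 1"])
    (auto simp: homogeneous_def monom_degree_def peval_single eval_monom_def)

lemma is_form_add [intro]:
  assumes "is_form d g" "is_form d h" shows "is_form d (\<lambda>v. g v + h v)"
proof -
  obtain F G where "homogeneous d F" "g = peval F" "homogeneous d G" "h = peval G"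
    using assms unfolding is_form_def by blast
  then have "homogeneous d (F + G)" "(\<lambda>v. g v + h v) = peval (F + G)"
    using Poly_Mapping.keys_add[of F G] by (auto simp: homogeneous_def peval_add)
  then show ?thesis unfolding is_form_def by blast
qed

lemma is_form_mult [intro]:
  assumes "is_form d g" "is_form e h" shows "is_form (d + e) (\<lambda>v. g v * h v)"
proof -
  obtain F G where "homogeneous d F" "g = peval F" "homogeneous e G" "h = peval G"
    using assms unfolding is_form_def by blast
  then have "homogeneous (d + e) (F * G)" "(\<lambda>v. g v * h v) = peval (F * G)"
    using homogeneous_mult by (auto simp: peval_mult)
  then show ?thesis unfolding is_form_def by blast
qed

lemma is_form_cmult [intro]: "is_form d g \<Longrightarrow> is_form d (\<lambda>v. c * g v)"
  using is_form_mult[OF is_form_const, of d g c] by simp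

lemma is_form_diff [intro]: "is_form d g \<Longrightarrow> is_form d h \<Longrightarrow> is_form d (\<lambda>v. g v - h v)"
  using is_form_add[of d g "\<lambda>v. - 1 * h v"] is_form_cmult[of d h "- 1"] by simp

lemma is_form_sum [intro]:
  "(\<And>i. i \<in> A \<Longrightarrow> is_form d (g i)) \<Longrightarrow> is_form d (\<lambda>v. \<Sum>i\<in>A. g i v)"
  by (induction A rule: infinite_finite_induct) auto

lemma is_form_power [intro]: "is_form d g \<Longrightarrow> is_form (d * n) (\<lambda>v. g v ^ n)"
  by (induction n) (auto dest: is_form_mult)

lemma is_form_if: "(b \<Longrightarrow> is_form d g) \<Longrightarrow> is_form d (\<lambda>v. if b then g v else 0)"
  by (cases b) auto

lemma is_form_induct [consumes 1, case_names zero const add var]: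
  assumes "is_form d g"
    and z: "\<And>d. P d (\<lambda>v. 0)"
    and c: "\<And>c. P 0 (\<lambda>v. c)"
    and a: "\<And>d g h. is_form d g \<Longrightarrow> P d g \<Longrightarrow> is_form d h \<Longrightarrow> P d h \<Longrightarrow> P d (\<lambda>v. g v + h v)"
    and x: "\<And>d g i. is_form d g \<Longrightarrow> P d g \<Longrightarrow> P (Suc d) (\<lambda>v. v i * g v)"
  shows "P d g"
proof -
  \<comment> \<open>The predicate is strengthened by \<open>is_form\<close>, since the rules for
    sums and for variables demand it of their arguments.\<close>
  define Q where "Q d g \<longleftrightarrow> is_form d g \<and> P d g" for d g
  have Qz: "Q d (\<lambda>v. 0)" and Qc: "Q 0 (\<lambda>v. c)" for d c
    using z c by (auto simp: Q_def)
  have Qa: "Q d (\<lambda>v. g v + h v)" if "Q d g" "Q d h" for d g h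
    using a that by (auto simp: Q_def)
  have Qx: "Q (Suc d) (\<lambda>v. v i * g v)" if "Q d g" for d g i
    using x that is_form_mult[OF is_form_var[of i], of d g] by (auto simp: Q_def)
  have pow: "Q (n + d) (\<lambda>v. v i ^ n * g v)" if "Q d g" for d g i n
    by (induction n) (use that in \<open>auto simp: mult.assoc intro: Qx\<close>)
  have mon: "Q (sum e A) (\<lambda>v. c * (\<Prod>i\<in>A. v i ^ e i))" if "finite A" for A and e :: "nat \<Rightarrow> nat" and c
    using that
  proof (induction A rule: finite_induct)
    case (insert j A)
    have "Q (e j + sum e A) (\<lambda>v. v j ^ e j * (c * (\<Prod>i\<in>A. v i ^ e i)))"
      by (rule pow[OF insert.IH])
    then show ?case using insert.hyps by (simp add: mult.left_commute)
  qed (simp add: Qc)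
  have sum: "Q d (\<lambda>v. \<Sum>i\<in>A. h i v)" if "\<And>i. i \<in> A \<Longrightarrow> Q d (h i)" "finite A"
    for A :: "(nat \<Rightarrow>\<^sub>0 nat) set" and h d
    using that(2,1) by (induction A rule: finite_induct) (auto intro: Qz Qa)
  obtain F where F: "homogeneous d F" "g = peval F"
    using assms(1) unfolding is_form_def by blast
  have "Q d (\<lambda>v. \<Sum>m\<in>Poly_Mapping.keys F. Poly_Mapping.lookup F m * eval_monom m v)"
  proof (rule sum)
    fix m assume "m \<in> Poly_Mapping.keys F"
    then have "d = (\<Sum>i\<in>Poly_Mapping.keys m. Poly_Mapping.lookup m i)"
      using F(1) by (auto simp: homogeneous_def monom_degree_def)
    then show "Q d (\<lambda>v. Poly_Mapping.lookup F m * eval_monom m v)"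
      using mon[OF finite_keys[of m]] by (simp add: eval_monom_def)
  qed simp
  then show ?thesis using F(2) by (simp add: Q_def peval_def[abs_def])
qed

lemma is_form_subst:
  assumes "is_form D g" "\<And>i. is_form e (h i)"
  shows "is_form (D * e) (\<lambda>v. g (\<lambda>i. h i v))"
  using assms(1)
proof (induction rule: is_form_induct)
  case (var d g i)
  show ?case using is_form_mult[OF assms(2)[of i] var.IH] by simp
qed auto

lemma is_form_scale:
  assumes "is_form d g" shows "g (scale_vec c v) = c ^ d * g v"
  using assms by (induction rule: is_form_induct) (auto simp: scale_vec_def algebra_simps)

text \<open>On a line a form is a univariate polynomial in the parameter, so it has only finitely
  many zeros there unless it vanishes on the whole line.\<close>

lemma is_form_line:
  assumes "is_form d g" shows "\<exists>P. \<forall>t. g (\<lambda>i. u i + t * w i) = poly P t"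
  using assms
proof (induction rule: is_form_induct)
  case zero
  show ?case by (rule exI[of _ 0]) simp
next
  case (const c)
  show ?case by (rule exI[of _ "[:c:]"]) simp
next
  case (add d g h)
  then obtain P Q where "\<forall>t. g (\<lambda>i. u i + t * w i) = poly P t" "\<forall>t. h (\<lambda>i. u i + t * w i) = poly Q t"
    by blast
  then show ?case by (intro exI[of _ "P + Q"]) simp
next
  case (var d g i)
  then obtain P where "\<forall>t. g (\<lambda>i. u i + t * w i) = poly P t"
    by blast
  then show ?case by (intro exI[of _ "[:u i, w i:] * P"]) (simp add: algebra_simps)
qed

text \<open>A common non-zero is found on the line joining a non-zero of each form.\<close>

lemma is_form_common_nonzero:
  fixes g h :: "(nat \<Rightarrow> 'k::field_char_0) \<Rightarrow> 'k"
  assumes "is_form d g" "is_form e h" "vec.subspace W" "u \<in> W" "w \<in> W" "g u \<noteq> 0" "h w \<noteq> 0"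
  shows "\<exists>v\<in>W. g v \<noteq> 0 \<and> h v \<noteq> 0"
proof -
  let ?l = "\<lambda>t i. u i + t * (w i - u i)"
  obtain P Q where P: "\<And>t. g (?l t) = poly P t" and Q: "\<And>t. h (?l t) = poly Q t"
    using is_form_line[OF assms(1), of u "w - u"] is_form_line[OF assms(2), of u "w - u"] by auto
  have "P \<noteq> 0" using P[of 0] assms(6) by auto
  moreover have "Q \<noteq> 0" using Q[of 1] assms(7) by auto
  ultimately have "P * Q \<noteq> 0" by simp
  then have "finite {t. poly (P * Q) t = 0}" by (rule poly_roots_finite)
  then obtain t where "poly (P * Q) t \<noteq> 0"
    using infinite_UNIV_char_0[where 'a = 'k] by (metis (mono_tags, lifting) UNIV_eq_I mem_Collect_eq)
  moreover have "?l t \<in> W"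
  proof -
    have "?l t = u + scale_vec t (w - u)" by (auto simp: scale_vec_def)
    then show ?thesis using assms(3-5) by (simp add: vec.subspace_add vec.subspace_scale vec.subspace_diff)
  qed
  ultimately show ?thesis using P Q by (intro bexI[of _ "?l t"]) auto
qed

lemma subspace_coords: "vec.subspace (coords n)"
  by (auto simp: vec.subspace_def coords_def scale_vec_def)

section \<open>Points and germs of regular functions\<close>

text \<open>No bound on the number of coordinates is recorded: local arguments need only the class
  of a nonzero vector, and so they apply to subsets of every projective space at once.\<close>

definition pointlike :: "'k::field point \<Rightarrow> bool" where
  "pointlike p \<longleftrightarrow> (\<exists>v. v \<noteq> 0 \<and> p = pt v)"

lemma in_pt: "w \<in> pt v \<longleftrightarrow> (\<exists>c. c \<noteq> 0 \<and> w = scale_vec c v)"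
  by (auto simp: pt_def)

lemma self_in_pt [simp]: "v \<in> pt v"
  unfolding in_pt by (rule exI[of _ 1]) (auto simp: scale_vec_def)

lemma pt_scale: "c \<noteq> 0 \<Longrightarrow> pt (scale_vec c v) = pt v"
proof -
  assume c: "c \<noteq> 0"
  have "\<exists>b. b \<noteq> 0 \<and> scale_vec a v = scale_vec b (scale_vec c v)" if "a \<noteq> 0" for a
    using that c by (intro exI[of _ "a / c"]) (auto simp: scale_vec_def)
  moreover have "\<exists>b. b \<noteq> 0 \<and> scale_vec a (scale_vec c v) = scale_vec b v" if "a \<noteq> 0" for a
    using that c by (intro exI[of _ "a * c"]) (auto simp: scale_vec_def)
  ultimately show ?thesis
    by (intro set_eqI) (metis in_pt)
qed

lemma pt_eqI: "w \<in> pt v \<Longrightarrow> pt w = pt v"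
  using pt_scale in_pt by metis

lemma pt_eq_iff: "pt w = pt v \<longleftrightarrow> (\<exists>c. c \<noteq> 0 \<and> w = scale_vec c v)"
  by (metis in_pt pt_eqI self_in_pt)

text \<open>Vanishing of the 2 x 2 minors is the equational form of equality of points. It lets an
  equality of points be established through regular functions, to which cancellation of a
  nonzerodivisor applies.\<close>

lemma pt_proportional:
  assumes "v \<noteq> 0" "w \<noteq> 0" "\<And>i j. v i * w j = v j * w i"
  shows "pt v = pt w"
proof -
  obtain i where i: "v i \<noteq> 0" using assms(1) by (auto simp: fun_eq_iff)
  have "w i \<noteq> 0"
  proof
    assume "w i = 0"
    then have "w j = 0" for j using assms(3)[of i j] i by simp
    then show False using assms(2) by (auto simp: fun_eq_iff)
  qed
  moreover have "v = scale_vec (v i / w i) w"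
  proof
    fix j
    have "v j * w i = v i * w j" using assms(3)[of i j] by simp
    then show "v j = scale_vec (v i / w i) w j"
      using \<open>w i \<noteq> 0\<close> by (simp add: scale_vec_def nonzero_eq_divide_eq)
  qed
  moreover have "v i / w i \<noteq> 0" using i calculation(1) by simp
  ultimately show ?thesis using pt_scale by metis
qed

lemma pointlike_pt [simp]: "pointlike (pt v) \<longleftrightarrow> v \<noteq> 0"
proof -
  have "v \<noteq> 0" if "w \<noteq> 0" "pt v = pt w" for w
    using that unfolding pt_eq_iff by (auto simp: scale_vec_def fun_eq_iff)
  then show ?thesis unfolding pointlike_def by blast
qed

lemma pointlike_in:
  assumes "pointlike p" "v \<in> p" shows "p = pt v" "v \<noteq> 0"
  using assms pt_eqI pointlike_pt by (metis pointlike_def)+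

lemma pointlike_ex: "pointlike p \<Longrightarrow> \<exists>v. v \<in> p"
  unfolding pointlike_def using self_in_pt by blast

lemma proj_pointlike: "p \<in> proj n \<Longrightarrow> pointlike p"
  by (auto simp: proj_def)

lemma proj_coords: "p \<in> proj n \<Longrightarrow> v \<in> p \<Longrightarrow> v \<in> coords n"
  by (auto simp: proj_def in_pt coords_def scale_vec_def)

lemma pt_in_proj: "v \<noteq> 0 \<Longrightarrow> v \<in> coords n \<Longrightarrow> pt v \<in> proj n"
  by (auto simp: proj_def)

lemma is_form_zero_iff:
  assumes "is_form d g" "pointlike p" "v \<in> p" "w \<in> p"
  shows "g v = 0 \<longleftrightarrow> g w = 0"
proof -
  obtain c where "c \<noteq> 0" "v = scale_vec c w"
    using assms(2-4) pointlike_in in_pt by metis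
  then show ?thesis using is_form_scale[OF assms(1)] by simp
qed

lemma is_form_quotient_eq:
  assumes "is_form d g" "is_form d h" "pointlike p" "v \<in> p" "w \<in> p"
  shows "g v / h v = g w / h w"
proof -
  obtain c where "c \<noteq> 0" "v = scale_vec c w"
    using assms(3-5) pointlike_in in_pt by metis
  then show ?thesis using is_form_scale[OF assms(1)] is_form_scale[OF assms(2)] by simp
qed

lemma is_form_pt_eq:
  assumes "\<And>i. is_form d (g i)" "pointlike p" "v \<in> p" "w \<in> p"
  shows "pt (\<lambda>i. g i v) = pt (\<lambda>i. g i w)"
proof -
  obtain c where c: "c \<noteq> 0" "v = scale_vec c w"
    using assms(2-4) pointlike_in in_pt by metis
  then have "(\<lambda>i. g i v) = scale_vec (c ^ d) (\<lambda>i. g i w)"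
    using is_form_scale[OF assms(1)] by (auto simp: scale_vec_def)
  then show ?thesis using pt_scale[of "c ^ d"] c by simp
qed

section \<open>Neighbourhood filters of the Zariski topology\<close>

abbreviation points :: "'k::field point set \<Rightarrow> bool" where
  "points X \<equiv> (\<forall>p\<in>X. pointlike p)"

text \<open>Filters absorb the repeated shrinking of open sets: facts that hold near
  \<open>p\<close> are combined by \<open>eventually_elim\<close> without naming a common
  neighbourhood.\<close>

abbreviation zariski_nhds :: "'k::field point set \<Rightarrow> 'k point \<Rightarrow> 'k point filter" where
  "zariski_nhds X p \<equiv> nhdsin (zariski X) p"

lemma zero_at_iff:
  assumes "homogeneous d F" "pointlike p" "v \<in> p"
  shows "zero_at F p \<longleftrightarrow> peval F v = 0" "nonzero_at F p \<longleftrightarrow> peval F v \<noteq> 0"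
  using is_form_zero_iff[OF is_form_peval[OF assms(1)] assms(2) _ assms(3)] assms(3)
  unfolding zero_at_def nonzero_at_def by blast+

lemma openin_zariski_basic:
  assumes "is_form d g" shows "openin (zariski X) {p\<in>X. \<forall>v\<in>p. g v \<noteq> 0}"
proof -
  obtain F where "homogeneous d F" "g = peval F" using assms is_form_def by blast
  then show ?thesis
    unfolding openin_zariski by (intro exI[of _ "{F}"]) (auto simp: nonzero_at_def)
qed

lemma eventually_nhds_zariski:
  "p \<in> X \<Longrightarrow> eventually P (zariski_nhds X p) \<longleftrightarrow> (\<exists>U. openin (zariski X) U \<and> p \<in> U \<and> (\<forall>q\<in>U. P q))"
  by (auto simp: eventually_nhdsin)

lemma eventually_nhds_zariski_self: "p \<in> X \<Longrightarrow> eventually P (zariski_nhds X p) \<Longrightarrow> P p"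
  by (auto simp: eventually_nhds_zariski)

lemma eventually_nhds_zariski_mem: "p \<in> X \<Longrightarrow> eventually (\<lambda>q. q \<in> X) (zariski_nhds X p)"
  unfolding eventually_nhds_zariski by (rule exI[of _ X]) (metis openin_topspace topspace_zariski)

lemma eventually_nhds_zariski_open: "openin (zariski X) U \<Longrightarrow> p \<in> U \<Longrightarrow> eventually (\<lambda>q. q \<in> U) (zariski_nhds X p)"
  using openin_subset[of "zariski X" U] by (subst eventually_nhds_zariski) auto

lemma eventually_nhds_zariski_eventually:
  assumes "p \<in> X" "eventually P (zariski_nhds X p)"
  shows "eventually (\<lambda>q. q \<in> X \<and> eventually P (zariski_nhds X q)) (zariski_nhds X p)"
proof -
  obtain U where U: "openin (zariski X) U" "p \<in> U" "\<forall>q\<in>U. P q"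
    using assms by (auto simp: eventually_nhds_zariski)
  show ?thesis
    using eventually_nhds_zariski_open[OF U(1,2)]
  proof eventually_elim
    case (elim q)
    then show ?case
      using U openin_subset[OF U(1)] by (subst eventually_nhds_zariski) auto
  qed
qed

lemma eventually_nhds_zariski_basic:
  assumes "is_form d g" "points X" "p \<in> X" "v \<in> p" "g v \<noteq> 0"
  shows "eventually (\<lambda>q. \<forall>v\<in>q. g v \<noteq> 0) (zariski_nhds X p)"
  unfolding eventually_nhds_zariski[OF assms(3)]
  using openin_zariski_basic[OF assms(1), of X] assms is_form_zero_iff[OF assms(1)]
  by (intro exI[of _ "{p\<in>X. \<forall>v\<in>p. g v \<noteq> 0}"]) blast

text \<open>Non-vanishing loci of single forms are a base of the topology. The form \<open>g\<close>
  obtained here is later multiplied into other forms, which turns a statement near \<open>p\<close>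
  into a vanishing statement without restriction to a neighbourhood.\<close>

lemma zariski_nhds_basic:
  assumes "points X" "p \<in> X" "eventually P (zariski_nhds X p)"
  shows "\<exists>d g. is_form d g \<and> (\<forall>v\<in>p. g v \<noteq> 0) \<and> (\<forall>q\<in>X. \<forall>v\<in>q. g v \<noteq> 0 \<longrightarrow> P q)"
proof -
  obtain U where U: "openin (zariski X) U" "p \<in> U" "\<forall>q\<in>U. P q"
    using assms by (auto simp: eventually_nhds_zariski)
  then obtain S where S: "\<forall>F\<in>S. \<exists>d. homogeneous d F" "U = {p\<in>X. \<exists>F\<in>S. nonzero_at F p}"
    unfolding openin_zariski by blast
  then obtain F d where F: "F \<in> S" "homogeneous d F" "nonzero_at F p"
    using U(2) by blast
  show ?thesis
  proof (intro exI conjI ballI impI)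
    show "is_form d (peval F)" by (rule is_form_peval) fact
    show "peval F v \<noteq> 0" if "v \<in> p" for v
      using F that by (auto simp: nonzero_at_def)
    show "P q" if "q \<in> X" "v \<in> q" "peval F v \<noteq> 0" for q v
    proof -
      have "nonzero_at F q" using zero_at_iff(2)[OF F(2)] assms(1) that by blast
      then show ?thesis using S F U(3) that by blast
    qed
  qed
qed

lemma openin_zariski_nhds_iff:
  "openin (zariski X) U \<longleftrightarrow> U \<subseteq> X \<and> (\<forall>p\<in>U. eventually (\<lambda>q. q \<in> U) (zariski_nhds X p))"
proof
  assume "openin (zariski X) U"
  then show "U \<subseteq> X \<and> (\<forall>p\<in>U. eventually (\<lambda>q. q \<in> U) (zariski_nhds X p))"
    using openin_subset[of "zariski X" U] eventually_nhds_zariski_open by auto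
next
  assume *: "U \<subseteq> X \<and> (\<forall>p\<in>U. eventually (\<lambda>q. q \<in> U) (zariski_nhds X p))"
  show "openin (zariski X) U"
  proof (subst openin_subopen, intro ballI)
    fix p assume p: "p \<in> U"
    then have "p \<in> X" using * by blast
    then show "\<exists>T. openin (zariski X) T \<and> p \<in> T \<and> T \<subseteq> U"
      using * p eventually_nhds_zariski[of p X "\<lambda>q. q \<in> U"] by (auto simp: subset_iff)
  qed
qed

text \<open>Regularity as a property of the germ at \<open>p\<close>. Quantifying over all
  representatives \<open>v\<close> of \<open>q\<close> avoids a choice; for forms of equal degree
  the quotient does not depend on it.\<close>

definition reg_at :: "'k::field point set \<Rightarrow> 'k point \<Rightarrow> ('k point \<Rightarrow> 'k) \<Rightarrow> bool" where
  "reg_at X p s \<longleftrightarrow> (\<exists>d F H. is_form d F \<and> is_form d H \<and>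
     (\<forall>\<^sub>F q in zariski_nhds X p. \<forall>v\<in>q. H v \<noteq> 0 \<and> s q = F v / H v))"

lemma reg_atI:
  assumes "is_form d F" "is_form d H" "\<forall>\<^sub>F q in zariski_nhds X p. \<forall>v\<in>q. H v \<noteq> 0 \<and> s q = F v / H v"
  shows "reg_at X p s"
  using assms unfolding reg_at_def by blast

lemma reg_at_cong:
  assumes "reg_at X p s" "\<forall>\<^sub>F q in zariski_nhds X p. s q = t q"
  shows "reg_at X p t"
proof -
  obtain d F H where 1: "is_form d F" "is_form d H" "\<forall>\<^sub>F q in zariski_nhds X p. \<forall>v\<in>q. H v \<noteq> 0 \<and> s q = F v / H v"
    using assms unfolding reg_at_def by blast
  from 1(3) assms(2) have "\<forall>\<^sub>F q in zariski_nhds X p. \<forall>v\<in>q. H v \<noteq> 0 \<and> t q = F v / H v"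
    by eventually_elim auto
  then show ?thesis using 1 reg_atI by blast
qed

lemma reg_at_const [simp, intro]: "reg_at X p (\<lambda>q. c)"
  by (rule reg_atI[of 0 "\<lambda>v. c" "\<lambda>v. 1"]) auto

lemma reg_at_add [intro]:
  assumes "reg_at X p s" "reg_at X p t"
  shows "reg_at X p (\<lambda>q. s q + t q)"
proof -
  obtain d F H where 1: "is_form d F" "is_form d H" "\<forall>\<^sub>F q in zariski_nhds X p. \<forall>v\<in>q. H v \<noteq> 0 \<and> s q = F v / H v"
    using assms unfolding reg_at_def by blast
  obtain e G K where 2: "is_form e G" "is_form e K" "\<forall>\<^sub>F q in zariski_nhds X p. \<forall>v\<in>q. K v \<noteq> 0 \<and> t q = G v / K v"
    using assms unfolding reg_at_def by blast
  show ?thesis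
  proof (rule reg_atI)
    show "is_form (d + e) (\<lambda>v. F v * K v + G v * H v)" "is_form (d + e) (\<lambda>v. H v * K v)"
      using 1 2 is_form_mult[OF 2(1) 1(2)] by (auto simp: add.commute)
    show "\<forall>\<^sub>F q in zariski_nhds X p. \<forall>v\<in>q. H v * K v \<noteq> 0 \<and> s q + t q = (F v * K v + G v * H v) / (H v * K v)"
      using 1(3) 2(3) by eventually_elim (auto simp: add_frac_eq)
  qed
qed

lemma reg_at_mult [intro]:
  assumes "reg_at X p s" "reg_at X p t"
  shows "reg_at X p (\<lambda>q. s q * t q)"
proof -
  obtain d F H where 1: "is_form d F" "is_form d H" "\<forall>\<^sub>F q in zariski_nhds X p. \<forall>v\<in>q. H v \<noteq> 0 \<and> s q = F v / H v"
    using assms unfolding reg_at_def by blast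
  obtain e G K where 2: "is_form e G" "is_form e K" "\<forall>\<^sub>F q in zariski_nhds X p. \<forall>v\<in>q. K v \<noteq> 0 \<and> t q = G v / K v"
    using assms unfolding reg_at_def by blast
  show ?thesis
  proof (rule reg_atI)
    show "is_form (d + e) (\<lambda>v. F v * G v)" "is_form (d + e) (\<lambda>v. H v * K v)"
      using 1 2 by auto
    show "\<forall>\<^sub>F q in zariski_nhds X p. \<forall>v\<in>q. H v * K v \<noteq> 0 \<and> s q * t q = (F v * G v) / (H v * K v)"
      using 1(3) 2(3) by eventually_elim auto
  qed
qed

lemma reg_at_diff [intro]: "reg_at X p s \<Longrightarrow> reg_at X p t \<Longrightarrow> reg_at X p (\<lambda>q. s q - t q)"
  using reg_at_add[of X p s "\<lambda>q. - 1 * t q"] reg_at_mult[OF reg_at_const, of X p t "- 1"] by simp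

lemma reg_at_sum [intro]:
  "(\<And>i. i \<in> A \<Longrightarrow> reg_at X p (s i)) \<Longrightarrow> reg_at X p (\<lambda>q. \<Sum>i\<in>A. s i q)"
  by (induction A rule: infinite_finite_induct) auto

lemma reg_at_eventually:
  assumes "p \<in> X" "reg_at X p s"
  shows "\<forall>\<^sub>F q in zariski_nhds X p. reg_at X q s"
proof -
  obtain d F H where 1: "is_form d F" "is_form d H" "\<forall>\<^sub>F q in zariski_nhds X p. \<forall>v\<in>q. H v \<noteq> 0 \<and> s q = F v / H v"
    using assms unfolding reg_at_def by blast
  from eventually_nhds_zariski_eventually[OF assms(1) 1(3)] show ?thesis
    by eventually_elim (use 1 reg_atI in blast)
qed

lemma reg_at_quotient:
  assumes "points X" "p \<in> X" "is_form d F" "is_form d H" "v \<in> p" "H v \<noteq> 0"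
    and "\<And>q v. q \<in> X \<Longrightarrow> v \<in> q \<Longrightarrow> H v \<noteq> 0 \<Longrightarrow> s q = F v / H v"
  shows "reg_at X p s"
proof (rule reg_atI)
  show "\<forall>\<^sub>F q in zariski_nhds X p. \<forall>v\<in>q. H v \<noteq> 0 \<and> s q = F v / H v"
    using eventually_nhds_zariski_basic[OF assms(4,1,2,5,6)] eventually_nhds_zariski_mem[OF assms(2)]
    by eventually_elim (use assms(7) in blast)
qed fact+

text \<open>Removes the structure sheaf from later arguments, which only manipulate germs.\<close>

lemma mem_structure_sheaf:
  assumes "openin (zariski X) U"
  shows "s \<in> structure_sheaf X U \<longleftrightarrow> (\<forall>p\<in>U. reg_at X p s)"
proof
  assume s: "s \<in> structure_sheaf X U"
  show "\<forall>p\<in>U. reg_at X p s"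
  proof
    fix p assume "p \<in> U"
    then obtain V F H where V: "openin (zariski X) V" "p \<in> V" "V \<subseteq> U" "is_quotient_on F H V s"
      using s unfolding structure_sheaf_def by blast
    then obtain d where d: "homogeneous d F" "homogeneous d H"
      unfolding is_quotient_on_def by blast
    show "reg_at X p s"
    proof (rule reg_atI[OF is_form_peval[OF d(1)] is_form_peval[OF d(2)]])
      show "\<forall>\<^sub>F q in zariski_nhds X p. \<forall>v\<in>q. peval H v \<noteq> 0 \<and> s q = peval F v / peval H v"
        using eventually_nhds_zariski_open[OF V(1,2)]
        by eventually_elim (use V(4) in \<open>auto simp: is_quotient_on_def nonzero_at_def\<close>)
    qed
  qed
next
  assume r: "\<forall>p\<in>U. reg_at X p s"
  show "s \<in> structure_sheaf X U"
    unfolding structure_sheaf_def mem_Collect_eq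
  proof
    fix p assume p: "p \<in> U"
    then have pX: "p \<in> X" using openin_subset[OF assms] by auto
    obtain d F H where 1: "is_form d F" "is_form d H" "\<forall>\<^sub>F q in zariski_nhds X p. \<forall>v\<in>q. H v \<noteq> 0 \<and> s q = F v / H v"
      using r p unfolding reg_at_def by blast
    obtain F' H' where 2: "homogeneous d F'" "F = peval F'" "homogeneous d H'" "H = peval H'"
      using 1 unfolding is_form_def by blast
    from 1(3) eventually_nhds_zariski_open[OF assms p]
    have "\<forall>\<^sub>F q in zariski_nhds X p. q \<in> U \<and> (\<forall>v\<in>q. H v \<noteq> 0 \<and> s q = F v / H v)"
      by eventually_elim auto
    then obtain V where V: "openin (zariski X) V" "p \<in> V"
      "\<And>q. q \<in> V \<Longrightarrow> q \<in> U \<and> (\<forall>v\<in>q. H v \<noteq> 0 \<and> s q = F v / H v)"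
      unfolding eventually_nhds_zariski[OF pX] by auto
    have "is_quotient_on F' H' V s"
      using V(3) 2 by (auto simp: is_quotient_on_def nonzero_at_def)
    moreover have "V \<subseteq> U" using V(3) by auto
    ultimately show "\<exists>V F H. openin (zariski X) V \<and> p \<in> V \<and> V \<subseteq> U \<and> is_quotient_on F H V s"
      using V(1,2) by metis
  qed
qed

section \<open>Regular maps\<close>

lemma form_map_eq:
  assumes "\<And>i. i \<le> m \<Longrightarrow> homogeneous d (F i)" "pointlike p" "v \<in> p"
  shows "form_map m F p = pt (\<lambda>i. if i \<le> m then peval (F i) v else 0)"
proof -
  have g: "is_form d (\<lambda>v. if i \<le> m then peval (F i) v else 0)" for i
    by (rule is_form_if) (rule is_form_peval, rule assms)
  have "pt (\<lambda>i. if i \<le> m then peval (F i) w else 0) = pt (\<lambda>i. if i \<le> m then peval (F i) v else 0)"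
    if "w \<in> p" for w
    by (rule is_form_pt_eq[OF g assms(2) that assms(3)])
  then have "form_map m F p = (\<Union>w\<in>p. pt (\<lambda>i. if i \<le> m then peval (F i) v else 0))"
    unfolding form_map_def by (intro SUP_cong refl)
  also have "\<dots> = pt (\<lambda>i. if i \<le> m then peval (F i) v else 0)"
    using assms(3) by (intro cSUP_const) blast
  finally show ?thesis .
qed

text \<open>The coordinate forms are continued by zero beyond index \<open>m\<close>, so the image
  point is the class of one full sequence and the case distinction in \<open>form_map\<close>
  disappears.\<close>

lemma regular_mapE:
  assumes "regular_map X Y \<phi>" "points X" "p \<in> X"
  obtains d m g where "\<And>i. is_form d (g i)" "\<And>i. i > m \<Longrightarrow> g i = (\<lambda>v. 0)"
    "\<forall>\<^sub>F q in zariski_nhds X p. \<forall>v\<in>q. \<phi> q = pt (\<lambda>i. g i v)"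
proof -
  obtain U d m F where U: "openin (zariski X) U" "p \<in> U"
    "\<And>i. i \<le> m \<Longrightarrow> homogeneous d (F i)" "\<And>q. q \<in> U \<Longrightarrow> \<phi> q = form_map m F q"
    using conjunct2[OF assms(1)[unfolded regular_map_def], rule_format, OF assms(3)] by metis
  have *: "pointlike q" if "q \<in> U" for q
    using openin_subset[OF U(1)] that assms(2) by auto
  show ?thesis
  proof (rule that)
    show "is_form d (\<lambda>v. if i \<le> m then peval (F i) v else 0)" for i
      by (rule is_form_if) (rule is_form_peval, rule U)
    show "(\<lambda>v. if i \<le> m then peval (F i) v else 0) = (\<lambda>v. 0)" if "i > m" for i
      using that by auto
    show "\<forall>\<^sub>F q in zariski_nhds X p. \<forall>v\<in>q. \<phi> q = pt (\<lambda>i. if i \<le> m then peval (F i) v else 0)"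
      using eventually_nhds_zariski_open[OF U(1,2)]
    proof eventually_elim
      case (elim q)
      then show ?case using U(4) form_map_eq[OF U(3) *[OF elim]] by simp
    qed
  qed
qed

lemma regular_mapI:
  assumes "points X" "\<phi> ` X \<subseteq> Y"
    and "\<And>p. p \<in> X \<Longrightarrow> \<exists>d m g. (\<forall>i. is_form d (g i)) \<and> (\<forall>i>m. g i = (\<lambda>v. 0)) \<and>
      (\<forall>\<^sub>F q in zariski_nhds X p. \<exists>v\<in>q. \<phi> q = pt (\<lambda>i. g i v))"
  shows "regular_map X Y \<phi>"
  unfolding regular_map_def
proof (intro conjI ballI)
  fix p assume p: "p \<in> X"
  obtain d m g where g: "\<And>i. is_form d (g i)" "\<And>i. i > m \<Longrightarrow> g i = (\<lambda>v. 0)"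
    and ev: "\<forall>\<^sub>F q in zariski_nhds X p. \<exists>v\<in>q. \<phi> q = pt (\<lambda>i. g i v)"
    using assms(3)[OF p] by blast
  obtain F where F: "\<And>i. homogeneous d (F i)" "\<And>i. g i = peval (F i)"
    using g(1) unfolding is_form_def by metis
  obtain U where U: "openin (zariski X) U" "p \<in> U" "\<And>q. q \<in> U \<Longrightarrow> \<exists>v\<in>q. \<phi> q = pt (\<lambda>i. g i v)"
    using ev unfolding eventually_nhds_zariski[OF p] by blast
  have "\<phi> q = form_map m F q" if q: "q \<in> U" for q
  proof -
    obtain v where v: "v \<in> q" "\<phi> q = pt (\<lambda>i. g i v)"
      using U(3)[OF q] by blast
    have "pointlike q" using q openin_subset[OF U(1)] assms(1) by auto
    moreover have "(\<lambda>i. g i v) = (\<lambda>i. if i \<le> m then peval (F i) v else 0)"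
      using g(2) by (auto simp: fun_eq_iff simp flip: F(2))
    ultimately show ?thesis
      using form_map_eq[of m d F q v] F(1) v by simp
  qed
  then show "\<exists>U d m F. openin (zariski X) U \<and> p \<in> U \<and> (\<forall>i\<le>m. homogeneous d (F i)) \<and>
      (\<forall>q\<in>U. \<phi> q = form_map m F q)"
    using U(1,2) F(1) by (intro exI[of _ U] exI[of _ d] exI[of _ m] exI[of _ F]) auto
qed (fact assms(2))

lemma regular_map_mem: "regular_map X Y \<phi> \<Longrightarrow> p \<in> X \<Longrightarrow> \<phi> p \<in> Y"
  unfolding regular_map_def by blast

text \<open>Continuity in filter form: a basic neighbourhood of the image, given by
  \<open>h\<close>, pulls back to the locus where \<open>h\<close> composed with the local forms of
  \<open>\<phi>\<close> is nonzero.\<close>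

lemma eventually_pullback:
  assumes "points W" "points X" "regular_map W X \<phi>" "p \<in> W" "\<forall>\<^sub>F x in zariski_nhds X (\<phi> p). P x"
  shows "\<forall>\<^sub>F q in zariski_nhds W p. P (\<phi> q)"
proof -
  obtain d m g where g': "\<And>i. is_form d (g i)" "\<And>i. i > m \<Longrightarrow> g i = (\<lambda>v. 0)"
    "\<forall>\<^sub>F q in zariski_nhds W p. \<forall>v\<in>q. \<phi> q = pt (\<lambda>i. g i v)"
    by (rule regular_mapE[OF assms(3,1,4)]) (rule that)
  note g = g'(1,3)
  note X = regular_map_mem[OF assms(3)]
  obtain e h where h: "is_form e h" "\<forall>v\<in>\<phi> p. h v \<noteq> 0" "\<forall>x\<in>X. \<forall>v\<in>x. h v \<noteq> 0 \<longrightarrow> P x"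
    using zariski_nhds_basic[OF assms(2) X assms(5)] assms(4) by blast
  obtain v where v: "v \<in> p" using assms(1,4) pointlike_ex by blast
  have "h (\<lambda>i. g i v) \<noteq> 0"
    using eventually_nhds_zariski_self[OF assms(4) g(2)] v h(2) by auto
  then have "\<forall>\<^sub>F q in zariski_nhds W p. \<forall>v\<in>q. h (\<lambda>i. g i v) \<noteq> 0"
    using eventually_nhds_zariski_basic[OF is_form_subst[OF h(1) g(1)] assms(1,4) v] by simp
  then show ?thesis
    using g(2) eventually_nhds_zariski_mem[OF assms(4)]
  proof eventually_elim
    case (elim q)
    obtain v where v: "v \<in> q" using assms(1) elim pointlike_ex by blast
    then have "(\<lambda>i. g i v) \<in> \<phi> q" using elim(2) by auto
    moreover have "h (\<lambda>i. g i v) \<noteq> 0" using elim(1) v by auto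
    ultimately show ?case using h(3) X[OF elim(3)] by auto
  qed
qed

lemma openin_preimage:
  assumes "points W" "points X" "regular_map W X \<phi>" "openin (zariski X) U"
  shows "openin (zariski W) {q\<in>W. \<phi> q \<in> U}"
  unfolding openin_zariski_nhds_iff
proof (intro conjI ballI)
  fix p assume p: "p \<in> {q \<in> W. \<phi> q \<in> U}"
  then have "\<forall>\<^sub>F q in zariski_nhds W p. \<phi> q \<in> U"
    by (intro eventually_pullback[OF assms(1-3)] eventually_nhds_zariski_open[OF assms(4)]) simp_all
  then show "\<forall>\<^sub>F q in zariski_nhds W p. q \<in> {q \<in> W. \<phi> q \<in> U}"
    using eventually_nhds_zariski_mem[of p W] p by (auto elim: eventually_elim2)
qed auto

lemma reg_at_pullback:
  assumes "points W" "points X" "regular_map W X \<phi>" "p \<in> W" "reg_at X (\<phi> p) s"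
  shows "reg_at W p (\<lambda>q. s (\<phi> q))"
proof -
  obtain d m g where g': "\<And>i. is_form d (g i)" "\<And>i. i > m \<Longrightarrow> g i = (\<lambda>v. 0)"
    "\<forall>\<^sub>F q in zariski_nhds W p. \<forall>v\<in>q. \<phi> q = pt (\<lambda>i. g i v)"
    by (rule regular_mapE[OF assms(3,1,4)]) (rule that)
  note g = g'(1,3)
  obtain e F H where F: "is_form e F" "is_form e H" "\<forall>\<^sub>F x in zariski_nhds X (\<phi> p). \<forall>v\<in>x. H v \<noteq> 0 \<and> s x = F v / H v"
    using assms(5) unfolding reg_at_def by blast
  show ?thesis
  proof (rule reg_atI[OF is_form_subst[OF F(1) g(1)] is_form_subst[OF F(2) g(1)]])
    show "\<forall>\<^sub>F q in zariski_nhds W p. \<forall>v\<in>q. H (\<lambda>i. g i v) \<noteq> 0 \<and> s (\<phi> q) = F (\<lambda>i. g i v) / H (\<lambda>i. g i v)"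
      using g(2) eventually_pullback[OF assms(1-4) F(3)]
      by eventually_elim (metis self_in_pt)
  qed
qed

lemma regular_map_compose:
  assumes "points W" "points X" "regular_map W X \<phi>" "regular_map X Y \<psi>"
  shows "regular_map W Y (\<lambda>q. \<psi> (\<phi> q))"
proof (rule regular_mapI)
  show "(\<lambda>q. \<psi> (\<phi> q)) ` W \<subseteq> Y"
    using regular_map_mem[OF assms(3)] regular_map_mem[OF assms(4)] by (simp add: image_subset_iff)
next
  fix p assume p: "p \<in> W"
  obtain d m g where g': "\<And>i. is_form d (g i)" "\<And>i. i > m \<Longrightarrow> g i = (\<lambda>v. 0)"
    "\<forall>\<^sub>F q in zariski_nhds W p. \<forall>v\<in>q. \<phi> q = pt (\<lambda>i. g i v)"
    by (rule regular_mapE[OF assms(3,1) p]) (rule that)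
  note g = g'(1,3)
  have "\<phi> p \<in> X" using regular_map_mem[OF assms(3) p] .
  note X = this
  obtain e m' h where h: "\<And>i. is_form e (h i)" "\<And>i. i > m' \<Longrightarrow> h i = (\<lambda>v. 0)"
    "\<forall>\<^sub>F q in zariski_nhds X (\<phi> p). \<forall>v\<in>q. \<psi> q = pt (\<lambda>i. h i v)"
    by (rule regular_mapE[OF assms(4,2) X]) (rule that)
  show "\<exists>d m g. (\<forall>i. is_form d (g i)) \<and> (\<forall>i>m. g i = (\<lambda>v. 0)) \<and>
      (\<forall>\<^sub>F q in zariski_nhds W p. \<exists>v\<in>q. \<psi> (\<phi> q) = pt (\<lambda>i. g i v))"
  proof (intro exI conjI allI impI)
    show "is_form (e * d) (\<lambda>v. h i (\<lambda>i. g i v))" for i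
      by (rule is_form_subst[OF h(1) g(1)])
    show "(\<lambda>v. h i (\<lambda>i. g i v)) = (\<lambda>v. 0)" if "i > m'" for i
      using h(2)[OF that] by simp
    show "\<forall>\<^sub>F q in zariski_nhds W p. \<exists>v\<in>q. \<psi> (\<phi> q) = pt (\<lambda>i. h i (\<lambda>i. g i v))"
      using g(2) eventually_pullback[OF assms(1-3) p h(3)] eventually_nhds_zariski_mem[OF p]
    proof eventually_elim
      case (elim q)
      obtain v where "v \<in> q" using assms(1) elim(3) pointlike_ex by blast
      then show ?case using elim by (intro bexI[of _ v]) auto
    qed
  qed
qed (fact assms(1))

text \<open>The ambient \<open>n\<close> matters because a regular map must be given locally by
  finitely many forms: the coordinates up to \<open>n\<close> suffice, all others vanish on
  \<open>X\<close>.\<close>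

lemma regular_map_id:
  assumes "X \<subseteq> proj n" shows "regular_map X X (\<lambda>p. p)"
proof (rule regular_mapI)
  show X: "points X" using assms proj_pointlike by blast
  fix p assume p: "p \<in> X"
  show "\<exists>d m g. (\<forall>i. is_form d (g i)) \<and> (\<forall>i>m. g i = (\<lambda>v. 0)) \<and>
      (\<forall>\<^sub>F q in zariski_nhds X p. \<exists>v\<in>q. q = pt (\<lambda>i. g i v))"
  proof (intro exI conjI allI impI)
    show "is_form 1 (\<lambda>v. if i \<le> n then v i else 0)" for i
      by (rule is_form_if) simp
    show "(\<lambda>v. if i \<le> n then v i else 0) = (\<lambda>v. 0)" if "i > n" for i
      using that by auto
    show "\<forall>\<^sub>F q in zariski_nhds X p. \<exists>v\<in>q. q = pt (\<lambda>i. if i \<le> n then v i else 0)"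
      using eventually_nhds_zariski_mem[OF p]
    proof eventually_elim
      case (elim q)
      then obtain v where v: "v \<in> q" using X pointlike_ex by blast
      then have "v \<in> coords n" using elim assms proj_coords by blast
      then have "(\<lambda>i. if i \<le> n then v i else 0) = v"
        by (auto simp: coords_def)
      moreover have "q = pt v" using X elim v pointlike_in by blast
      ultimately show ?case using v by (intro bexI[of _ v]) simp_all
    qed
  qed
qed auto

section \<open>Quasi-projective sets and uniqueness of blowing-ups\<close>

lemma quasi_projective_subset: "quasi_projective W \<Longrightarrow> \<exists>n. W \<subseteq> proj n"
  unfolding quasi_projective_def by (metis closedin_subset openin_subset order_trans topspace_zariski)

lemma quasi_projective_points: "quasi_projective W \<Longrightarrow> points W"
  using quasi_projective_subset proj_pointlike by blast

lemma closed_quasi_projective: "closedin (zariski (proj n)) X \<Longrightarrow> quasi_projective X"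
  unfolding quasi_projective_def by (metis openin_topspace topspace_zariski)

lemma isomorphic_refl: "quasi_projective X \<Longrightarrow> isomorphic X X"
  using quasi_projective_subset regular_map_id unfolding isomorphic_def by blast

lemma blowup_lift:
  assumes "is_blowup X I Y \<pi>" "quasi_projective W" "regular_map W X \<phi>"
    "invertible_ideal W (inverse_image_ideal W X \<phi> I)"
  shows "\<exists>\<psi>. regular_map W Y \<psi> \<and> (\<forall>w\<in>W. \<pi> (\<psi> w) = \<phi> w)"
  using assms unfolding is_blowup_def by simp

lemma blowup_lift_unique:
  assumes "is_blowup X I Y \<pi>" "quasi_projective W" "regular_map W X \<phi>"
    "invertible_ideal W (inverse_image_ideal W X \<phi> I)"
    "regular_map W Y \<psi>" "\<forall>w\<in>W. \<pi> (\<psi> w) = \<phi> w"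
    "regular_map W Y \<psi>'" "\<forall>w\<in>W. \<pi> (\<psi>' w) = \<phi> w" "w \<in> W"
  shows "\<psi> w = \<psi>' w"
proof -
  have "(\<forall>\<psi> \<psi>'. regular_map W Y \<psi> \<and> (\<forall>w\<in>W. \<pi> (\<psi> w) = \<phi> w) \<and>
                 regular_map W Y \<psi>' \<and> (\<forall>w\<in>W. \<pi> (\<psi>' w) = \<phi> w) \<longrightarrow>
            (\<forall>w\<in>W. \<psi> w = \<psi>' w))"
    using assms(1-4) unfolding is_blowup_def by simp
  from this[rule_format, of \<psi> \<psi>' w] show ?thesis using assms(5-9) by blast
qed

text \<open>Both \<open>\<psi>\<close> and the identity are lifts of \<open>\<pi>\<close> through
  itself, and \<open>Y\<close> is a legitimate test object, so uniqueness of lifts applies.\<close>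

lemma blowup_endo_id:
  assumes "is_blowup X I Y \<pi>" "regular_map Y Y \<psi>" "\<forall>w\<in>Y. \<pi> (\<psi> w) = \<pi> w" "w \<in> Y"
  shows "\<psi> w = w"
proof -
  have Y: "quasi_projective Y" "regular_map Y X \<pi>" "invertible_ideal Y (inverse_image_ideal Y X \<pi> I)"
    using assms(1) unfolding is_blowup_def by simp_all
  have "regular_map Y Y (\<lambda>w. w)"
    using quasi_projective_subset[OF Y(1)] regular_map_id by blast
  then show ?thesis
    by (intro blowup_lift_unique[OF assms(1) Y assms(2,3), of "\<lambda>w. w" w]) (simp_all add: assms(4))
qed

text \<open>The lifts of \<open>\<pi>\<close> and \<open>\<pi>'\<close> through each other compose
  to endomorphisms over \<open>X\<close>, and these are identities by
  \<open>blowup_endo_id\<close>.\<close>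

lemma blowup_unique:
  assumes "is_blowup X I Y \<pi>" "is_blowup X I Y' \<pi>'"
  shows "isomorphic Y Y'"
proof -
  have Y: "quasi_projective Y" "regular_map Y X \<pi>" "invertible_ideal Y (inverse_image_ideal Y X \<pi> I)"
    using assms(1) unfolding is_blowup_def by simp_all
  have Y': "quasi_projective Y'" "regular_map Y' X \<pi>'" "invertible_ideal Y' (inverse_image_ideal Y' X \<pi>' I)"
    using assms(2) unfolding is_blowup_def by simp_all
  note p = Y(1)[THEN quasi_projective_points] Y'(1)[THEN quasi_projective_points]
  obtain f where f: "regular_map Y Y' f" "\<forall>w\<in>Y. \<pi>' (f w) = \<pi> w"
    using blowup_lift[OF assms(2) Y] by (elim exE conjE)
  obtain g where g: "regular_map Y' Y g" "\<forall>w\<in>Y'. \<pi> (g w) = \<pi>' w"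
    using blowup_lift[OF assms(1) Y'] by (elim exE conjE)
  have "\<forall>w\<in>Y. \<pi> (g (f w)) = \<pi> w" "\<forall>w\<in>Y'. \<pi>' (f (g w)) = \<pi>' w"
    using f(2) g(2) regular_map_mem[OF f(1)] regular_map_mem[OF g(1)] by simp_all
  then have "\<forall>w\<in>Y. g (f w) = w" "\<forall>w\<in>Y'. f (g w) = w"
    using blowup_endo_id[OF assms(1) regular_map_compose[OF p f(1) g(1)]]
      blowup_endo_id[OF assms(2) regular_map_compose[OF p(2,1) g(1) f(1)]] by simp_all
  then show ?thesis
    unfolding isomorphic_def using f(1) g(1) by (intro exI[of _ f] exI[of _ g] conjI)
qed

section \<open>Ideal sheaves generated by forms\<close>

text \<open>The stalk at \<open>p\<close> of the ideal generated by \<open>c 0\<close>, ...,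
  \<open>c m\<close>: the germ of \<open>s\<close> is a combination of these with regular
  coefficients.\<close>

definition span_at ::
  "'k::field point set \<Rightarrow> 'k point \<Rightarrow> nat \<Rightarrow> (nat \<Rightarrow> 'k point \<Rightarrow> 'k) \<Rightarrow> ('k point \<Rightarrow> 'k) \<Rightarrow> bool" where
  "span_at W p m c s \<longleftrightarrow> (\<exists>a. (\<forall>j\<le>m. reg_at W p (a j)) \<and>
     (\<forall>\<^sub>F q in zariski_nhds W p. s q = (\<Sum>j\<le>m. a j q * c j q)))"

lemma span_atI:
  assumes "\<And>j. j \<le> m \<Longrightarrow> reg_at W p (a j)" "\<forall>\<^sub>F q in zariski_nhds W p. s q = (\<Sum>j\<le>m. a j q * c j q)"
  shows "span_at W p m c s"
  using assms unfolding span_at_def by blast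

lemma span_at_cong:
  assumes "span_at W p m c s" "\<forall>\<^sub>F q in zariski_nhds W p. t q = s q"
  shows "span_at W p m c t"
proof -
  obtain a where a: "\<And>j. j \<le> m \<Longrightarrow> reg_at W p (a j)" "\<forall>\<^sub>F q in zariski_nhds W p. s q = (\<Sum>j\<le>m. a j q * c j q)"
    using assms(1) unfolding span_at_def by blast
  show ?thesis
    by (rule span_atI[OF a(1)]) (use a(2) assms(2) in \<open>auto elim: eventually_elim2\<close>)
qed

lemma span_at_zero: "span_at W p m c (\<lambda>q. 0)"
  by (rule span_atI[of _ _ _ "\<lambda>j q. 0"]) auto

lemma span_at_add:
  assumes "span_at W p m c s" "span_at W p m c t"
  shows "span_at W p m c (\<lambda>q. s q + t q)"
proof -
  obtain a where a: "\<And>j. j \<le> m \<Longrightarrow> reg_at W p (a j)" "\<forall>\<^sub>F q in zariski_nhds W p. s q = (\<Sum>j\<le>m. a j q * c j q)"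
    using assms(1) unfolding span_at_def by blast
  obtain b where b: "\<And>j. j \<le> m \<Longrightarrow> reg_at W p (b j)" "\<forall>\<^sub>F q in zariski_nhds W p. t q = (\<Sum>j\<le>m. b j q * c j q)"
    using assms(2) unfolding span_at_def by blast
  show ?thesis
  proof (rule span_atI)
    show "reg_at W p (\<lambda>q. a j q + b j q)" if "j \<le> m" for j using that a b by auto
    show "\<forall>\<^sub>F q in zariski_nhds W p. s q + t q = (\<Sum>j\<le>m. (a j q + b j q) * c j q)"
      using a(2) b(2) by eventually_elim (simp add: distrib_right sum.distrib)
  qed
qed

lemma span_at_mult:
  assumes "reg_at W p b" "span_at W p m c s"
  shows "span_at W p m c (\<lambda>q. b q * s q)"
proof -
  obtain a where a: "\<And>j. j \<le> m \<Longrightarrow> reg_at W p (a j)" "\<forall>\<^sub>F q in zariski_nhds W p. s q = (\<Sum>j\<le>m. a j q * c j q)"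
    using assms(2) unfolding span_at_def by blast
  show ?thesis
  proof (rule span_atI)
    show "reg_at W p (\<lambda>q. b q * a j q)" if "j \<le> m" for j using that a assms by auto
    show "\<forall>\<^sub>F q in zariski_nhds W p. b q * s q = (\<Sum>j\<le>m. (b q * a j q) * c j q)"
      using a(2) by eventually_elim (simp add: sum_distrib_left mult.assoc)
  qed
qed

lemma span_at_sum:
  "finite T \<Longrightarrow> (\<And>g. g \<in> T \<Longrightarrow> span_at W p m c (s g)) \<Longrightarrow> span_at W p m c (\<lambda>q. \<Sum>g\<in>T. s g q)"
  by (induction T rule: finite_induct) (auto intro: span_at_zero span_at_add)

lemma span_at_generator:
  assumes "i \<le> m" shows "span_at W p m c (c i)"
proof (rule span_atI)
  show "reg_at W p (\<lambda>q. if j = i then 1 else 0)" for j by simp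
  show "\<forall>\<^sub>F q in zariski_nhds W p. c i q = (\<Sum>j\<le>m. (if j = i then 1 else 0) * c j q)"
    using assms by (auto simp: if_distrib[of "\<lambda>x. x * _"] sum.delta cong: if_cong)
qed

lemma span_at_pullback:
  assumes "points W" "points X" "regular_map W X \<phi>" "p \<in> W" "span_at X (\<phi> p) m c s"
  shows "span_at W p m (\<lambda>j q. c j (\<phi> q)) (\<lambda>q. s (\<phi> q))"
proof -
  obtain a where a: "\<And>j. j \<le> m \<Longrightarrow> reg_at X (\<phi> p) (a j)" "\<forall>\<^sub>F q in zariski_nhds X (\<phi> p). s q = (\<Sum>j\<le>m. a j q * c j q)"
    using assms(5) unfolding span_at_def by blast
  show ?thesis
    by (rule span_atI[of _ _ _ "\<lambda>j q. a j (\<phi> q)"])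
      (use a reg_at_pullback[OF assms(1-4)] eventually_pullback[OF assms(1-4)] in auto)
qed

text \<open>Dehomogenisation of a form of degree \<open>d\<close> by the coordinate with index
  \<open>i\<close>. By \<open>chart_eq\<close> the chosen representative is irrelevant; where the
  coordinate vanishes the value is a convention of division, so the function is meaningful over
  \<open>chart_dom\<close> only.\<close>

definition chart :: "nat \<Rightarrow> nat \<Rightarrow> ((nat \<Rightarrow> 'k::field) \<Rightarrow> 'k) \<Rightarrow> 'k point \<Rightarrow> 'k" where
  "chart d i f p = (let v = SOME v. v \<in> p in f v / v i ^ d)"

lemma chart_eq:
  assumes "is_form d f" "pointlike p" "v \<in> p"
  shows "chart d i f p = f v / v i ^ d"
proof -
  have 1: "(SOME v. v \<in> p) \<in> p" by (rule someI[of _ v]) (fact assms(3))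
  have "is_form d (\<lambda>v. v i ^ d)" using is_form_power[OF is_form_var[of i], of d] by simp
  then show ?thesis
    unfolding chart_def Let_def by (rule is_form_quotient_eq[OF assms(1) _ assms(2) 1 assms(3)])
qed

definition chart_dom :: "'k::field point set \<Rightarrow> nat \<Rightarrow> 'k point set" where
  "chart_dom X i = {p\<in>X. \<forall>v\<in>p. v i \<noteq> 0}"

lemma openin_chart_dom: "openin (zariski X) (chart_dom X i)"
  unfolding chart_dom_def by (rule openin_zariski_basic[OF is_form_var])

lemma chart_dom_ex:
  assumes "pointlike p" "p \<in> X" shows "\<exists>i. p \<in> chart_dom X i"
proof -
  obtain v where v: "p = pt v" "v \<noteq> 0" using assms unfolding pointlike_def by blast
  then obtain i where i: "v i \<noteq> 0" by (auto simp: fun_eq_iff)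
  have "w i \<noteq> 0" if "w \<in> p" for w
    using is_form_zero_iff[OF is_form_var assms(1) that, of v i] v i by simp
  then show ?thesis using assms(2) by (auto simp: chart_dom_def)
qed

lemma chart_domI:
  assumes "pointlike p" "p \<in> X" "v \<in> p" "v i \<noteq> 0" shows "p \<in> chart_dom X i"
proof -
  have "w i \<noteq> 0" if "w \<in> p" for w
    using is_form_zero_iff[OF is_form_var assms(1,3) that, of i] assms(4) by simp
  then show ?thesis using assms(2) by (simp add: chart_dom_def)
qed

lemma reg_at_chart:
  assumes "points X" "is_form d f" "p \<in> chart_dom X i"
  shows "reg_at X p (chart d i f)"
proof -
  have p: "p \<in> X" "\<And>v. v \<in> p \<Longrightarrow> v i \<noteq> 0" using assms by (auto simp: chart_dom_def)
  obtain v where "v \<in> p" using p assms(1) pointlike_ex by blast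
  then show ?thesis
    using assms p is_form_power[OF is_form_var[of i], of d] chart_eq[OF assms(2)]
    by (intro reg_at_quotient[of X p d f "\<lambda>v. v i ^ d" v]) auto
qed

text \<open>On the chart \<open>x\<^sub>i \<noteq> 0\<close> the forms \<open>f\<^sub>j\<close> of degree \<open>d\<close> are trivialised as \<open>f\<^sub>j/x\<^sub>i\<^sup>d\<close>.\<close>

definition ideal_generated_by_forms ::
  "'k::field point set \<Rightarrow> nat \<Rightarrow> nat \<Rightarrow> (nat \<Rightarrow> (nat \<Rightarrow> 'k) \<Rightarrow> 'k) \<Rightarrow> 'k function_sheaf \<Rightarrow> bool" where
  "ideal_generated_by_forms X m d f I \<longleftrightarrow>
     (\<forall>i. \<forall>j\<le>m. chart d i (f j) \<in> I (chart_dom X i)) \<and>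
     (\<forall>U b p i. openin (zariski X) U \<and> b \<in> I U \<and> p \<in> U \<and> p \<in> chart_dom X i \<longrightarrow>
        span_at X p m (\<lambda>j. chart d i (f j)) b)"

text \<open>Pulled back generators generate the inverse image ideal. One direction writes each local
  section of \<open>I\<close> in the generators and pulls back the coefficients; the other uses that
  the generators are themselves sections of \<open>I\<close> over the whole chart. Afterwards the
  inverse image ideal is known by its stalks.\<close>

lemma mem_inverse_image_ideal:
  assumes "points W" "points X" "regular_map W X \<phi>" "ideal_generated_by_forms X m d f I"
    and V: "openin (zariski W) V" "\<And>q. q \<in> V \<Longrightarrow> \<phi> q \<in> chart_dom X i"
  shows "s \<in> inverse_image_ideal W X \<phi> I V \<longleftrightarrow>
    (\<forall>p\<in>V. span_at W p m (\<lambda>j q. chart d i (f j) (\<phi> q)) s)"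
proof
  assume s: "s \<in> inverse_image_ideal W X \<phi> I V"
  show "\<forall>p\<in>V. span_at W p m (\<lambda>j q. chart d i (f j) (\<phi> q)) s"
  proof
    fix p assume p: "p \<in> V"
    then have pW: "p \<in> W" using openin_subset[OF V(1)] by auto
    obtain V' T a where V': "openin (zariski W) V'" "p \<in> V'" "V' \<subseteq> V" "finite T"
      "T \<subseteq> {s. \<exists>U b. openin (zariski X) U \<and> \<phi> ` V' \<subseteq> U \<and> b \<in> I U \<and> (\<forall>q\<in>V'. s q = b (\<phi> q))}"
      "\<forall>g\<in>T. a g \<in> structure_sheaf W V'" "\<forall>q\<in>V'. s q = (\<Sum>g\<in>T. a g q * g q)"
      using s[unfolded inverse_image_ideal_def generated_ideal_def mem_Collect_eq, rule_format, OF p]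
      by (elim exE conjE)
    have "span_at W p m (\<lambda>j q. chart d i (f j) (\<phi> q)) (\<lambda>q. \<Sum>g\<in>T. a g q * g q)"
    proof (rule span_at_sum[OF V'(4)], rule span_at_mult)
      fix g assume g: "g \<in> T"
      show "reg_at W p (a g)"
        using V'(6) g V'(2) mem_structure_sheaf[OF V'(1)] by blast
      obtain U b where U: "openin (zariski X) U" "\<phi> ` V' \<subseteq> U" "b \<in> I U" "\<forall>q\<in>V'. g q = b (\<phi> q)"
        using subsetD[OF V'(5) g] by (elim CollectE exE conjE)
      have "span_at X (\<phi> p) m (\<lambda>j. chart d i (f j)) b"
        using assms(4) U V'(2) V(2)[OF p] unfolding ideal_generated_by_forms_def by blast
      then have "span_at W p m (\<lambda>j q. chart d i (f j) (\<phi> q)) (\<lambda>q. b (\<phi> q))"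
        by (rule span_at_pullback[OF assms(1-3) pW])
      moreover have "\<forall>\<^sub>F q in zariski_nhds W p. g q = b (\<phi> q)"
        using eventually_nhds_zariski_open[OF V'(1,2)] by eventually_elim (use U(4) in blast)
      ultimately show "span_at W p m (\<lambda>j q. chart d i (f j) (\<phi> q)) g"
        by (rule span_at_cong)
    qed
    moreover have "\<forall>\<^sub>F q in zariski_nhds W p. s q = (\<Sum>g\<in>T. a g q * g q)"
      using eventually_nhds_zariski_open[OF V'(1,2)] by eventually_elim (use V'(7) in blast)
    ultimately show "span_at W p m (\<lambda>j q. chart d i (f j) (\<phi> q)) s"
      by (rule span_at_cong)
  qed
next
  let ?c = "\<lambda>j q. chart d i (f j) (\<phi> q)"
  assume s: "\<forall>p\<in>V. span_at W p m ?c s"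
  show "s \<in> inverse_image_ideal W X \<phi> I V"
    unfolding inverse_image_ideal_def generated_ideal_def mem_Collect_eq
  proof
    fix p assume p: "p \<in> V"
    then have pW: "p \<in> W" using openin_subset[OF V(1)] by auto
    obtain a where a: "\<And>j. j \<le> m \<Longrightarrow> reg_at W p (a j)" "\<forall>\<^sub>F q in zariski_nhds W p. s q = (\<Sum>j\<le>m. a j q * ?c j q)"
      using s p unfolding span_at_def by blast
    have "\<forall>\<^sub>F q in zariski_nhds W p. \<forall>j\<in>{..m}. reg_at W q (a j)"
      using a(1) reg_at_eventually[OF pW] by (intro eventually_ball_finite) auto
    with a(2) eventually_nhds_zariski_open[OF V(1) p]
    have "\<forall>\<^sub>F q in zariski_nhds W p. q \<in> V \<and> s q = (\<Sum>j\<le>m. a j q * ?c j q) \<and> (\<forall>j\<in>{..m}. reg_at W q (a j))"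
      by eventually_elim blast
    then obtain V' where V'1: "openin (zariski W) V'" "p \<in> V'"
      "\<forall>q\<in>V'. q \<in> V \<and> s q = (\<Sum>j\<le>m. a j q * ?c j q) \<and> (\<forall>j\<in>{..m}. reg_at W q (a j))"
      unfolding eventually_nhds_zariski[OF pW] by (elim exE conjE)
    note V' = V'1(1,2) V'1(3)[THEN bspec, THEN conjunct1]
      V'1(3)[THEN bspec, THEN conjunct2, THEN conjunct1]
      V'1(3)[THEN bspec, THEN conjunct2, THEN conjunct2, THEN bspec]
    let ?T = "?c ` {..m}"
    \<comment> \<open>Different indices may give the same function \<open>?c j\<close>, while the
      definition of a generated ideal attaches one coefficient to each generating function; so
      coefficients are added over the indices with equal \<open>?c j\<close>.\<close>
    define a' where "a' g q = (\<Sum>j\<in>{j\<in>{..m}. ?c j = g}. a j q)" for g q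
    show "\<exists>V' T a. openin (zariski W) V' \<and> p \<in> V' \<and> V' \<subseteq> V \<and> finite T \<and>
      T \<subseteq> {s. \<exists>U b. openin (zariski X) U \<and> \<phi> ` V' \<subseteq> U \<and> b \<in> I U \<and> (\<forall>q\<in>V'. s q = b (\<phi> q))} \<and>
      (\<forall>g\<in>T. a g \<in> structure_sheaf W V') \<and> (\<forall>q\<in>V'. s q = (\<Sum>g\<in>T. a g q * g q))"
    proof (intro exI conjI ballI)
      show "openin (zariski W) V'" "p \<in> V'" by fact+
      show "V' \<subseteq> V" using V'(3) by (rule subsetI)
      show "finite ?T" by simp
      show "?T \<subseteq> {s. \<exists>U b. openin (zariski X) U \<and> \<phi> ` V' \<subseteq> U \<and> b \<in> I U \<and> (\<forall>q\<in>V'. s q = b (\<phi> q))}"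
      proof
        fix g assume "g \<in> ?T"
        then obtain j where j: "j \<le> m" "g = ?c j" by auto
        have "chart d i (f j) \<in> I (chart_dom X i)"
          using assms(4) j(1) unfolding ideal_generated_by_forms_def by blast
        moreover have "\<phi> ` V' \<subseteq> chart_dom X i" using V(2) V'(3) by blast
        ultimately show "g \<in> {s. \<exists>U b. openin (zariski X) U \<and> \<phi> ` V' \<subseteq> U \<and> b \<in> I U \<and> (\<forall>q\<in>V'. s q = b (\<phi> q))}"
          unfolding j(2) mem_Collect_eq
          by (intro exI[of _ "chart_dom X i"] exI[of _ "chart d i (f j)"] conjI ballI openin_chart_dom refl)
      qed
      show "a' g \<in> structure_sheaf W V'" if "g \<in> ?T" for g
        unfolding mem_structure_sheaf[OF V'(1)] a'_def[abs_def]
        by (intro ballI reg_at_sum V'(5)) simp_all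
      show "s q = (\<Sum>g\<in>?T. a' g q * g q)" if q: "q \<in> V'" for q
      proof -
        have "s q = (\<Sum>g\<in>?T. \<Sum>j\<in>{j\<in>{..m}. ?c j = g}. a j q * ?c j q)"
          unfolding V'(4)[OF q] by (rule sum.image_gen) simp
        also have "\<dots> = (\<Sum>g\<in>?T. a' g q * g q)"
          unfolding a'_def sum_distrib_right by (intro sum.cong refl) auto
        finally show ?thesis .
      qed
    qed
  qed
qed

lemma closedin_proj_subset: "closedin (zariski (proj n)) X \<Longrightarrow> X \<subseteq> proj n"
  using closedin_subset by fastforce

text \<open>The open complement is a union of non-vanishing loci of forms, each of which vanishes on
  \<open>X\<close>. If \<open>pt v\<close> were outside \<open>X\<close>, one of these forms would
  be nonzero at \<open>v\<close>.\<close>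

lemma closedin_projD:
  assumes "closedin (zariski (proj n)) X" "v \<in> coords n" "v \<noteq> 0"
    and "\<And>D F. is_form D F \<Longrightarrow> (\<forall>p\<in>X. \<forall>x\<in>p. F x = 0) \<Longrightarrow> F v = 0"
  shows "pt v \<in> X"
proof (rule ccontr)
  assume "pt v \<notin> X"
  have "openin (zariski (proj n)) (proj n - X)"
    using assms(1) unfolding closedin_def by simp
  then obtain S where S: "\<forall>F\<in>S. \<exists>d. homogeneous d F" "proj n - X = {p\<in>proj n. \<exists>F\<in>S. nonzero_at F p}"
    unfolding openin_zariski by (elim exE conjE)
  have "pt v \<in> proj n - X" using pt_in_proj[OF assms(3,2)] \<open>pt v \<notin> X\<close> by simp
  then obtain F where F: "F \<in> S" "nonzero_at F (pt v)" unfolding S(2) by auto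
  then obtain d where d: "homogeneous d F" using S(1) by auto
  have "peval F x = 0" if "p \<in> X" "x \<in> p" for p x
  proof -
    have p: "p \<in> proj n" using that closedin_proj_subset[OF assms(1)] by auto
    then have "\<not> nonzero_at F p" using that(1) S(2) F(1) by blast
    then show ?thesis using zero_at_iff(2)[OF d proj_pointlike[OF p] that(2)] by simp
  qed
  then have "peval F v = 0" using assms(4)[OF is_form_peval[OF d]] by simp
  then show False using F(2) self_in_pt unfolding nonzero_at_def by blast
qed

section \<open>Regular germs: common denominators, cancellation, gluing\<close>

lemma span_at_reg:
  assumes "span_at W p m c s" "\<And>j. j \<le> m \<Longrightarrow> reg_at W p (c j)"
  shows "reg_at W p s"
proof -
  obtain a where a: "\<And>j. j \<le> m \<Longrightarrow> reg_at W p (a j)" "\<forall>\<^sub>F q in zariski_nhds W p. s q = (\<Sum>j\<le>m. a j q * c j q)"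
    using assms(1) unfolding span_at_def by blast
  have "reg_at W p (\<lambda>q. \<Sum>j\<le>m. a j q * c j q)"
    using a(1) assms(2) by (intro reg_at_sum reg_at_mult) simp_all
  moreover have "\<forall>\<^sub>F q in zariski_nhds W p. (\<Sum>j\<le>m. a j q * c j q) = s q"
    using a(2) by eventually_elim simp
  ultimately show ?thesis by (rule reg_at_cong)
qed

text \<open>Finitely many regular germs become homogeneous coordinates once they are written over
  one denominator; this is how the lifted map is seen to be given by forms. The induction
  cross-multiplies with each new denominator.\<close>

lemma common_denominator:
  fixes m :: nat
  assumes "\<And>j. j \<le> m \<Longrightarrow> reg_at W p (A j)"
  shows "\<exists>D H F. is_form D H \<and> (\<forall>j. is_form D (F j)) \<and> (\<forall>j>m. F j = (\<lambda>v. 0)) \<and>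
    (\<forall>\<^sub>F q in zariski_nhds W p. \<forall>v\<in>q. H v \<noteq> 0 \<and> (\<forall>j\<le>m. A j q = F j v / H v))"
  using assms
proof (induction m)
  case 0
  then obtain d F H where F: "is_form d F" "is_form d H" "\<forall>\<^sub>F q in zariski_nhds W p. \<forall>v\<in>q. H v \<noteq> 0 \<and> A 0 q = F v / H v"
    unfolding reg_at_def by blast
  show ?case
    by (rule exI[of _ d], rule exI[of _ H], rule exI[of _ "\<lambda>j. if j = 0 then F else (\<lambda>v. 0)"])
      (use F in auto)
next
  case (Suc m)
  from Suc.IH Suc.prems obtain D H F where 1: "is_form D H" "\<And>j. is_form D (F j)" "\<And>j. j > m \<Longrightarrow> F j = (\<lambda>v. 0)"
    "\<forall>\<^sub>F q in zariski_nhds W p. \<forall>v\<in>q. H v \<noteq> 0 \<and> (\<forall>j\<le>m. A j q = F j v / H v)"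
    by auto
  obtain e K E where 2: "is_form e K" "is_form e E" "\<forall>\<^sub>F q in zariski_nhds W p. \<forall>v\<in>q. E v \<noteq> 0 \<and> A (Suc m) q = K v / E v"
    using Suc.prems[of "Suc m"] unfolding reg_at_def by auto
  let ?F = "\<lambda>j v. if j = Suc m then H v * K v else F j v * E v"
  show ?case
  proof (intro exI conjI allI impI)
    show "is_form (D + e) (\<lambda>v. H v * E v)" using 1 2 by auto
    show "is_form (D + e) (?F j)" for j
      using 1(1,2) 2(1,2) by (cases "j = Suc m") auto
    show "?F j = (\<lambda>v. 0)" if "j > Suc m" for j using that 1(3) by auto
    show "\<forall>\<^sub>F q in zariski_nhds W p. \<forall>v\<in>q. H v * E v \<noteq> 0 \<and> (\<forall>j\<le>Suc m. A j q = ?F j v / (H v * E v))"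
      using 1(4) 2(3) by eventually_elim (auto simp: le_Suc_eq)
  qed
qed

text \<open>Only the value of \<open>s\<close> at \<open>p\<close> is concluded, but the hypotheses
  on \<open>s\<close> spread to nearby points, so required at all points of an open set this amounts
  to injectivity of multiplication by \<open>h\<close>. It replaces density of the locus where
  \<open>h\<close> is nonzero.\<close>

definition nonzerodivisor_at :: "'k::field point set \<Rightarrow> 'k point \<Rightarrow> ('k point \<Rightarrow> 'k) \<Rightarrow> bool" where
  "nonzerodivisor_at W p h \<longleftrightarrow> (\<forall>s. reg_at W p s \<longrightarrow> (\<forall>\<^sub>F q in zariski_nhds W p. s q * h q = 0) \<longrightarrow> s p = 0)"

lemma nonzerodivisor_atD:
  "nonzerodivisor_at W p h \<Longrightarrow> reg_at W p s \<Longrightarrow> \<forall>\<^sub>F q in zariski_nhds W p. s q * h q = 0 \<Longrightarrow> s p = 0"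
  unfolding nonzerodivisor_at_def by blast

text \<open>Local quotients of \<open>s\<close> by \<open>h\<close> are unique because
  \<open>h\<close> can be cancelled. Hence they agree on overlaps, and evaluating at each point the
  quotient chosen there gives a regular function.\<close>

lemma glue_quotient:
  assumes V: "openin (zariski W) V" and nzd: "\<And>q. q \<in> V \<Longrightarrow> nonzerodivisor_at W q h"
    and loc: "\<And>p. p \<in> V \<Longrightarrow> \<exists>a. reg_at W p a \<and> (\<forall>\<^sub>F q in zariski_nhds W p. s q = a q * h q)"
  shows "\<exists>a\<in>structure_sheaf W V. \<forall>q\<in>V. s q = a q * h q"
proof -
  obtain A where A: "\<And>p. p \<in> V \<Longrightarrow> reg_at W p (A p)" "\<And>p. p \<in> V \<Longrightarrow> \<forall>\<^sub>F q in zariski_nhds W p. s q = A p q * h q"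
    using loc by metis
  have VW: "V \<subseteq> W" using openin_subset[OF V] by simp
  have "reg_at W p (\<lambda>q. A q q)" if p: "p \<in> V" for p
  proof (rule reg_at_cong[OF A(1)[OF p]])
    have pW: "p \<in> W" using p VW by auto
    show "\<forall>\<^sub>F q in zariski_nhds W p. A p q = A q q"
      using eventually_nhds_zariski_open[OF V p] reg_at_eventually[OF pW A(1)[OF p]] eventually_nhds_zariski_eventually[OF pW A(2)[OF p]]
    proof eventually_elim
      case (elim q)
      have "\<forall>\<^sub>F r in zariski_nhds W q. (A p r - A q r) * h r = 0"
        using elim(3)[THEN conjunct2] A(2)[OF elim(1)] by eventually_elim (metis left_diff_distrib diff_self)
      then have "A p q - A q q = 0"
        using nonzerodivisor_atD[OF nzd[OF elim(1)] reg_at_diff[OF elim(2) A(1)[OF elim(1)]]] by simp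
      then show ?case by simp
    qed
  qed
  moreover have "s q = A q q * h q" if "q \<in> V" for q
    using eventually_nhds_zariski_self[OF _ A(2)[OF that]] that VW by auto
  ultimately show ?thesis
    by (intro bexI[of _ "\<lambda>q. A q q"]) (auto simp: mem_structure_sheaf[OF V])
qed

lemma quotient_function:
  fixes F H :: "(nat \<Rightarrow> 'k::field) \<Rightarrow> 'k"
  assumes "is_form d F" "is_form d H"
  obtains s where "\<And>q v. pointlike q \<Longrightarrow> v \<in> q \<Longrightarrow> s q = F v / H v"
proof
  fix q :: "'k point" and v assume q: "pointlike q" "v \<in> q"
  have "(SOME v. v \<in> q) \<in> q" by (rule someI[of _ v]) (fact q(2))
  then show "(\<lambda>q. F (SOME v. v \<in> q) / H (SOME v. v \<in> q)) q = F v / H v"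
    using is_form_quotient_eq[OF assms q(1) _ q(2)] by simp
qed

section \<open>The closure of the graph of a map given by forms\<close>

text \<open>The Segre coordinate with index \<open>k\<close> is \<open>v\<^bsub>a k\<^esub> w\<^bsub>b k\<^esub>\<close>. The numbering is left abstract so that
  exchanging \<open>a\<close> and \<open>b\<close> exchanges the two factors without changing the points.\<close>

locale segre_graph =
  fixes a b :: "nat \<Rightarrow> nat" and e :: "nat \<Rightarrow> nat \<Rightarrow> nat" and n m N d :: nat
    and X :: "'k::field point set" and f :: "nat \<Rightarrow> (nat \<Rightarrow> 'k) \<Rightarrow> 'k"
  assumes ab_e [simp]: "a (e i j) = i" "b (e i j) = j" and e_ab [simp]: "e (a k) (b k) = k"
    and e_le: "i \<le> n \<Longrightarrow> j \<le> m \<Longrightarrow> e i j \<le> N"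
    and X_closed: "closedin (zariski (proj n)) X"
    and f_form: "is_form d (f j)" and f_zero: "j > m \<Longrightarrow> f j = (\<lambda>v. 0)"
begin

definition segre :: "(nat \<Rightarrow> 'k) \<Rightarrow> (nat \<Rightarrow> 'k) \<Rightarrow> nat \<Rightarrow> 'k" where
  "segre v w = (\<lambda>k. v (a k) * w (b k))"

definition form_vec :: "(nat \<Rightarrow> 'k) \<Rightarrow> nat \<Rightarrow> 'k" where
  "form_vec v = (\<lambda>j. f j v)"

definition graph :: "'k point set" where
  "graph = {pt (segre v (form_vec v)) | v. pt v \<in> X \<and> form_vec v \<noteq> 0}"

text \<open>The closure is taken by forms in the Segre coordinates, not by a topology on a product.
  Within the ambient space it depends on the graph only through the forms vanishing on it, and these
  are all that has to be compared for the two blowing-ups.\<close>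

definition graph_closure :: "'k point set" where
  "graph_closure = {p\<in>proj N. \<forall>D F. is_form D F \<longrightarrow> (\<forall>q\<in>graph. \<forall>z\<in>q. F z = 0) \<longrightarrow> (\<forall>z\<in>p. F z = 0)}"

text \<open>The first factor of a Segre point is unique by \<open>segre_inj\<close>, so the choice
  is harmless.\<close>

definition fst_proj :: "'k point \<Rightarrow> 'k point" where
  "fst_proj p = (SOME x. \<exists>v w. p = pt (segre v w) \<and> v \<noteq> 0 \<and> w \<noteq> 0 \<and> x = pt v)"

section \<open>Points of the graph closure and its first projection\<close>

lemma X_sub: "X \<subseteq> proj n"
  using closedin_proj_subset[OF X_closed] .

lemma X_points: "points X"
  using X_sub proj_pointlike by blast

lemma pt_in_X: "pt v \<in> X \<Longrightarrow> v \<noteq> 0 \<and> v \<in> coords n"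
  using X_points X_sub proj_coords self_in_pt pointlike_pt by blast

lemma segre_e [simp]: "segre v w (e i j) = v i * w j"
  by (simp add: segre_def)

lemma segre_nz: "segre v w \<noteq> 0 \<longleftrightarrow> v \<noteq> 0 \<and> w \<noteq> 0"
proof
  assume "v \<noteq> 0 \<and> w \<noteq> 0"
  then obtain i j where "v i \<noteq> 0" "w j \<noteq> 0" by (auto simp: fun_eq_iff)
  then have "segre v w (e i j) \<noteq> 0" by simp
  then show "segre v w \<noteq> 0" by force
qed (auto simp: segre_def fun_eq_iff)

lemma segre_scale:
  "segre (scale_vec c v) w = scale_vec c (segre v w)" "segre v (scale_vec c w) = scale_vec c (segre v w)"
  by (auto simp: segre_def scale_vec_def)

lemma segre_cong:
  assumes "pt v = pt v'" "pt w = pt w'" shows "pt (segre v w) = pt (segre v' w')"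
proof -
  obtain c c' where "c \<noteq> 0" "v = scale_vec c v'" "c' \<noteq> 0" "w = scale_vec c' w'"
    using assms unfolding pt_eq_iff by blast
  then show ?thesis by (simp add: segre_scale pt_scale)
qed

text \<open>A nonzero entry of \<open>w\<close> singles out a column of the rank-one matrix, and
  that column is a multiple of both \<open>v\<close> and \<open>v'\<close>.\<close>

lemma segre_inj:
  assumes "pt (segre v w) = pt (segre v' w')" "v \<noteq> 0" "w \<noteq> 0" "v' \<noteq> 0" "w' \<noteq> 0"
  shows "pt v = pt v'"
proof (rule pt_proportional[OF assms(2,4)])
  fix i l
  obtain c where "segre v w = scale_vec c (segre v' w')" using assms(1) unfolding pt_eq_iff by blast
  then have "segre v w (e i j) = scale_vec c (segre v' w') (e i j)" for i j
    by (rule fun_cong)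
  then have c: "v i * w j = c * (v' i * w' j)" for i j
    by (simp add: scale_vec_def)
  obtain j where j: "w j \<noteq> 0" using assms(3) by (auto simp: fun_eq_iff)
  have "v i * v' l * w j = v' l * (v i * w j)" by simp
  also have "\<dots> = v' i * (v l * w j)" unfolding c by simp
  finally have "(v i * v' l) * w j = (v l * v' i) * w j" by (simp add: mult_ac)
  then show "v i * v' l = v l * v' i" using j by simp
qed

lemma segre_coords: "v \<in> coords n \<Longrightarrow> w \<in> coords m \<Longrightarrow> segre v w \<in> coords N"
proof -
  assume vw: "v \<in> coords n" "w \<in> coords m"
  have "a k > n \<or> b k > m" if "k > N" for k
    using that e_le[of "a k" "b k"] by force
  then show ?thesis using vw by (auto simp: coords_def segre_def)
qed

lemma form_vec_coords: "form_vec v \<in> coords m"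
  using f_zero by (auto simp: coords_def form_vec_def)

lemma graph_sub: "graph \<subseteq> graph_closure"
proof
  fix p assume p: "p \<in> graph"
  then obtain v where v: "p = pt (segre v (form_vec v))" "pt v \<in> X" "form_vec v \<noteq> 0"
    unfolding graph_def by blast
  have "p \<in> proj N"
    unfolding v(1) using pt_in_X[OF v(2)] v(3) form_vec_coords
    by (intro pt_in_proj segre_coords) (auto simp: segre_nz)
  then show "p \<in> graph_closure" using p unfolding graph_closure_def by blast
qed

text \<open>The working principle for the closure: since forms scale, an equation need only be
  checked at the representatives \<open>segre v (form_vec v)\<close> of graph points.\<close>

lemma vanish:
  assumes "p \<in> graph_closure" "z \<in> p" "is_form D F"
    "\<And>v. pt v \<in> X \<Longrightarrow> form_vec v \<noteq> 0 \<Longrightarrow> F (segre v (form_vec v)) = 0"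
  shows "F z = 0"
proof -
  have "F z = 0" if q: "q \<in> graph" "z \<in> q" for q z
  proof -
    obtain v where v: "q = pt (segre v (form_vec v))" "pt v \<in> X" "form_vec v \<noteq> 0"
      using q(1) unfolding graph_def by blast
    then obtain c where "z = scale_vec c (segre v (form_vec v))" using q(2) in_pt by blast
    then show ?thesis using is_form_scale[OF assms(3)] assms(4)[OF v(2,3)] by simp
  qed
  then show ?thesis using assms(1-3) unfolding graph_closure_def by blast
qed

lemma graph_closure_sub: "graph_closure \<subseteq> proj N"
  unfolding graph_closure_def by blast

lemma graph_closure_points: "points graph_closure"
  using graph_closure_sub proj_pointlike by blast

lemma graph_closure_closed: "closedin (zariski (proj N)) graph_closure"
proof -
  define S where "S = {F. \<exists>D. homogeneous D F \<and> (\<forall>q\<in>graph. \<forall>z\<in>q. peval F z = 0)}"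
  have "proj N - graph_closure = {p\<in>proj N. \<exists>F\<in>S. nonzero_at F p}"
  proof (intro set_eqI iffI)
    fix p assume p: "p \<in> proj N - graph_closure"
    then obtain D F z where F: "is_form D F" "\<forall>q\<in>graph. \<forall>z\<in>q. F z = 0" "z \<in> p" "F z \<noteq> 0"
      unfolding graph_closure_def by blast
    then obtain F' where F': "homogeneous D F'" "F = peval F'" unfolding is_form_def by blast
    then have "nonzero_at F' p" using zero_at_iff(2)[OF F'(1) proj_pointlike[of p N] F(3)] p F(4) by simp
    moreover have "F' \<in> S" using F F' by (auto simp: S_def)
    ultimately show "p \<in> {p\<in>proj N. \<exists>F\<in>S. nonzero_at F p}" using p by blast
  next
    fix p assume "p \<in> {p\<in>proj N. \<exists>F\<in>S. nonzero_at F p}"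
    then obtain F where F: "p \<in> proj N" "F \<in> S" "nonzero_at F p" by blast
    then obtain D where D: "homogeneous D F" "\<forall>q\<in>graph. \<forall>z\<in>q. peval F z = 0"
      unfolding S_def by blast
    obtain z where z: "z \<in> p" using F(1) proj_pointlike pointlike_ex by blast
    then have "peval F z \<noteq> 0" using F(3) unfolding nonzero_at_def by blast
    then have "p \<notin> graph_closure"
      using is_form_peval[OF D(1)] D(2) z unfolding graph_closure_def by blast
    then show "p \<in> proj N - graph_closure" using F(1) by blast
  qed
  then have "openin (zariski (proj N)) (proj N - graph_closure)"
    unfolding openin_zariski by (intro exI[of _ S]) (auto simp: S_def)
  then show ?thesis unfolding closedin_def using graph_closure_sub by simp
qed

text \<open>Every property of the factors is expressed by forms vanishing on the graph: the 2 x 2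
  minors, the coordinates beyond the ranges \<open>n\<close> and \<open>m\<close>, the equations of
  \<open>X\<close>, and the proportionality of \<open>w\<close> to the values of the
  \<open>f j\<close>.\<close>

lemma graph_closure_pointE:
  assumes p: "p \<in> graph_closure"
  obtains v w where "p = pt (segre v w)" "pt v \<in> X" "v \<noteq> 0" "w \<noteq> 0" "w \<in> coords m"
    "\<And>j l. f j v * w l = f l v * w j"
proof -
  obtain z where z: "z \<in> p" "p = pt z" "z \<noteq> 0"
    using graph_closure_points p pointlike_ex pointlike_in by metis
  then obtain k where "z k \<noteq> 0" by (auto simp: fun_eq_iff)
  define i0 j0 where "i0 = a k" and "j0 = b k"
  have z0: "z (e i0 j0) \<noteq> 0" using \<open>z k \<noteq> 0\<close> by (simp add: i0_def j0_def)
  \<comment> \<open>A nonzero entry serves as pivot: the column through it is the first factor, the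
    row through it, divided by the pivot, the second.\<close>
  define v w where "v i = z (e i j0)" and "w j = z (e i0 j) / z (e i0 j0)" for i j
  have minor: "z (e i j0) * z (e i0 j) = z (e i j) * z (e i0 j0)" for i j
  proof -
    have "is_form (Suc 0 + Suc 0) (\<lambda>z::nat \<Rightarrow> 'k. z (e i j0) * z (e i0 j) - z (e i j) * z (e i0 j0))"
      by (intro is_form_diff is_form_mult) simp_all
    from vanish[OF p z(1) this] show ?thesis by simp
  qed
  have zs: "z = segre v w"
  proof
    fix l show "z l = segre v w l"
      using minor[of "a l" "b l"] z0 by (simp add: segre_def v_def w_def field_simps)
  qed
  have "v i = 0" if "i > n" for i
  proof -
    have "u i = 0" if "pt u \<in> X" for u
      using pt_in_X[OF that] \<open>i > n\<close> by (auto simp: coords_def)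
    then show ?thesis
      unfolding v_def using vanish[OF p z(1) is_form_var[of "e i j0"]] by simp
  qed
  then have vn: "v \<in> coords n" by (auto simp: coords_def)
  have "z (e i0 j) = 0" if "j > m" for j
    using vanish[OF p z(1) is_form_var[of "e i0 j"]] f_zero[OF that] by (simp add: form_vec_def)
  then have wm: "w \<in> coords m" by (auto simp: coords_def w_def)
  have nz: "v \<noteq> 0" "w \<noteq> 0" using z(3) unfolding zs segre_nz by auto
  have vX: "pt v \<in> X"
  proof (rule closedin_projD[OF X_closed vn nz(1)])
    fix D F assume F: "is_form D F" "\<forall>p\<in>X. \<forall>x\<in>p. F x = 0"
    \<comment> \<open>On the graph the column with index \<open>j0\<close> is a multiple of the
      point of \<open>X\<close>, so an equation of \<open>X\<close> vanishes on it.\<close>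
    have "F (\<lambda>i. z (e i j0)) = 0"
    proof (rule vanish[OF p z(1) is_form_subst[OF F(1)]])
      show "is_form (Suc 0) (\<lambda>z::nat \<Rightarrow> 'k. z (e i j0))" for i by simp
      fix u assume u: "pt u \<in> X"
      have "(\<lambda>i. segre u (form_vec u) (e i j0)) = scale_vec (form_vec u j0) u"
        by (auto simp: scale_vec_def)
      moreover have "F u = 0" using F(2) u self_in_pt by blast
      ultimately show "F (\<lambda>i. segre u (form_vec u) (e i j0)) = 0"
        using is_form_scale[OF F(1)] by simp
    qed
    then show "F v = 0" by (simp add: v_def[abs_def])
  qed
  have rel: "f j v * w l = f l v * w j" for j l
  proof -
    \<comment> \<open>\<open>v\<close> and \<open>w\<close> are replaced by the column and the row
      through the pivot, without dividing, so that the relation becomes a form.\<close>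
    let ?F = "\<lambda>z. f j (\<lambda>i. z (e i j0)) * z (e i0 l) - f l (\<lambda>i. z (e i j0)) * z (e i0 j)"
    have "?F z = 0"
    proof (rule vanish[OF p z(1)])
      have "is_form (d * Suc 0) (\<lambda>z. f j (\<lambda>i. z (e i j0)))" for j
        by (rule is_form_subst[OF f_form]) simp
      then show "is_form (d * Suc 0 + Suc 0) ?F"
        by (intro is_form_diff is_form_mult) simp_all
      fix u assume "pt u \<in> X"
      have s: "(\<lambda>i. segre u (form_vec u) (e i j0)) = scale_vec (form_vec u j0) u"
        by (auto simp: scale_vec_def)
      show "?F (segre u (form_vec u)) = 0"
        unfolding s is_form_scale[OF f_form] by (simp add: form_vec_def)
    qed
    then show ?thesis
      by (simp add: v_def[abs_def] w_def divide_simps)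
  qed
  show ?thesis
    by (rule that[of v w]) (use z zs vX nz wm rel in auto)
qed

lemma fst_proj_segre:
  assumes "v \<noteq> 0" "w \<noteq> 0" shows "fst_proj (pt (segre v w)) = pt v"
  unfolding fst_proj_def
proof (rule some_equality)
  show "\<exists>v' w'. pt (segre v w) = pt (segre v' w') \<and> v' \<noteq> 0 \<and> w' \<noteq> 0 \<and> pt v = pt v'"
    using assms by blast
  fix x assume "\<exists>v' w'. pt (segre v w) = pt (segre v' w') \<and> v' \<noteq> 0 \<and> w' \<noteq> 0 \<and> x = pt v'"
  then obtain v' w' where x: "pt (segre v w) = pt (segre v' w')" "v' \<noteq> 0" "w' \<noteq> 0" "x = pt v'"
    by (elim exE conjE)
  show "x = pt v" using segre_inj[OF x(1) assms x(2,3)] x(4) by simp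
qed

lemma fst_proj_regular: "regular_map graph_closure X fst_proj"
proof (rule regular_mapI[OF graph_closure_points])
  show "fst_proj ` graph_closure \<subseteq> X"
  proof
    fix x assume "x \<in> fst_proj ` graph_closure"
    then obtain p where p: "p \<in> graph_closure" "x = fst_proj p" by blast
    from p(1) obtain v w where "p = pt (segre v w)" "pt v \<in> X" "v \<noteq> 0" "w \<noteq> 0"
      by (rule graph_closure_pointE)
    then show "x \<in> X" using p(2) fst_proj_segre by simp
  qed
  fix p assume p: "p \<in> graph_closure"
  from p obtain v w where vw: "p = pt (segre v w)" "v \<noteq> 0" "w \<noteq> 0"
    by (rule graph_closure_pointE)
  then obtain i0 j0 where ij: "v i0 \<noteq> 0" "w j0 \<noteq> 0" by (auto simp: fun_eq_iff)
  show "\<exists>d m g. (\<forall>i. is_form d (g i)) \<and> (\<forall>i>m. g i = (\<lambda>v. 0)) \<and>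
     (\<forall>\<^sub>F q in zariski_nhds graph_closure p. \<exists>v\<in>q. fst_proj q = pt (\<lambda>i. g i v))"
  proof (intro exI conjI allI impI)
    \<comment> \<open>Where the entry \<open>e i0 j0\<close> is nonzero, the column
      \<open>j0\<close> is a nonzero multiple of the first factor.\<close>
    let ?g = "\<lambda>i z. if i \<le> n then z (e i j0) else 0"
    show "is_form (Suc 0) (?g i)" for i by (rule is_form_if) simp
    show "?g i = (\<lambda>z. 0)" if "i > n" for i using that by auto
    have "\<forall>\<^sub>F q in zariski_nhds graph_closure p. \<forall>z\<in>q. z (e i0 j0) \<noteq> 0"
      by (rule eventually_nhds_zariski_basic[OF is_form_var graph_closure_points p, of "segre v w"])
        (simp_all add: vw(1) ij)
    then show "\<forall>\<^sub>F q in zariski_nhds graph_closure p. \<exists>z\<in>q. fst_proj q = pt (\<lambda>i. ?g i z)"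
      using eventually_nhds_zariski_mem[OF p]
    proof eventually_elim
      case (elim q)
      from elim(2) obtain v w where vw: "q = pt (segre v w)" "pt v \<in> X" "v \<noteq> 0" "w \<noteq> 0"
        by (rule graph_closure_pointE)
      have "segre v w \<in> q" using vw(1) by simp
      then have wj: "w j0 \<noteq> 0" using elim(1) by force
      have "(\<lambda>i. ?g i (segre v w)) = scale_vec (w j0) v"
        using pt_in_X[OF vw(2)] by (auto simp: scale_vec_def coords_def)
      then have "fst_proj q = pt (\<lambda>i. ?g i (segre v w))"
        using fst_proj_segre[OF vw(3,4)] pt_scale[OF wj] vw(1) by simp
      then show ?case using \<open>segre v w \<in> q\<close> by blast
    qed
  qed
qed

text \<open>On \<open>V\<close> the inverse image ideal is generated by \<open>h\<close>, and \<open>[A\<^sub>0 : \<dots> : A\<^sub>m]\<close> is the second component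
  of the lift of \<open>\<phi>\<close> to the graph closure.\<close>

definition lift_data ::
  "'k point set \<Rightarrow> ('k point \<Rightarrow> 'k point) \<Rightarrow> 'k point set \<Rightarrow> nat \<Rightarrow> ('k point \<Rightarrow> 'k) \<Rightarrow>
   (nat \<Rightarrow> 'k point \<Rightarrow> 'k) \<Rightarrow> bool" where
  "lift_data W \<phi> V i h A \<longleftrightarrow> openin (zariski W) V \<and> (\<forall>j>m. A j = (\<lambda>q. 0)) \<and>
     (\<forall>q\<in>V. \<phi> q \<in> chart_dom X i \<and> reg_at W q h \<and> nonzerodivisor_at W q h \<and>
        (\<forall>j. reg_at W q (A j) \<and> chart d i (f j) (\<phi> q) = h q * A j q) \<and> (\<exists>j. A j q \<noteq> 0))"

section \<open>Lifts of test maps to the graph closure\<close>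

lemma lift_dataD:
  assumes "lift_data W \<phi> V i h A"
  shows "openin (zariski W) V" "V \<subseteq> W" "j > m \<Longrightarrow> A j = (\<lambda>q. 0)"
    "q \<in> V \<Longrightarrow> \<phi> q \<in> chart_dom X i" "q \<in> V \<Longrightarrow> reg_at W q h" "q \<in> V \<Longrightarrow> nonzerodivisor_at W q h"
    "q \<in> V \<Longrightarrow> reg_at W q (A j)" "q \<in> V \<Longrightarrow> chart d i (f j) (\<phi> q) = h q * A j q"
    "q \<in> V \<Longrightarrow> (\<lambda>j. A j q) \<noteq> 0"
  using assms openin_subset[of "zariski W" V] unfolding lift_data_def by (auto simp: fun_eq_iff)

lemma chart_form_vec: "p \<in> X \<Longrightarrow> x \<in> p \<Longrightarrow> chart d i (f j) p = form_vec x j / x i ^ d"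
  using chart_eq[OF f_form] X_points by (simp add: form_vec_def)

text \<open>Let \<open>h\<close> generate the inverse image ideal locally. Each pulled back
  generator is h A_j, and conversely h is a combination of these with coefficients B_j, so (1 - sum
  of B_j A_j) h = 0. Cancelling \<open>h\<close> shows that the A_j have no common zero, hence
  define a point of projective space even where all pulled back forms vanish.\<close>

lemma lift_data_ex:
  assumes W: "points W" and \<phi>: "regular_map W X \<phi>" and I: "ideal_generated_by_forms X m d f I"
    and inv: "invertible_ideal W (inverse_image_ideal W X \<phi> I)" and p: "p \<in> W"
  shows "\<exists>V i h A. lift_data W \<phi> V i h A \<and> p \<in> V"
proof -
  let ?J = "inverse_image_ideal W X \<phi> I"
  obtain V0 h where V0: "openin (zariski W) V0" "p \<in> V0"
    "\<forall>V'. openin (zariski W) V' \<and> V' \<subseteq> V0 \<longrightarrow>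
        ?J V' = {s. \<exists>a\<in>structure_sheaf W V'. \<forall>q\<in>V'. s q = a q * h q} \<and>
        (\<forall>a\<in>structure_sheaf W V'. (\<forall>q\<in>V'. a q * h q = 0) \<longrightarrow> (\<forall>q\<in>V'. a q = 0))"
    using inv[unfolded invertible_ideal_def, rule_format, OF p] by (elim exE conjE)
  have pX: "\<phi> p \<in> X" using regular_map_mem[OF \<phi> p] .
  obtain i where i: "\<phi> p \<in> chart_dom X i" using chart_dom_ex[OF _ pX] X_points pX by blast
  define V1 where "V1 = V0 \<inter> {q\<in>W. \<phi> q \<in> chart_dom X i}"
  have V1: "openin (zariski W) V1" "p \<in> V1" "V1 \<subseteq> V0" "V1 \<subseteq> W"
    using openin_preimage[OF W X_points \<phi> openin_chart_dom] V0(1,2) p i by (auto simp: V1_def)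
  have ch: "\<phi> q \<in> chart_dom X i" if "q \<in> V1" for q using that by (simp add: V1_def)
  let ?c = "\<lambda>j q. chart d i (f j) (\<phi> q)"
  note J = mem_inverse_image_ideal[OF W X_points \<phi> I V1(1) ch]
  note V0' = V0(3)[rule_format, OF conjI]
  have h_span: "span_at W q m ?c h" if "q \<in> V1" for q
  proof -
    have "h \<in> ?J V1"
      unfolding V0'[OF V1(1,3), THEN conjunct1] mem_Collect_eq mem_structure_sheaf[OF V1(1)]
      by (rule bexI[of _ "\<lambda>q. 1"]) (simp_all add: mem_structure_sheaf[OF V1(1)])
    then show ?thesis using J that by simp
  qed
  have c_reg: "reg_at W q (?c j)" if "q \<in> V1" for q j
    using reg_at_pullback[OF W X_points \<phi> _ reg_at_chart[OF X_points f_form ch[OF that]]] V1(4) that by auto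
  have nzd: "nonzerodivisor_at W q h" if q: "q \<in> V1" for q
    unfolding nonzerodivisor_at_def
  proof (intro allI impI)
    fix s assume s: "reg_at W q s" "\<forall>\<^sub>F r in zariski_nhds W q. s r * h r = 0"
    have qW: "q \<in> W" using q V1(4) by auto
    have "\<forall>\<^sub>F r in zariski_nhds W q. r \<in> V1 \<and> reg_at W r s \<and> s r * h r = 0"
      using eventually_nhds_zariski_open[OF V1(1) q] reg_at_eventually[OF qW s(1)] s(2) by eventually_elim simp
    then obtain U where U: "openin (zariski W) U" "q \<in> U" "\<forall>r\<in>U. r \<in> V1 \<and> reg_at W r s \<and> s r * h r = 0"
      unfolding eventually_nhds_zariski[OF qW] by (elim exE conjE)
    have "U \<subseteq> V0" using U(3) V1(3) by auto
    moreover have "s \<in> structure_sheaf W U" using U(3) by (simp add: mem_structure_sheaf[OF U(1)])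
    ultimately show "s q = 0" using V0'[OF U(1), THEN conjunct2] U(2,3) by simp
  qed
  have "\<exists>a\<in>structure_sheaf W V1. \<forall>q\<in>V1. ?c j q = a q * h q" if "j \<le> m" for j
  proof -
    have "?c j \<in> ?J V1" using J[of "?c j"] span_at_generator[OF that, of W _ ?c] by simp
    then show ?thesis unfolding V0'[OF V1(1,3), THEN conjunct1] mem_Collect_eq .
  qed
  then obtain A0 where A0: "\<And>j. j \<le> m \<Longrightarrow> A0 j \<in> structure_sheaf W V1"
    "\<And>j q. j \<le> m \<Longrightarrow> q \<in> V1 \<Longrightarrow> ?c j q = A0 j q * h q"
    by metis
  \<comment> \<open>Beyond \<open>m\<close> both \<open>A j\<close> and \<open>f j\<close> are zero,
    so the relation with \<open>h\<close> holds for every index.\<close>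
  define A where "A j = (if j \<le> m then A0 j else (\<lambda>q. 0))" for j
  have A_reg: "reg_at W q (A j)" if "q \<in> V1" for j q
    using A0(1) that by (simp add: A_def mem_structure_sheaf[OF V1(1)])
  have A_eq: "?c j q = h q * A j q" if "q \<in> V1" for j q
  proof (cases "j \<le> m")
    case False
    then have "f j = (\<lambda>v. 0)" using f_zero by simp
    then show ?thesis using False by (simp add: A_def chart_def)
  qed (use A0(2) that in \<open>simp add: A_def\<close>)
  obtain B where B: "\<And>j. j \<le> m \<Longrightarrow> reg_at W p (B j)" "\<forall>\<^sub>F q in zariski_nhds W p. h q = (\<Sum>j\<le>m. B j q * ?c j q)"
    using h_span[OF V1(2)] unfolding span_at_def by blast
  let ?s = "\<lambda>q. 1 - (\<Sum>j\<le>m. B j q * A j q)"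
  have s_reg: "reg_at W p ?s"
    using B(1) A_reg[OF V1(2)] by (intro reg_at_diff reg_at_const reg_at_sum reg_at_mult) simp_all
  have s_h: "\<forall>\<^sub>F q in zariski_nhds W p. ?s q * h q = 0"
    using B(2) eventually_nhds_zariski_open[OF V1(1,2)]
  proof eventually_elim
    case (elim q)
    have "(\<Sum>j\<le>m. B j q * A j q) * h q = (\<Sum>j\<le>m. B j q * ?c j q)"
      unfolding sum_distrib_right A_eq[OF elim(2)] by (intro sum.cong refl) (simp add: mult_ac)
    also have "\<dots> = h q" using elim(1) by simp
    finally show ?case by (simp add: left_diff_distrib)
  qed
  \<comment> \<open>The coefficients \<open>B j\<close> are germs at \<open>p\<close>, so the
    absence of common zeros is obtained only after shrinking \<open>V1\<close>.\<close>
  have "\<forall>\<^sub>F q in zariski_nhds W p. q \<in> V1 \<and> (\<exists>j. A j q \<noteq> 0)"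
    using reg_at_eventually[OF p s_reg] eventually_nhds_zariski_eventually[OF p s_h] eventually_nhds_zariski_open[OF V1(1,2)]
  proof eventually_elim
    case (elim q)
    have "?s q = 0"
      by (rule nonzerodivisor_atD[OF nzd[OF elim(3)] elim(1) elim(2)[THEN conjunct2]])
    then have "(\<Sum>j\<le>m. B j q * A j q) \<noteq> 0" by auto
    then obtain j where "B j q * A j q \<noteq> 0" by (meson sum.neutral)
    then show ?case using elim(3) by auto
  qed
  then obtain V where V: "openin (zariski W) V" "p \<in> V" "\<forall>q\<in>V. q \<in> V1 \<and> (\<exists>j. A j q \<noteq> 0)"
    unfolding eventually_nhds_zariski[OF p] by (elim exE conjE)
  have "lift_data W \<phi> V i h A"
    unfolding lift_data_def
  proof (intro conjI ballI allI impI)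
    show "A j = (\<lambda>q. 0)" if "j > m" for j using that by (simp add: A_def)
    fix q assume "q \<in> V"
    then have q: "q \<in> V1" "\<exists>j. A j q \<noteq> 0" using V(3) by auto
    show "\<phi> q \<in> chart_dom X i" "nonzerodivisor_at W q h" "\<exists>j. A j q \<noteq> 0"
      using ch nzd q by simp_all
    show "reg_at W q h" using span_at_reg[OF h_span[OF q(1)] c_reg[OF q(1)]] .
    show "reg_at W q (A j)" "?c j q = h q * A j q" for j using A_reg A_eq q(1) by simp_all
  qed (fact V(1))
  then show ?thesis using V(2) by blast
qed

lemma lift_local_forms:
  assumes W: "points W" and \<phi>: "regular_map W X \<phi>" and L: "lift_data W \<phi> V i h A" and p: "p \<in> V"
  obtains D M g E F H where "\<And>k. is_form D (g k)" "\<And>k. k > M \<Longrightarrow> g k = (\<lambda>v. 0)"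
    "\<And>j. is_form E (F j)" "\<And>j. j > m \<Longrightarrow> F j = (\<lambda>v. 0)" "is_form E H"
    "\<forall>\<^sub>F q in zariski_nhds W p. q \<in> V \<and> (\<forall>v\<in>q. \<phi> q = pt (\<lambda>k. g k v) \<and> H v \<noteq> 0 \<and> (\<forall>j. A j q = F j v / H v))"
proof -
  have pW: "p \<in> W" using p lift_dataD(2)[OF L] by auto
  obtain D M g where g: "\<And>k. is_form D (g k)" "\<And>k. k > M \<Longrightarrow> g k = (\<lambda>v. 0)"
    "\<forall>\<^sub>F q in zariski_nhds W p. \<forall>v\<in>q. \<phi> q = pt (\<lambda>i. g i v)"
    by (rule regular_mapE[OF \<phi> W pW]) (rule that)
  have "\<exists>D H F. is_form D H \<and> (\<forall>j. is_form D (F j)) \<and> (\<forall>j>m. F j = (\<lambda>v. 0)) \<and>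
    (\<forall>\<^sub>F q in zariski_nhds W p. \<forall>v\<in>q. H v \<noteq> 0 \<and> (\<forall>j\<le>m. A j q = F j v / H v))"
    by (rule common_denominator) (rule lift_dataD(7)[OF L p])
  then obtain E H F where F: "is_form E H" "\<forall>j. is_form E (F j)" "\<forall>j>m. F j = (\<lambda>v. 0)"
    "\<forall>\<^sub>F q in zariski_nhds W p. \<forall>v\<in>q. H v \<noteq> 0 \<and> (\<forall>j\<le>m. A j q = F j v / H v)"
    by (elim exE conjE)
  have "\<forall>\<^sub>F q in zariski_nhds W p. q \<in> V \<and> (\<forall>v\<in>q. \<phi> q = pt (\<lambda>k. g k v) \<and> H v \<noteq> 0 \<and> (\<forall>j. A j q = F j v / H v))"
    using g(3) F(4) eventually_nhds_zariski_open[OF lift_dataD(1)[OF L] p]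
  proof eventually_elim
    case (elim q)
    have "A j q = F j v / H v" if "v \<in> q" for j v
    proof (cases "j \<le> m")
      case True
      then show ?thesis using elim(2) that by simp
    next
      case False
      then show ?thesis using F(3) lift_dataD(3)[OF L, of j] by simp
    qed
    then show ?case using elim by simp
  qed
  then show ?thesis
    by (intro that[of D g M E F H]) (use g F in auto)
qed

text \<open>Where \<open>h\<close> is nonzero it is a mere scalar in the relation between the
  \<open>A j\<close> and the pulled back forms, so the lift lies on the graph there.\<close>

lemma lift_off_base:
  assumes \<phi>: "regular_map W X \<phi>" and L: "lift_data W \<phi> V i h A" and q: "q \<in> V" and x: "x \<in> \<phi> q"
    and h: "h q \<noteq> 0"
  shows "pt x \<in> X" "form_vec x \<noteq> 0" "pt (\<lambda>j. A j q) = pt (form_vec x)"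
proof -
  have "q \<in> W" using q lift_dataD(2)[OF L] by auto
  then have X: "\<phi> q \<in> X" using regular_map_mem[OF \<phi>] by simp
  then show "pt x \<in> X" using X_points pointlike_in(1) x by metis
  have xi: "x i \<noteq> 0" using lift_dataD(4)[OF L q] x by (simp add: chart_dom_def)
  have "form_vec x j / x i ^ d = h q * A j q" for j
    using lift_dataD(8)[OF L q, of j] chart_form_vec[OF X x] by simp
  then have eq: "form_vec x = scale_vec (h q * x i ^ d) (\<lambda>j. A j q)"
    using xi by (auto simp: scale_vec_def field_simps)
  then show "pt (\<lambda>j. A j q) = pt (form_vec x)"
    using pt_scale[of "h q * x i ^ d" "\<lambda>j. A j q"] xi h by simp
  then show "form_vec x \<noteq> 0" using lift_dataD(9)[OF L q] pointlike_pt by metis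
qed

text \<open>A form vanishing on the graph becomes, after substituting the local forms of the lift
  and dividing by a suitable form, a regular function near \<open>p\<close>. Off the zeros of
  \<open>h\<close> the lift lies on the graph, so the product of this function with \<open>h\<close>
  vanishes and \<open>h\<close> can be cancelled.\<close>

lemma lift_mem:
  assumes W: "points W" and \<phi>: "regular_map W X \<phi>" and L: "lift_data W \<phi> V i h A" and p: "p \<in> V"
    and x: "x \<in> \<phi> p"
  shows "pt (segre x (\<lambda>j. A j p)) \<in> graph_closure"
proof -
  have pW: "p \<in> W" using p lift_dataD(2)[OF L] by auto
  obtain D M g E F H where g: "\<And>k. is_form D (g k)" "\<And>k. k > M \<Longrightarrow> g k = (\<lambda>v. 0)"
    and F: "\<And>j. is_form E (F j)" "\<And>j. j > m \<Longrightarrow> F j = (\<lambda>v. 0)" "is_form E H"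
    and ev: "\<forall>\<^sub>F q in zariski_nhds W p. q \<in> V \<and> (\<forall>v\<in>q. \<phi> q = pt (\<lambda>k. g k v) \<and> H v \<noteq> 0 \<and> (\<forall>j. A j q = F j v / H v))"
    by (rule lift_local_forms[OF W \<phi> L p]) (rule that)
  have A_pt: "pt (\<lambda>j. A j q) = pt (\<lambda>j. F j v)" if "H v \<noteq> 0" "\<forall>j. A j q = F j v / H v" for q v
  proof -
    have "(\<lambda>j. A j q) = scale_vec (1 / H v) (\<lambda>j. F j v)" using that(2) by (simp add: scale_vec_def)
    then show ?thesis using pt_scale[of "1 / H v"] that(1) by simp
  qed
  obtain v0 where v0: "v0 \<in> p" using W pW pointlike_ex by blast
  note at_p = eventually_nhds_zariski_self[OF pW ev, THEN conjunct2, rule_format, OF v0]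
  have "pt x = pt (\<lambda>k. g k v0)" using pt_eqI x at_p by blast
  moreover have "pt (\<lambda>j. A j p) = pt (\<lambda>j. F j v0)" using A_pt at_p by blast
  ultimately have eq: "pt (segre x (\<lambda>j. A j p)) = pt (segre (\<lambda>k. g k v0) (\<lambda>j. F j v0))"
    by (rule segre_cong)
  have X: "\<phi> p \<in> X" using regular_map_mem[OF \<phi> pW] .
  have gi: "g i v0 \<noteq> 0"
  proof -
    have "\<forall>v\<in>\<phi> p. v i \<noteq> 0" using lift_dataD(4)[OF L p] by (simp add: chart_dom_def)
    moreover have "(\<lambda>k. g k v0) \<in> \<phi> p" using at_p by simp
    ultimately show ?thesis by (rule bspec)
  qed
  have xX: "pt x \<in> X" using X X_points pointlike_in(1) x by metis
  have "(\<lambda>j. A j p) \<in> coords m" using lift_dataD(3)[OF L] by (auto simp: coords_def)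
  then have "pt (segre x (\<lambda>j. A j p)) \<in> proj N"
    using pt_in_X[OF xX] lift_dataD(9)[OF L p] by (intro pt_in_proj segre_coords) (simp_all add: segre_nz)
  moreover have "G z = 0" if G: "is_form B G" "\<forall>q\<in>graph. \<forall>z\<in>q. G z = 0"
    and z: "z \<in> pt (segre x (\<lambda>j. A j p))" for B G z
  proof -
    have num: "is_form (B * (D + E)) (\<lambda>v. G (segre (\<lambda>k. g k v) (\<lambda>j. F j v)))"
      unfolding segre_def by (intro is_form_subst[OF G(1)] is_form_mult g F)
    \<comment> \<open>Any denominator of this degree that is nonzero at \<open>p\<close> would do;
      \<open>g i\<close> is nonzero there because \<open>\<phi> p\<close> lies in the chart of index
      \<open>i\<close>.\<close>
    have "is_form ((D + E) * B) (\<lambda>v. (g i v * H v) ^ B)"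
      by (intro is_form_power is_form_mult g F)
    then have den: "is_form (B * (D + E)) (\<lambda>v. (g i v * H v) ^ B)" by (simp add: mult.commute)
    obtain s where s: "\<And>q v. pointlike q \<Longrightarrow> v \<in> q \<Longrightarrow>
        s q = G (segre (\<lambda>k. g k v) (\<lambda>j. F j v)) / (g i v * H v) ^ B"
      using quotient_function[OF num den] by metis
    have "reg_at W p s"
      by (rule reg_at_quotient[OF W pW num den v0]) (use W s at_p gi in auto)
    moreover have "\<forall>\<^sub>F q in zariski_nhds W p. s q * h q = 0"
      using ev
    proof eventually_elim
      case (elim q)
      then have q: "pointlike q" using W lift_dataD(2)[OF L] by auto
      then obtain v where v: "v \<in> q" using pointlike_ex by blast
      let ?x = "\<lambda>k. g k v"
      have x: "?x \<in> \<phi> q" using elim v by simp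
      show "s q * h q = 0"
      proof (cases "h q = 0")
        case False
        note off = lift_off_base[OF \<phi> L _ x False]
        have "pt (\<lambda>j. F j v) = pt (form_vec ?x)" using A_pt off(3) elim v by metis
        then have "pt (segre ?x (\<lambda>j. F j v)) = pt (segre ?x (form_vec ?x))"
          by (intro segre_cong refl)
        moreover have "pt (segre ?x (form_vec ?x)) \<in> graph"
          using off(1,2) elim unfolding graph_def by blast
        ultimately have "G (segre ?x (\<lambda>j. F j v)) = 0" using G(2) self_in_pt by metis
        then show ?thesis using s[OF q v] by simp
      qed simp
    qed
    ultimately have "s p = 0" by (rule nonzerodivisor_atD[OF lift_dataD(6)[OF L p]])
    then have "G (segre (\<lambda>k. g k v0) (\<lambda>j. F j v0)) = 0"
      using s[of p v0] W pW v0 gi at_p by simp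
    moreover obtain c where "z = scale_vec c (segre (\<lambda>k. g k v0) (\<lambda>j. F j v0))"
      using z unfolding eq in_pt by blast
    ultimately show ?thesis using is_form_scale[OF G(1)] by simp
  qed
  ultimately show ?thesis unfolding graph_closure_def by blast
qed

text \<open>Multiplied by \<open>h\<close> and \<open>h'\<close>, each minor of the two coordinate
  vectors becomes a difference of equal products of pulled back forms. The two factors are cancelled
  in turn, \<open>h'\<close> at all nearby points and then \<open>h\<close> at
  \<open>q\<close>.\<close>

lemma lift_compat:
  assumes \<phi>: "regular_map W X \<phi>" and L: "lift_data W \<phi> V i h A" and L': "lift_data W \<phi> V' i' h' A'"
    and q: "q \<in> V" "q \<in> V'"
  shows "pt (\<lambda>j. A j q) = pt (\<lambda>j. A' j q)"
proof (rule pt_proportional[OF lift_dataD(9)[OF L q(1)] lift_dataD(9)[OF L' q(2)]])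
  fix j k
  have qW: "q \<in> W" using q lift_dataD(2)[OF L] by auto
  let ?s = "\<lambda>q. A j q * A' k q - A k q * A' j q"
  have s_reg: "reg_at W r ?s" if "r \<in> V" "r \<in> V'" for r
    using that by (intro reg_at_diff reg_at_mult lift_dataD(7)[OF L] lift_dataD(7)[OF L'])
  have "\<forall>\<^sub>F r in zariski_nhds W q. r \<in> V \<and> r \<in> V'"
    using eventually_nhds_zariski_open[OF lift_dataD(1)[OF L] q(1)] eventually_nhds_zariski_open[OF lift_dataD(1)[OF L'] q(2)]
    by eventually_elim simp
  then have ev: "\<forall>\<^sub>F r in zariski_nhds W q. r \<in> V \<and> r \<in> V' \<and> ?s r * h r * h' r = 0"
  proof eventually_elim
    case (elim r)
    then have "r \<in> W" using lift_dataD(2)[OF L] by auto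
    then have X: "\<phi> r \<in> X" using regular_map_mem[OF \<phi>] by simp
    then obtain x where x: "x \<in> \<phi> r" using X_points pointlike_ex by blast
    have "form_vec x l / x i ^ d = h r * A l r" "form_vec x l / x i' ^ d = h' r * A' l r" for l
      using lift_dataD(8)[OF L, of r l] lift_dataD(8)[OF L', of r l] elim chart_form_vec[OF X x] by simp_all
    note * = this[symmetric]
    have "?s r * h r * h' r = (h r * A j r) * (h' r * A' k r) - (h r * A k r) * (h' r * A' j r)"
      by (simp add: algebra_simps)
    also have "\<dots> = 0" unfolding * by (simp add: mult.commute)
    finally show ?case using elim by simp
  qed
  have "\<forall>\<^sub>F r in zariski_nhds W q. ?s r * h r = 0"
    using eventually_nhds_zariski_eventually[OF qW ev] ev
  proof eventually_elim
    case (elim r)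
    have reg: "reg_at W r (\<lambda>r. ?s r * h r)"
      using elim(2) by (intro reg_at_mult s_reg lift_dataD(5)[OF L]) simp_all
    have "\<forall>\<^sub>F t in zariski_nhds W r. (?s t * h t) * h' t = 0"
      using elim(1)[THEN conjunct2] by eventually_elim simp
    then show ?case
      using nonzerodivisor_atD[OF lift_dataD(6)[OF L'] reg] elim(2) by simp
  qed
  then have "?s q = 0"
    using nonzerodivisor_atD[OF lift_dataD(6)[OF L q(1)] s_reg[OF q]] by simp
  then show "A j q * A' k q = A k q * A' j q" by simp
qed

lemma lift_exists:
  assumes W: "points W" and \<phi>: "regular_map W X \<phi>"
    and ex: "\<And>p. p \<in> W \<Longrightarrow> \<exists>V i h A. lift_data W \<phi> V i h A \<and> p \<in> V"
  shows "\<exists>\<psi>. regular_map W graph_closure \<psi> \<and> (\<forall>w\<in>W. fst_proj (\<psi> w) = \<phi> w)"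
proof -
  obtain V i h A where L: "\<And>p. p \<in> W \<Longrightarrow> lift_data W \<phi> (V p) (i p) (h p) (A p)"
    and pV: "\<And>p. p \<in> W \<Longrightarrow> p \<in> V p"
    using ex by metis
  \<comment> \<open>At every point the data chosen for that very point are used; by
    \<open>lift_compat\<close> this agrees near \<open>p\<close> with the data of
    \<open>p\<close>.\<close>
  define \<psi> where "\<psi> p = pt (segre (SOME x. x \<in> \<phi> p) (\<lambda>j. A p j p))" for p
  have X: "\<phi> p \<in> X" "pointlike (\<phi> p)" if "p \<in> W" for p
    using regular_map_mem[OF \<phi> that] X_points by auto
  have some: "(SOME x. x \<in> \<phi> p) \<in> \<phi> p" if "p \<in> W" for p
    using pointlike_ex[OF X(2)[OF that]] by (rule someI_ex)
  have \<psi>: "\<psi> q = pt (segre x w)" if "q \<in> W" "x \<in> \<phi> q" "pt w = pt (\<lambda>j. A q j q)" for q x w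
    unfolding \<psi>_def
    by (rule segre_cong) (use that some[OF that(1)] pointlike_in(1)[OF X(2)[OF that(1)]] in auto)
  have "regular_map W graph_closure \<psi>"
  proof (rule regular_mapI[OF W])
    show "\<psi> ` W \<subseteq> graph_closure"
      using lift_mem[OF W \<phi> L pV some] unfolding \<psi>_def by auto
    fix p assume p: "p \<in> W"
    obtain D M g E F H where g: "\<And>k. is_form D (g k)" "\<And>k. k > M \<Longrightarrow> g k = (\<lambda>v. 0)"
      and F: "\<And>j. is_form E (F j)" "\<And>j. j > m \<Longrightarrow> F j = (\<lambda>v. 0)" "is_form E H"
      and ev: "\<forall>\<^sub>F q in zariski_nhds W p. q \<in> V p \<and> (\<forall>v\<in>q. \<phi> q = pt (\<lambda>k. g k v) \<and> H v \<noteq> 0 \<and> (\<forall>j. A p j q = F j v / H v))"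
      by (rule lift_local_forms[OF W \<phi> L[OF p] pV[OF p]]) (rule that)
    \<comment> \<open>The local forms of \<open>\<phi>\<close> end at an index \<open>M\<close> that
      depends on the point, not at \<open>n\<close>; \<open>?K\<close> bounds the Segre indices with
      both components in range.\<close>
    let ?K = "Max ((\<lambda>(i, j). e i j) ` ({..M} \<times> {..m}))"
    let ?G = "\<lambda>k v. g (a k) v * F (b k) v"
    show "\<exists>d m g. (\<forall>i. is_form d (g i)) \<and> (\<forall>i>m. g i = (\<lambda>v. 0)) \<and>
        (\<forall>\<^sub>F q in zariski_nhds W p. \<exists>v\<in>q. \<psi> q = pt (\<lambda>i. g i v))"
    proof (rule exI[of _ "D + E"], rule exI[of _ ?K], rule exI[of _ ?G], intro conjI allI impI)
      show "is_form (D + E) (?G k)" for k by (intro is_form_mult g F)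
      show "?G k = (\<lambda>v. 0)" if k: "k > ?K" for k
      proof -
        have "\<not> (a k \<le> M \<and> b k \<le> m)"
        proof
          assume "a k \<le> M \<and> b k \<le> m"
          then have "e (a k) (b k) \<in> (\<lambda>(i, j). e i j) ` ({..M} \<times> {..m})"
            by (intro image_eqI[of _ _ "(a k, b k)"]) simp_all
          then have "e (a k) (b k) \<le> ?K" by (intro Max_ge) simp_all
          then show False using k by simp
        qed
        then show ?thesis using g(2)[of "a k"] F(2)[of "b k"] by (metis mult_zero_left mult_zero_right not_le)
      qed
      show "\<forall>\<^sub>F q in zariski_nhds W p. \<exists>v\<in>q. \<psi> q = pt (\<lambda>k. ?G k v)"
        using ev eventually_nhds_zariski_mem[OF p]
      proof eventually_elim
        case (elim q)
        then obtain v where v: "v \<in> q" using W pointlike_ex by blast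
        have at: "\<phi> q = pt (\<lambda>k. g k v)" "H v \<noteq> 0" "\<forall>j. A p j q = F j v / H v"
          using elim(1) v by simp_all
        have "(\<lambda>j. A p j q) = scale_vec (1 / H v) (\<lambda>j. F j v)" using at(3) by (simp add: scale_vec_def)
        then have "pt (\<lambda>j. F j v) = pt (\<lambda>j. A p j q)" using pt_scale[of "1 / H v"] at(2) by simp
        also have "\<dots> = pt (\<lambda>j. A q j q)"
          by (rule lift_compat[OF \<phi> L[OF p] L[OF elim(2)]]) (use elim pV in auto)
        finally have "\<psi> q = pt (segre (\<lambda>k. g k v) (\<lambda>j. F j v))"
          by (intro \<psi>[OF elim(2)]) (simp_all add: at(1))
        then show ?case using v by (intro bexI[of _ v]) (simp_all add: segre_def)
      qed
    qed
  qed
  moreover have "fst_proj (\<psi> w) = \<phi> w" if w: "w \<in> W" for w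
  proof -
    note x = pointlike_in[OF X(2)[OF w] some[OF w]]
    show ?thesis
      unfolding \<psi>_def using fst_proj_segre[OF x(2) lift_dataD(9)[OF L[OF w] pV[OF w]]] x(1) by simp
  qed
  ultimately show ?thesis by blast
qed

text \<open>Off the zeros of \<open>h\<close> the fibre of the first projection over
  \<open>\<phi> q\<close> is a single point, because the second factor must be proportional to the
  values of the \<open>f j\<close>. So the minors of the coordinate vectors of two lifts are killed
  by \<open>h\<close>, hence vanish.\<close>

lemma lift_unique:
  assumes W: "points W" and \<phi>: "regular_map W X \<phi>"
    and ex: "\<And>p. p \<in> W \<Longrightarrow> \<exists>V i h A. lift_data W \<phi> V i h A \<and> p \<in> V"
    and \<psi>: "regular_map W graph_closure \<psi>" "\<forall>w\<in>W. fst_proj (\<psi> w) = \<phi> w"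
    and \<psi>': "regular_map W graph_closure \<psi>'" "\<forall>w\<in>W. fst_proj (\<psi>' w) = \<phi> w" and p: "p \<in> W"
  shows "\<psi> p = \<psi>' p"
proof -
  obtain V i h A where L: "lift_data W \<phi> V i h A" and pV: "p \<in> V"
    using ex[OF p] by (elim exE conjE)
  have off: "\<theta> q = pt (segre x (form_vec x))"
    if \<theta>: "regular_map W graph_closure \<theta>" "\<forall>w\<in>W. fst_proj (\<theta> w) = \<phi> w" and q: "q \<in> V" "h q \<noteq> 0" "x \<in> \<phi> q"
    for \<theta> q x
  proof -
    have qW: "q \<in> W" using q lift_dataD(2)[OF L] by auto
    from regular_map_mem[OF \<theta>(1) qW] obtain v w where vw: "\<theta> q = pt (segre v w)" "pt v \<in> X" "v \<noteq> 0" "w \<noteq> 0"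
      "w \<in> coords m" "\<And>j l. f j v * w l = f l v * w j"
      by (rule graph_closure_pointE) (rule that)
    have "\<phi> q = pt v" using \<theta>(2) qW vw(1) fst_proj_segre[OF vw(3,4)] by auto
    then have xv: "pt x = pt v" using q(3) pt_eqI by simp
    have "v \<in> \<phi> q" using \<open>\<phi> q = pt v\<close> by simp
    note off = lift_off_base[OF \<phi> L q(1) this q(2)] lift_off_base[OF \<phi> L q(1,3,2)]
    have "pt (form_vec v) = pt w"
      by (rule pt_proportional[OF off(2) vw(4)]) (use vw(6) in \<open>simp add: form_vec_def\<close>)
    then show ?thesis
      unfolding vw(1) using xv off by (intro segre_cong) simp_all
  qed
  obtain D M g where g: "\<And>k. is_form D (g k)" "\<And>k. k > M \<Longrightarrow> g k = (\<lambda>v. 0)"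
    "\<forall>\<^sub>F q in zariski_nhds W p. \<forall>v\<in>q. \<psi> q = pt (\<lambda>i. g i v)"
    by (rule regular_mapE[OF \<psi>(1) W p]) (rule that)
  obtain E M' g' where g': "\<And>k. is_form E (g' k)" "\<And>k. k > M' \<Longrightarrow> g' k = (\<lambda>v. 0)"
    "\<forall>\<^sub>F q in zariski_nhds W p. \<forall>v\<in>q. \<psi>' q = pt (\<lambda>i. g' i v)"
    by (rule regular_mapE[OF \<psi>'(1) W p]) (rule that)
  obtain v0 where v0: "v0 \<in> p" using W p pointlike_ex by blast
  have at: "\<psi> p = pt (\<lambda>i. g i v0)" "\<psi>' p = pt (\<lambda>i. g' i v0)"
    using eventually_nhds_zariski_self[OF p g(3)] eventually_nhds_zariski_self[OF p g'(3)] v0 by simp_all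
  have "pointlike (\<psi> p)" "pointlike (\<psi>' p)"
    using regular_map_mem[OF \<psi>(1) p] regular_map_mem[OF \<psi>'(1) p] graph_closure_points by auto
  then have nz: "(\<lambda>i. g i v0) \<noteq> 0" "(\<lambda>i. g' i v0) \<noteq> 0" using at by simp_all
  then obtain k0 k1 where k: "g k0 v0 \<noteq> 0" "g' k1 v0 \<noteq> 0" by (auto simp: fun_eq_iff)
  show ?thesis
    unfolding at
  proof (rule pt_proportional[OF nz])
    fix k l
    have num: "is_form (D + E) (\<lambda>v. g k v * g' l v - g l v * g' k v)" by (intro is_form_diff is_form_mult g g')
    \<comment> \<open>A product of coordinates nonzero at \<open>p\<close>, one from each lift; it
      only serves to turn the minor into a regular function.\<close>
    have den: "is_form (D + E) (\<lambda>v. g k0 v * g' k1 v)" by (intro is_form_mult g g')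
    obtain s where s: "\<And>q v. pointlike q \<Longrightarrow> v \<in> q \<Longrightarrow>
        s q = (g k v * g' l v - g l v * g' k v) / (g k0 v * g' k1 v)"
      using quotient_function[OF num den] by metis
    have "reg_at W p s"
      by (rule reg_at_quotient[OF W p num den v0]) (use W s k in auto)
    moreover have "\<forall>\<^sub>F q in zariski_nhds W p. s q * h q = 0"
      using g(3) g'(3) eventually_nhds_zariski_open[OF lift_dataD(1)[OF L] pV]
    proof eventually_elim
      case (elim q)
      show "s q * h q = 0"
      proof (cases "h q = 0")
        case False
        have qW: "q \<in> W" using elim lift_dataD(2)[OF L] by auto
        then obtain v where v: "v \<in> q" using W pointlike_ex by blast
        obtain x where x: "x \<in> \<phi> q" using regular_map_mem[OF \<phi> qW] X_points pointlike_ex by blast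
        have "pt (\<lambda>i. g i v) = pt (\<lambda>i. g' i v)"
          using off[OF \<psi> elim(3) False x] off[OF \<psi>' elim(3) False x] elim(1,2) v by simp
        then obtain c where c: "(\<lambda>i. g i v) = scale_vec c (\<lambda>i. g' i v)" unfolding pt_eq_iff by blast
        have "g i v = c * g' i v" for i using fun_cong[OF c, of i] by (simp add: scale_vec_def)
        then have "s q = 0" using s[of q v] W qW v by simp
        then show ?thesis by simp
      qed simp
    qed
    ultimately have "s p = 0" by (rule nonzerodivisor_atD[OF lift_dataD(6)[OF L pV]])
    then show "g k v0 * g' l v0 = g l v0 * g' k v0" using s[of p v0] W p v0 k by simp
  qed
qed

text \<open>Where the entry with indices \<open>i0\<close>, \<open>j0\<close> is nonzero, the
  generator with index \<open>j0\<close> divides all others, the quotients being ratios of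
  coordinates of the second factor. It can be cancelled because it is nonzero at the graph points of
  this chart, and forms vanishing on the graph vanish on the closure.\<close>

lemma graph_closure_invertible:
  assumes I: "ideal_generated_by_forms X m d f I"
  shows "invertible_ideal graph_closure (inverse_image_ideal graph_closure X fst_proj I)"
  unfolding invertible_ideal_def
proof
  fix p assume p: "p \<in> graph_closure"
  from p obtain v0 w0 where vw0: "p = pt (segre v0 w0)" "v0 \<noteq> 0" "w0 \<noteq> 0" "w0 \<in> coords m"
    by (rule graph_closure_pointE)
  obtain i0 j0 where ij: "v0 i0 \<noteq> 0" "w0 j0 \<noteq> 0" using vw0(2,3) by (auto simp: fun_eq_iff)
  have j0: "j0 \<le> m"
  proof (rule ccontr)
    assume "\<not> j0 \<le> m"
    then have "w0 j0 = 0" using vw0(4) by (simp add: coords_def)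
    then show False using ij(2) by simp
  qed
  define k0 where "k0 = e i0 j0"
  define V where "V = chart_dom graph_closure k0"
  let ?c = "\<lambda>j q. chart d i0 (f j) (fst_proj q)"
  define h where "h = ?c j0"
  \<comment> \<open>This is the ratio w_j / w_j0 of coordinates of the second factor.\<close>
  define t where "t j = chart (Suc 0) k0 (\<lambda>z::nat \<Rightarrow> 'k. z (e i0 j))" for j
  have V: "openin (zariski graph_closure) V" "V \<subseteq> graph_closure"
    unfolding V_def using openin_chart_dom by (auto simp: chart_dom_def)
  have "p \<in> V"
    unfolding V_def
    by (rule chart_domI[of _ _ "segre v0 w0"]) (use p graph_closure_points ij vw0(2,3) in \<open>simp_all add: vw0(1) k0_def segre_nz\<close>)
  have point: "\<exists>v w. q = pt (segre v w) \<and> pt v \<in> X \<and> v i0 \<noteq> 0 \<and> w j0 \<noteq> 0 \<and> fst_proj q = pt v \<and>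
      (\<forall>j l. f j v * w l = f l v * w j)" if q: "q \<in> V" for q
  proof -
    have "q \<in> graph_closure" using q V by auto
    then obtain v w where vw: "q = pt (segre v w)" "pt v \<in> X" "v \<noteq> 0" "w \<noteq> 0" "w \<in> coords m"
      "\<And>j l. f j v * w l = f l v * w j"
      by (rule graph_closure_pointE) (rule that)
    have "segre v w \<in> q" using vw(1) by simp
    then have "segre v w k0 \<noteq> 0" using q unfolding V_def chart_dom_def by blast
    then show ?thesis
      using vw fst_proj_segre[OF vw(3,4)] by (intro exI[of _ v] exI[of _ w]) (simp add: k0_def)
  qed
  have ch: "fst_proj q \<in> chart_dom X i0" if q: "q \<in> V" for q
  proof -
    obtain v where v: "pt v \<in> X" "v i0 \<noteq> 0" "fst_proj q = pt v" using point[OF q] by blast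
    then show ?thesis using X_points by (intro chart_domI[of _ _ v]) auto
  qed
  have t_reg: "reg_at graph_closure q (t j)" if "q \<in> V" for q j
    unfolding t_def using that by (intro reg_at_chart[OF graph_closure_points is_form_var]) (simp add: V_def)
  have c_eq: "?c j q = t j q * h q" if q: "q \<in> V" for q j
  proof -
    obtain v w where vw: "q = pt (segre v w)" "pt v \<in> X" "v i0 \<noteq> 0" "w j0 \<noteq> 0" "fst_proj q = pt v"
      "f j v * w j0 = f j0 v * w j" using point[OF q] by blast
    have "pointlike q" using q V graph_closure_points by auto
    then have "t j q = w j / w j0"
      unfolding t_def using chart_eq[OF is_form_var[of "e i0 j"], of q "segre v w" k0] vw(1,3)
      by (simp add: k0_def)
    moreover have "?c l q = f l v / v i0 ^ d" for l
      unfolding vw(5) using chart_form_vec[OF vw(2), of v i0 l] by (simp add: form_vec_def)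
    moreover have "f j v = w j / w j0 * f j0 v" using vw(4,6) by (simp add: field_simps)
    ultimately show ?thesis by (simp add: h_def)
  qed
  have nzd: "nonzerodivisor_at graph_closure q h" if q: "q \<in> V" for q
    unfolding nonzerodivisor_at_def
  proof (intro allI impI)
    fix s assume s: "reg_at graph_closure q s" "\<forall>\<^sub>F r in zariski_nhds graph_closure q. s r * h r = 0"
    have qG: "q \<in> graph_closure" using q V by auto
    obtain D F H where F: "is_form D F" "is_form D H"
      "\<forall>\<^sub>F r in zariski_nhds graph_closure q. \<forall>v\<in>r. H v \<noteq> 0 \<and> s r = F v / H v"
      using s(1) unfolding reg_at_def by blast
    have "\<forall>\<^sub>F r in zariski_nhds graph_closure q. r \<in> V \<and> s r * h r = 0 \<and> (\<forall>v\<in>r. H v \<noteq> 0 \<and> s r = F v / H v)"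
      using F(3) s(2) eventually_nhds_zariski_open[OF V(1) q] by eventually_elim simp
    from zariski_nhds_basic[OF graph_closure_points qG this] obtain E S where S: "is_form E S" "\<forall>v\<in>q. S v \<noteq> 0"
      "\<forall>r\<in>graph_closure. \<forall>v\<in>r. S v \<noteq> 0 \<longrightarrow>
        r \<in> V \<and> s r * h r = 0 \<and> (\<forall>v\<in>r. H v \<noteq> 0 \<and> s r = F v / H v)"
      by (elim exE conjE)
    obtain z where z: "z \<in> q" using graph_closure_points qG pointlike_ex by blast
    \<comment> \<open>\<open>S\<close> is nonzero only at points of the closure where the local
      description of \<open>s\<close> is valid, so the product vanishes on the whole graph and
      \<open>vanish\<close> applies.\<close>
    have "F z * S z = 0"
    proof (rule vanish[OF qG z is_form_mult[OF F(1) S(1)]])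
      fix u assume u: "pt u \<in> X" "form_vec u \<noteq> 0"
      let ?r = "pt (segre u (form_vec u))"
      have "?r \<in> graph" using u unfolding graph_def by blast
      then have rG: "?r \<in> graph_closure" using graph_sub by blast
      show "F (segre u (form_vec u)) * S (segre u (form_vec u)) = 0"
      proof (cases "S (segre u (form_vec u)) = 0")
        case False
        have r: "?r \<in> V" "s ?r * h ?r = 0" "H (segre u (form_vec u)) \<noteq> 0"
            "s ?r = F (segre u (form_vec u)) / H (segre u (form_vec u))"
          using S(3)[rule_format, OF rG self_in_pt False] self_in_pt by blast+
        have "segre u (form_vec u) k0 \<noteq> 0"
          using r(1) self_in_pt[of "segre u (form_vec u)"] unfolding V_def chart_dom_def by blast
        then have nz: "u i0 \<noteq> 0" "form_vec u j0 \<noteq> 0" by (simp_all add: k0_def)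
        have "fst_proj ?r = pt u" using pt_in_X[OF u(1)] u(2) fst_proj_segre by simp
        then have "h ?r = form_vec u j0 / u i0 ^ d"
          using chart_form_vec[OF u(1), of u] by (simp add: h_def)
        then show ?thesis using r(2-4) nz by simp
      qed simp
    qed
    then have "F z = 0" using S(2) z by simp
    then show "s q = 0" using eventually_nhds_zariski_self[OF qG F(3)] z by auto
  qed
  have gen: "inverse_image_ideal graph_closure X fst_proj I V' =
          {s. \<exists>a\<in>structure_sheaf graph_closure V'. \<forall>q\<in>V'. s q = a q * h q} \<and>
        (\<forall>a\<in>structure_sheaf graph_closure V'. (\<forall>q\<in>V'. a q * h q = 0) \<longrightarrow> (\<forall>q\<in>V'. a q = 0))"
    if V': "openin (zariski graph_closure) V'" "V' \<subseteq> V" for V'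
  proof (intro conjI set_eqI iffI ballI impI)
    have VG: "q \<in> graph_closure" if "q \<in> V'" for q using that V' V by auto
    have J: "s \<in> inverse_image_ideal graph_closure X fst_proj I V' \<longleftrightarrow> (\<forall>p\<in>V'. span_at graph_closure p m ?c s)" for s
      by (rule mem_inverse_image_ideal[OF graph_closure_points X_points fst_proj_regular I V'(1)]) (use ch V' in auto)
    fix s
    {
      assume s: "s \<in> inverse_image_ideal graph_closure X fst_proj I V'"
      have "\<exists>a\<in>structure_sheaf graph_closure V'. \<forall>q\<in>V'. s q = a q * h q"
      proof (rule glue_quotient[OF V'(1) nzd])
        fix q assume q: "q \<in> V'"
        then have qV: "q \<in> V" using V'(2) by auto
        obtain b where b: "\<And>j. j \<le> m \<Longrightarrow> reg_at graph_closure q (b j)"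
          "\<forall>\<^sub>F r in zariski_nhds graph_closure q. s r = (\<Sum>j\<le>m. b j r * ?c j r)"
          using s q unfolding J span_at_def by blast
        show "\<exists>b. reg_at graph_closure q b \<and> (\<forall>\<^sub>F r in zariski_nhds graph_closure q. s r = b r * h r)"
        proof (intro exI conjI)
          show "reg_at graph_closure q (\<lambda>r. \<Sum>j\<le>m. b j r * t j r)"
            using b(1) t_reg[OF qV] by (intro reg_at_sum reg_at_mult) simp_all
          show "\<forall>\<^sub>F r in zariski_nhds graph_closure q. s r = (\<Sum>j\<le>m. b j r * t j r) * h r"
            using b(2) eventually_nhds_zariski_open[OF V(1) qV]
            by eventually_elim (simp add: c_eq sum_distrib_right mult.assoc)
        qed
      qed (use V'(2) in auto)
      then show "s \<in> {s. \<exists>a\<in>structure_sheaf graph_closure V'. \<forall>q\<in>V'. s q = a q * h q}" by simp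
    next
      assume "s \<in> {s. \<exists>a\<in>structure_sheaf graph_closure V'. \<forall>q\<in>V'. s q = a q * h q}"
      then obtain b where b: "b \<in> structure_sheaf graph_closure V'" "\<forall>q\<in>V'. s q = b q * h q"
        by blast
      show "s \<in> inverse_image_ideal graph_closure X fst_proj I V'"
        unfolding J
      proof
        fix q assume q: "q \<in> V'"
        have "span_at graph_closure q m ?c (\<lambda>q. b q * h q)"
        proof (rule span_at_mult)
          show "reg_at graph_closure q b" using b(1) q mem_structure_sheaf[OF V'(1)] by blast
          show "span_at graph_closure q m ?c h"
            unfolding h_def using span_at_generator[OF j0, of graph_closure q ?c] by simp
        qed
        moreover have "\<forall>\<^sub>F r in zariski_nhds graph_closure q. s r = b r * h r"
          using eventually_nhds_zariski_open[OF V'(1) q] by eventually_elim (use b(2) in blast)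
        ultimately show "span_at graph_closure q m ?c s" by (rule span_at_cong)
      qed
    next
      fix q assume s: "s \<in> structure_sheaf graph_closure V'" "\<forall>q\<in>V'. s q * h q = 0" and q: "q \<in> V'"
      have "\<forall>\<^sub>F r in zariski_nhds graph_closure q. s r * h r = 0"
        using eventually_nhds_zariski_open[OF V'(1) q] by eventually_elim (use s(2) in blast)
      moreover have "q \<in> V" using q V'(2) by auto
      moreover have "reg_at graph_closure q s" using s(1) q mem_structure_sheaf[OF V'(1)] by blast
      ultimately show "s q = 0" using nonzerodivisor_atD[OF nzd] by blast
    }
  qed
  show "\<exists>V h. openin (zariski graph_closure) V \<and> p \<in> V \<and>
      (\<forall>V'. openin (zariski graph_closure) V' \<and> V' \<subseteq> V \<longrightarrow>
        inverse_image_ideal graph_closure X fst_proj I V' =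
          {s. \<exists>a\<in>structure_sheaf graph_closure V'. \<forall>q\<in>V'. s q = a q * h q} \<and>
        (\<forall>a\<in>structure_sheaf graph_closure V'. (\<forall>q\<in>V'. a q * h q = 0) \<longrightarrow> (\<forall>q\<in>V'. a q = 0)))"
    by (rule exI[of _ V], rule exI[of _ h], intro conjI[OF V(1)] conjI[OF \<open>p \<in> V\<close>] allI impI, elim conjE, rule gen)
qed

lemma graph_closure_blowup:
  assumes I: "ideal_generated_by_forms X m d f I"
  shows "is_blowup X I graph_closure fst_proj"
  unfolding is_blowup_def
proof (intro conjI allI impI)
  show "quasi_projective X" "quasi_projective graph_closure"
    using closed_quasi_projective X_closed graph_closure_closed by blast+
  show "regular_map graph_closure X fst_proj" by (rule fst_proj_regular)
  show "invertible_ideal graph_closure (inverse_image_ideal graph_closure X fst_proj I)"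
    by (rule graph_closure_invertible[OF I])
  fix W \<phi>
  assume *: "quasi_projective W \<and> regular_map W X \<phi> \<and> invertible_ideal W (inverse_image_ideal W X \<phi> I)"
  then have W: "points W" and \<phi>: "regular_map W X \<phi>"
    using quasi_projective_points by blast+
  have ex: "\<exists>V i h A. lift_data W \<phi> V i h A \<and> p \<in> V" if "p \<in> W" for p
    using lift_data_ex[OF W \<phi> I _ that] * by simp
  show "\<exists>\<psi>. regular_map W graph_closure \<psi> \<and> (\<forall>w\<in>W. fst_proj (\<psi> w) = \<phi> w)"
    by (rule lift_exists[OF W \<phi> ex])
  show "\<forall>w\<in>W. \<psi> w = \<psi>' w"
    if "regular_map W graph_closure \<psi> \<and> (\<forall>w\<in>W. fst_proj (\<psi> w) = \<phi> w) \<and>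
       regular_map W graph_closure \<psi>' \<and> (\<forall>w\<in>W. fst_proj (\<psi>' w) = \<phi> w)" for \<psi> \<psi>'
    using lift_unique[OF W \<phi> ex, of \<psi> \<psi>'] that by simp
qed

end

section \<open>The ideal sheaves of the base locus and of a linear subspace\<close>

lemma homogeneous_sum:
  fixes F :: "'i \<Rightarrow> 'k::comm_ring_1 mpol"
  assumes "\<And>i. i \<in> A \<Longrightarrow> homogeneous d (F i)" shows "homogeneous d (\<Sum>i\<in>A. F i)"
proof -
  have 0: "homogeneous d (0 :: 'k mpol)" by (simp add: homogeneous_def)
  have add: "homogeneous d (F + G)" if "homogeneous d F" "homogeneous d G" for F G :: "'k mpol"
    using that Poly_Mapping.keys_add[of F G] by (auto simp: homogeneous_def)
  show ?thesis
    using assms by (induction A rule: infinite_finite_induct) (auto intro: 0 add)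
qed

lemma homogeneous_single_0: "homogeneous 0 (Poly_Mapping.single 0 c)"
  by (auto simp: homogeneous_def monom_degree_def)

lemma homogeneous_degree_unique:
  "homogeneous d F \<Longrightarrow> homogeneous e F \<Longrightarrow> F \<noteq> 0 \<Longrightarrow> d = e"
  unfolding homogeneous_def by (metis equals0I keys_eq_empty)

lemma peval_sum: "peval (\<Sum>i\<in>A. F i) v = (\<Sum>i\<in>A. peval (F i) v)"
  by (induction A rule: infinite_finite_induct) (simp_all add: peval_add)

lemma peval_const [simp]: "peval (Poly_Mapping.single 0 c) v = c"
  by (simp add: peval_single eval_monom_def)

definition form_fun :: "nat \<Rightarrow> (nat \<Rightarrow> 'k::field mpol) \<Rightarrow> nat \<Rightarrow> (nat \<Rightarrow> 'k) \<Rightarrow> 'k" where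
  "form_fun m f j v = (if j \<le> m then peval (f j) v else 0)"

lemma is_form_form_fun:
  assumes "\<And>i. i \<le> m \<Longrightarrow> f i \<in> forms n d" shows "is_form d (form_fun m f j)"
proof (cases "j \<le> m")
  case True
  then show ?thesis using is_form_peval[of d "f j"] assms by (simp add: form_fun_def[abs_def] forms_def)
qed (simp add: form_fun_def[abs_def])

lemma points_proj: "points (proj n)"
  using proj_pointlike by blast

text \<open>A local generator is F / H with \<open>F\<close> in the linear system and
  \<open>H\<close> of the same degree; it equals x_i^d / H times a combination of the f_j / x_i^d
  with constant coefficients.\<close>

lemma base_ideal_generated:
  fixes f :: "nat \<Rightarrow> 'k::field mpol"
  assumes f: "\<And>i. i \<le> m \<Longrightarrow> f i \<in> forms n d"
  shows "ideal_generated_by_forms (proj N) m d (form_fun m f) (base_ideal N (linear_system m f))"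
  unfolding ideal_generated_by_forms_def
proof (intro conjI allI impI)
  have hom: "homogeneous d (f i)" if "i \<le> m" for i using f[OF that] by (simp add: forms_def)
  note ff = is_form_form_fun[of m f n d, OF f]
  fix i j assume j: "j \<le> m"
  let ?V = "chart_dom (proj N :: 'k point set) i" and ?s = "chart d i (form_fun m f j)"
  have sys: "f j \<in> linear_system m f"
  proof -
    have "(\<Sum>i\<le>m. Poly_Mapping.single 0 (if i = j then 1 else 0) * f i) = (\<Sum>i\<le>m. if i = j then f i else 0)"
      by (intro sum.cong refl) simp
    also have "\<dots> = f j" using j by simp
    finally show ?thesis unfolding linear_system_def mem_Collect_eq by (intro exI[of _ "\<lambda>i. if i = j then 1 else 0"]) simp
  qed
  have quot: "is_quotient_on (f j) (Poly_Mapping.single (Poly_Mapping.single i d) 1) ?V ?s"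
    unfolding is_quotient_on_def
  proof (intro conjI exI[of _ d] ballI)
    show "homogeneous d (f j)" by (rule hom[OF j])
    show "homogeneous d (Poly_Mapping.single (Poly_Mapping.single i d) (1::'k))"
      by (simp add: homogeneous_def monom_degree_def)
    have ev: "peval (Poly_Mapping.single (Poly_Mapping.single i d) 1) v = v i ^ d" for v :: "nat \<Rightarrow> 'k"
      by (simp add: peval_single eval_monom_def)
    fix q assume q: "q \<in> ?V"
    then show "nonzero_at (Poly_Mapping.single (Poly_Mapping.single i d) 1) q"
      by (simp add: nonzero_at_def ev chart_dom_def)
    fix v assume v: "v \<in> q"
    have "pointlike q" using q proj_pointlike by (auto simp: chart_dom_def)
    from chart_eq[OF ff this v] j
    show "?s q = peval (f j) v / peval (Poly_Mapping.single (Poly_Mapping.single i d) 1) v"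
      by (simp add: ev form_fun_def)
  qed
  show "?s \<in> base_ideal N (linear_system m f) ?V"
    unfolding base_ideal_def generated_ideal_def mem_Collect_eq
  proof
    fix p assume "p \<in> ?V"
    show "\<exists>V T a. openin (zariski (proj N)) V \<and> p \<in> V \<and> V \<subseteq> ?V \<and> finite T \<and>
      T \<subseteq> {s. \<exists>F\<in>linear_system m f. \<exists>H. is_quotient_on F H V s} \<and>
      (\<forall>g\<in>T. a g \<in> structure_sheaf (proj N) V) \<and> (\<forall>q\<in>V. ?s q = (\<Sum>g\<in>T. a g q * g q))"
      by (rule exI[of _ ?V], rule exI[of _ "{?s}"], rule exI[of _ "\<lambda>g q. 1"])
        (use \<open>p \<in> ?V\<close> sys quot openin_chart_dom in \<open>auto simp: mem_structure_sheaf[OF openin_chart_dom]\<close>)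
  qed
next
  have hom: "homogeneous d (f i)" if "i \<le> m" for i using f[OF that] by (simp add: forms_def)
  note ff = is_form_form_fun[of m f n d, OF f]
  fix U b p i
  assume *: "openin (zariski (proj N)) U \<and> b \<in> base_ideal N (linear_system m f) U \<and> p \<in> U \<and> p \<in> chart_dom (proj N) i"
  let ?c = "\<lambda>j. chart d i (form_fun m f j)"
  have "b \<in> base_ideal N (linear_system m f) U" "p \<in> U" using * by simp_all
  from this(1)[unfolded base_ideal_def generated_ideal_def mem_Collect_eq, rule_format, OF this(2)]
  obtain V T a where V: "openin (zariski (proj N)) V" "p \<in> V" "V \<subseteq> U" "finite T"
    "T \<subseteq> {s. \<exists>F\<in>linear_system m f. \<exists>H. is_quotient_on F H V s}"
    "\<forall>g\<in>T. a g \<in> structure_sheaf (proj N) V" "\<forall>q\<in>V. b q = (\<Sum>g\<in>T. a g q * g q)"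
    by (elim exE conjE)
  have p: "p \<in> chart_dom (proj N) i" "p \<in> proj N" using * by (simp_all add: chart_dom_def)
  have "span_at (proj N) p m ?c (\<lambda>q. \<Sum>g\<in>T. a g q * g q)"
  proof (rule span_at_sum[OF V(4)], rule span_at_mult)
    fix g assume g: "g \<in> T"
    show "reg_at (proj N) p (a g)"
      using V(6) g V(2) mem_structure_sheaf[OF V(1)] by blast
    obtain F H where F: "F \<in> linear_system m f" "is_quotient_on F H V g"
      using subsetD[OF V(5) g] by blast
    obtain c where c: "F = (\<Sum>i\<le>m. Poly_Mapping.single 0 (c i) * f i)"
      using F(1) unfolding linear_system_def by blast
    obtain D where D: "homogeneous D F" "homogeneous D H"
      using F(2) unfolding is_quotient_on_def by blast
    have gq: "peval H v \<noteq> 0" "g q = peval F v / peval H v" if "q \<in> V" "v \<in> q" for q v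
      using F(2) that unfolding is_quotient_on_def nonzero_at_def by blast+
    show "span_at (proj N) p m ?c g"
    \<comment> \<open>The zero polynomial is homogeneous of every degree, so the degree of
      \<open>H\<close> is known to be \<open>d\<close> only when \<open>F\<close> is
      nonzero.\<close>
    proof (cases "F = 0")
      case True
      have "g q = 0" if q: "q \<in> V" for q
      proof -
        have "q \<in> proj N" using openin_subset[OF V(1)] q by auto
        then obtain v where "v \<in> q" using proj_pointlike pointlike_ex by blast
        then show ?thesis using gq(2)[OF q] True by simp
      qed
      then have "\<forall>\<^sub>F q in zariski_nhds (proj N) p. g q = 0"
        using eventually_nhds_zariski_open[OF V(1,2)] by (rule eventually_mono[rotated])
      then show ?thesis by (rule span_at_cong[OF span_at_zero])
    next
      case False
      have "homogeneous (0 + d) F"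
        unfolding c by (intro homogeneous_sum homogeneous_mult homogeneous_single_0 hom) simp
      then have "D = d" using homogeneous_degree_unique[OF D(1) _ False] by simp
      have xd: "is_form d (\<lambda>v::nat \<Rightarrow> 'k. v i ^ d)" using is_form_power[OF is_form_var[of i], of d] by simp
      have Hd: "is_form d (peval H)" using is_form_peval[OF D(2)] \<open>D = d\<close> by simp
      obtain r where r: "\<And>q v. pointlike q \<Longrightarrow> v \<in> q \<Longrightarrow> r q = v i ^ d / peval H v"
        using quotient_function[OF xd Hd] by metis
      obtain v0 where v0: "v0 \<in> p" using p(2) proj_pointlike pointlike_ex by blast
      have r_reg: "reg_at (proj N) p r"
        by (rule reg_at_quotient[OF points_proj p(2) xd Hd v0]) (simp add: gq(1)[OF V(2) v0], rule r[OF proj_pointlike])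
      show ?thesis
      proof (rule span_atI)
        show "reg_at (proj N) p (\<lambda>q. c j * r q)" for j
          using r_reg by (intro reg_at_mult reg_at_const)
        show "\<forall>\<^sub>F q in zariski_nhds (proj N) p. g q = (\<Sum>j\<le>m. (c j * r q) * ?c j q)"
          using eventually_nhds_zariski_open[OF V(1,2)] eventually_nhds_zariski_open[OF openin_chart_dom p(1)]
        proof eventually_elim
          case (elim q)
          then have q: "pointlike q" using proj_pointlike by (auto simp: chart_dom_def)
          then obtain v where v: "v \<in> q" using pointlike_ex by blast
          have vi: "v i \<noteq> 0" using elim(2) v by (simp add: chart_dom_def)
          have "(\<Sum>j\<le>m. (c j * r q) * ?c j q) = (\<Sum>j\<le>m. c j * peval (f j) v / peval H v)"
            using vi by (intro sum.cong refl) (simp add: chart_eq[OF ff q v] r[OF q v] form_fun_def)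
          also have "\<dots> = peval F v / peval H v"
            unfolding c by (simp add: peval_sum peval_mult sum_divide_distrib)
          finally show ?case using gq(2)[OF elim(1) v] by simp
        qed
      qed
    qed
  qed
  moreover have "\<forall>\<^sub>F q in zariski_nhds (proj N) p. b q = (\<Sum>g\<in>T. a g q * g q)"
    using eventually_nhds_zariski_open[OF V(1,2)] by eventually_elim (use V(7) in blast)
  ultimately show "span_at (proj N) p m ?c b" by (rule span_at_cong)
qed

section \<open>Linear forms and the ideal of a linear subspace\<close>

lemma is_form_linear:
  assumes "is_form (Suc 0) g"
  shows "g (u + v) = g u + g v" "g (scale_vec c v) = c * g v"
proof -
  have const: "h u = h v" if "is_form D h" "D = 0" for D and h :: "(nat \<Rightarrow> 'a) \<Rightarrow> 'a" and u v
    using that by (induction rule: is_form_induct) auto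
  \<comment> \<open>The induction runs over all degrees, so the degree is kept as a premise; in the
    variable case the cofactor has degree 0 and is constant.\<close>
  have "D = Suc 0 \<longrightarrow> h (u + v) = h u + h v" if "is_form D h" for D h
    using that
  proof (induction rule: is_form_induct)
    case (var d h i)
    show ?case
    proof
      assume "Suc d = Suc 0"
      then have *: "h (u + v) = h u" "h v = h u"
        using const[OF var.hyps] by blast+
      show "(u + v) i * h (u + v) = u i * h u + v i * h v"
        unfolding * by (simp add: distrib_right)
    qed
  qed auto
  then show "g (u + v) = g u + g v" using assms by blast
  show "g (scale_vec c v) = c * g v" using is_form_scale[OF assms] by simp
qed

lemma is_form_linear_sum:
  assumes "is_form (Suc 0) g" "finite A"
  shows "g (\<Sum>j\<in>A. scale_vec (c j) (e j)) = (\<Sum>j\<in>A. c j * g (e j))"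
  using assms(2)
proof (induction A rule: finite_induct)
  case empty
  have "g (scale_vec 0 0) = 0" unfolding is_form_linear(2)[OF assms(1)] by simp
  then show ?case by (simp add: scale_vec_def zero_fun_def)
next
  case (insert i A)
  then show ?case unfolding sum.insert[OF insert.hyps] is_form_linear[OF assms(1)] by simp
qed

text \<open>For suitable vectors \<open>e\<^sub>j\<close> this is a linear projection onto the common kernel of the \<open>l\<^sub>j\<close>, even if
  the \<open>l\<^sub>j\<close> are linearly dependent.\<close>

definition retract ::
  "nat \<Rightarrow> (nat \<Rightarrow> (nat \<Rightarrow> 'k) \<Rightarrow> 'k) \<Rightarrow> (nat \<Rightarrow> nat \<Rightarrow> 'k) \<Rightarrow> (nat \<Rightarrow> 'k) \<Rightarrow> nat \<Rightarrow> 'k::field" where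
  "retract m l e v = v - (\<Sum>j<m. scale_vec (l j v) (e j))"

lemma is_form_diff_vec: "is_form (Suc 0) g \<Longrightarrow> g (u - v) = g u - g v"
  using is_form_linear(1)[of g u "scale_vec (- 1) v"] is_form_linear(2)[of g "- 1" v]
  by (simp add: scale_vec_def fun_diff_def plus_fun_def)

lemma retract_coords:
  assumes "\<And>j. j < m \<Longrightarrow> e j \<in> coords n" "v \<in> coords n" shows "retract m l e v \<in> coords n"
  unfolding retract_def using assms
  by (intro vec.subspace_diff vec.subspace_sum vec.subspace_scale subspace_coords) auto

text \<open>Elimination, one linear form at a time. If the new form vanishes on the image of the
  retraction found so far, nothing changes; otherwise that image contains a vector \<open>u\<close>
  with value 1, and a multiple of it is subtracted.\<close>

lemma retract_exists:
  assumes l: "\<And>j. is_form (Suc 0) (l j)"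
  shows "\<exists>e. (\<forall>j<m. e j \<in> coords n) \<and> (\<forall>v\<in>coords n. \<forall>i<m. l i (retract m l e v) = 0)"
proof (induction m)
  case (Suc m)
  then obtain e where e: "\<And>j. j < m \<Longrightarrow> e j \<in> coords n"
    and ker: "\<And>v i. v \<in> coords n \<Longrightarrow> i < m \<Longrightarrow> l i (retract m l e v) = 0"
    by blast
  show ?case
  proof (cases "\<forall>v\<in>coords n. l m (retract m l e v) = 0")
    case True
    let ?e = "e(m := 0)"
    have eq: "retract (Suc m) l ?e v = retract m l e v" for v
    proof -
      have "scale_vec (l m v) 0 = 0" by (simp add: scale_vec_def zero_fun_def)
      then show ?thesis by (simp add: retract_def)
    qed
    show ?thesis
    proof (intro exI[of _ ?e] conjI allI impI ballI)
      show "?e j \<in> coords n" if "j < Suc m" for j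
        using that e[of j] vec.subspace_0[OF subspace_coords, of n] by auto
      show "l i (retract (Suc m) l ?e v) = 0" if "v \<in> coords n" "i < Suc m" for v i
        unfolding eq using that ker True by (auto simp: less_Suc_eq)
    qed
  next
    case False
    then obtain u0 where u0: "u0 \<in> coords n" "l m (retract m l e u0) \<noteq> 0" by blast
    define u where "u = scale_vec (1 / l m (retract m l e u0)) (retract m l e u0)"
    have "retract m l e u0 \<in> coords n" by (rule retract_coords) (use e u0(1) in auto)
    then have u: "u \<in> coords n" "l m u = 1" "\<And>i. i < m \<Longrightarrow> l i u = 0"
      unfolding u_def using u0 ker[OF u0(1)]
      by (auto simp: is_form_linear(2)[OF l] intro: vec.subspace_scale[OF subspace_coords])
    \<comment> \<open>Chosen so that the new retraction is the old one followed by removal of the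
      \<open>u\<close> component; \<open>u\<close> lies in the kernel of the earlier forms, which
      therefore stay zero.\<close>
    let ?e = "\<lambda>j. if j = m then u else e j - scale_vec (l m (e j)) u"
    have eq: "retract (Suc m) l ?e v = retract m l e v - scale_vec (l m (retract m l e v)) u" for v
    proof -
      have lm: "l m (retract m l e v) = l m v - (\<Sum>j<m. l j v * l m (e j))"
        unfolding retract_def by (simp add: is_form_diff_vec[OF l] is_form_linear_sum[OF l])
      have "(\<Sum>j<m. scale_vec (l j v) (?e j)) =
          (\<Sum>j<m. scale_vec (l j v) (e j) - scale_vec (l j v * l m (e j)) u)"
        by (intro sum.cong refl) (auto simp: scale_vec_def algebra_simps)
      also have "\<dots> = (\<Sum>j<m. scale_vec (l j v) (e j)) - scale_vec (\<Sum>j<m. l j v * l m (e j)) u"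
        by (simp add: sum_subtractf vec.scale_sum_left)
      finally have "retract (Suc m) l ?e v =
          v - ((\<Sum>j<m. scale_vec (l j v) (e j)) - scale_vec (\<Sum>j<m. l j v * l m (e j)) u + scale_vec (l m v) u)"
        unfolding retract_def by simp
      then show ?thesis
        unfolding lm vec.scale_left_diff_distrib by (simp add: retract_def)
    qed
    show ?thesis
    proof (intro exI[of _ ?e] conjI allI impI ballI)
      show "?e j \<in> coords n" if "j < Suc m" for j
        using that e[of j] u(1)
        by (auto intro!: vec.subspace_diff[OF subspace_coords] vec.subspace_scale[OF subspace_coords])
      show "l i (retract (Suc m) l ?e v) = 0" if "v \<in> coords n" "i < Suc m" for v i
        unfolding eq is_form_diff_vec[OF l] is_form_linear(2)[OF l] using that ker[of v i] u
        by (cases "i = m") auto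
    qed
  qed
qed simp

text \<open>A form vanishing on the common kernel of the \<open>l\<^sub>j\<close> lies in the ideal they generate: telescope
  \<open>F(v) - F(r(v))\<close>, where \<open>r\<close> is the retraction onto the kernel.\<close>

lemma is_form_retract:
  assumes l: "\<And>j. is_form (Suc 0) (l j)" and "is_form D F"
  shows "(D = 0 \<longrightarrow> (\<forall>u v. F u = F v)) \<and> (\<forall>D'. D = Suc D' \<longrightarrow>
    (\<exists>G. (\<forall>j. is_form D' (G j)) \<and> (\<forall>v. F v - F (retract m l e v) = (\<Sum>j<m. l j v * G j v))))"
  using assms(2)
proof (induction rule: is_form_induct)
  case (zero d)
  show ?case by (intro conjI allI impI exI[of _ "\<lambda>j v. 0"]) auto
next
  case (const c)
  show ?case by simp
next
  case (add d g h)
  show ?case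
  proof (intro conjI allI impI)
    show "g u + h u = g v + h v" if "d = 0" for u v using add.IH that by metis
    fix D' assume D': "d = Suc D'"
    obtain G where G: "\<And>j. is_form D' (G j)" "\<And>v. g v - g (retract m l e v) = (\<Sum>j<m. l j v * G j v)"
      using add.IH(1) D' by blast
    obtain H where H: "\<And>j. is_form D' (H j)" "\<And>v. h v - h (retract m l e v) = (\<Sum>j<m. l j v * H j v)"
      using add.IH(2) D' by blast
    show "\<exists>G. (\<forall>j. is_form D' (G j)) \<and>
      (\<forall>v. g v + h v - (g (retract m l e v) + h (retract m l e v)) = (\<Sum>j<m. l j v * G j v))"
    proof (intro exI[of _ "\<lambda>j v. G j v + H j v"] conjI allI)
      show "is_form D' (\<lambda>v. G j v + H j v)" for j using G(1) H(1) by (rule is_form_add)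
      show "g v + h v - (g (retract m l e v) + h (retract m l e v)) = (\<Sum>j<m. l j v * (G j v + H j v))" for v
        unfolding distrib_left sum.distrib G(2)[symmetric] H(2)[symmetric] by simp
    qed
  qed
next
  case (var d g i)
  have r: "is_form (Suc 0) (\<lambda>v. retract m l e v k)" for k
  proof -
    have eq: "retract m l e v k = v k - (\<Sum>j<m. e j k * l j v)" for v
    proof -
      have "(\<Sum>j<m. scale_vec (l j v) (e j)) k = (\<Sum>j<m. e j k * l j v)"
        by (induction m) (simp_all add: scale_vec_def)
      then show ?thesis by (simp add: retract_def)
    qed
    show ?thesis unfolding eq by (intro is_form_diff is_form_var is_form_sum is_form_cmult l)
  qed
  have coord: "v i - retract m l e v i = (\<Sum>j<m. l j v * e j i)" for v
  proof -
    have "(\<Sum>j<m. scale_vec (l j v) (e j)) i = (\<Sum>j<m. l j v * e j i)"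
      by (induction m) (simp_all add: scale_vec_def)
    then show ?thesis by (simp add: retract_def)
  qed
  show ?case
  proof (intro conjI allI impI)
    fix D' assume "Suc d = Suc D'"
    then have D': "D' = d" by simp
    have gr: "is_form d (\<lambda>v. g (retract m l e v))"
      using is_form_subst[OF var.hyps r] by simp
    \<comment> \<open>In degree 0 there are no coefficients of lower degree, but there the
      difference vanishes; stating the degree for the product with \<open>v i\<close> covers both
      cases.\<close>
    have "\<exists>G. (\<forall>j. is_form d (\<lambda>v. v i * G j v)) \<and> (\<forall>v. g v - g (retract m l e v) = (\<Sum>j<m. l j v * G j v))"
    proof (cases d)
      case 0
      have "g v = g (retract m l e v)" for v using var.IH[THEN conjunct1] 0 by blast
      then show ?thesis by (intro exI[of _ "\<lambda>j v. 0"]) simp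
    next
      case (Suc d')
      then obtain G where G: "\<And>j. is_form d' (G j)" "\<And>v. g v - g (retract m l e v) = (\<Sum>j<m. l j v * G j v)"
        using var.IH by blast
      then show ?thesis
        using is_form_mult[OF is_form_var[of i] G(1)] Suc by (intro exI[of _ G]) simp
    qed
    then obtain G where G: "\<And>j. is_form d (\<lambda>v. v i * G j v)"
      "\<And>v. g v - g (retract m l e v) = (\<Sum>j<m. l j v * G j v)" by blast
    show "\<exists>G. (\<forall>j. is_form D' (G j)) \<and>
        (\<forall>v. v i * g v - retract m l e v i * g (retract m l e v) = (\<Sum>j<m. l j v * G j v))"
    proof (intro exI[of _ "\<lambda>j v. v i * G j v + e j i * g (retract m l e v)"] conjI allI)
      show "is_form D' (\<lambda>v. v i * G j v + e j i * g (retract m l e v))" for j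
        unfolding D' by (intro is_form_add is_form_cmult G(1) gr)
      fix v
      have "v i * g v - retract m l e v i * g (retract m l e v) =
          v i * (g v - g (retract m l e v)) + (v i - retract m l e v i) * g (retract m l e v)"
        by (simp add: algebra_simps)
      also have "\<dots> = (\<Sum>j<m. l j v * (v i * G j v + e j i * g (retract m l e v)))"
        unfolding G(2) coord
        by (simp add: sum_distrib_left sum_distrib_right distrib_left sum.distrib mult_ac)
      finally show "v i * g v - retract m l e v i * g (retract m l e v) =
          (\<Sum>j<m. l j v * (v i * G j v + e j i * g (retract m l e v)))" .
    qed
  qed simp
qed

text \<open>Near a point outside \<open>L\<close> some linear form is invertible, so the generators
  give the unit ideal. Near a point of \<open>L\<close> a section is F / H, and multiplying by a
  form \<open>S\<close> that is nonzero on \<open>X\<close> only where this description holds makes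
  the numerator vanish on all of \<open>L\<close>; as \<open>L\<close> is linear, the product is a
  combination of the linear forms with forms as coefficients.\<close>

lemma linear_ideal_generated:
  fixes l :: "nat \<Rightarrow> 'k::field mpol"
  assumes X: "X \<subseteq> proj n" and l: "\<And>i. i \<le> m \<Longrightarrow> l i \<in> forms n 1"
    and L: "L = {p\<in>proj n. \<forall>i\<le>m. zero_at (l i) p}" "L \<subseteq> X"
  shows "ideal_generated_by_forms X m 1 (form_fun m l) (ideal_of_subvariety X L)"
  unfolding ideal_generated_by_forms_def
proof (intro conjI allI impI)
  have ff: "is_form (Suc 0) (form_fun m l j)" for j using is_form_form_fun[of m l n 1, OF l] by simp
  have pX: "points X" using X proj_pointlike by blast
  fix i j assume j: "j \<le> m"
  have "chart 1 i (form_fun m l j) q = 0" if "q \<in> L" for q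
  proof -
    have q: "pointlike q" "zero_at (l j) q" using that j proj_pointlike by (auto simp: L(1))
    then obtain v where v: "v \<in> q" using pointlike_ex by blast
    then show ?thesis using q(2) j chart_eq[OF ff q(1) v] by (simp add: zero_at_def form_fun_def)
  qed
  then show "chart 1 i (form_fun m l j) \<in> ideal_of_subvariety X L (chart_dom X i)"
    unfolding ideal_of_subvariety_def mem_structure_sheaf[OF openin_chart_dom] mem_Collect_eq
    using reg_at_chart[OF pX ff] by simp
next
  have ff: "is_form (Suc 0) (form_fun m l j)" for j using is_form_form_fun[of m l n 1, OF l] by simp
  have pX: "points X" using X proj_pointlike by blast
  fix U b p i
  assume *: "openin (zariski X) U \<and> b \<in> ideal_of_subvariety X L U \<and> p \<in> U \<and> p \<in> chart_dom X i"
  then have U: "openin (zariski X) U" "p \<in> U" and pc: "p \<in> chart_dom X i" by simp_all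
  have b: "reg_at X p b" "\<And>q. q \<in> U \<Longrightarrow> q \<in> L \<Longrightarrow> b q = 0"
    using * mem_structure_sheaf[OF U(1)] by (auto simp: ideal_of_subvariety_def)
  have p: "p \<in> X" using pc by (simp add: chart_dom_def)
  then have p': "pointlike p" using pX by blast
  obtain v0 where v0: "v0 \<in> p" using pointlike_ex[OF p'] by blast
  let ?c = "\<lambda>j. chart 1 i (form_fun m l j)"
  show "span_at X p m ?c b"
  proof (cases "\<exists>j\<le>m. form_fun m l j v0 \<noteq> 0")
    case True
    then obtain j where j: "j \<le> m" "form_fun m l j v0 \<noteq> 0" by blast
    obtain r where r: "\<And>q v. pointlike q \<Longrightarrow> v \<in> q \<Longrightarrow> r q = v i / form_fun m l j v"
      using quotient_function[OF is_form_var[of i] ff[of j]] by metis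
    have "reg_at X p r"
      by (rule reg_at_quotient[OF pX p is_form_var[of i] ff v0 j(2)]) (use r pX in auto)
    then have "span_at X p m ?c (\<lambda>q. (b q * r q) * ?c j q)"
      using b(1) by (intro span_at_mult reg_at_mult span_at_generator j(1))
    moreover have "\<forall>\<^sub>F q in zariski_nhds X p. b q = (b q * r q) * ?c j q"
      using eventually_nhds_zariski_basic[OF ff pX p v0 j(2)] eventually_nhds_zariski_open[OF openin_chart_dom pc]
    proof eventually_elim
      case (elim q)
      then have q: "pointlike q" using pX by (auto simp: chart_dom_def)
      then obtain v where v: "v \<in> q" using pointlike_ex by blast
      show ?case
        using elim v r[OF q v] chart_eq[OF ff q v] by (simp add: chart_dom_def)
    qed
    ultimately show ?thesis by (rule span_at_cong)
  next
    case False
    obtain D F H where F: "is_form D F" "is_form D H" "\<forall>\<^sub>F q in zariski_nhds X p. \<forall>v\<in>q. H v \<noteq> 0 \<and> b q = F v / H v"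
      using b(1) unfolding reg_at_def by blast
    have "\<forall>\<^sub>F q in zariski_nhds X p. q \<in> U \<and> (\<forall>v\<in>q. H v \<noteq> 0 \<and> b q = F v / H v)"
      using F(3) eventually_nhds_zariski_open[OF U] by eventually_elim simp
    from zariski_nhds_basic[OF pX p this] obtain E S where S: "is_form E S" "\<forall>v\<in>p. S v \<noteq> 0"
      "\<forall>q\<in>X. \<forall>v\<in>q. S v \<noteq> 0 \<longrightarrow> q \<in> U \<and> (\<forall>v\<in>q. H v \<noteq> 0 \<and> b q = F v / H v)"
      by (elim exE conjE)
    define K where "K v = F v * S v" for v
    have K: "is_form (D + E) K" using is_form_mult[OF F(1) S(1)] by (simp add: K_def[abs_def])
    have K0: "K v = 0" if v: "v \<in> coords n" "v \<noteq> 0" "\<And>j. j \<le> m \<Longrightarrow> form_fun m l j v = 0" for v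
    proof (cases "S v = 0")
      case False
      have "zero_at (l j) (pt v)" if j: "j \<le> m" for j
      proof -
        have "homogeneous 1 (l j)" using l[OF j] by (simp add: forms_def)
        then show ?thesis using zero_at_iff(1)[of 1 "l j" "pt v" v] v(2) v(3)[OF j] j by (simp add: form_fun_def)
      qed
      then have q: "pt v \<in> L" using pt_in_proj[OF v(2,1)] by (simp add: L(1))
      then have "pt v \<in> U \<and> (\<forall>x\<in>pt v. H x \<noteq> 0 \<and> b (pt v) = F x / H x)"
        using S(3) L(2) False self_in_pt by blast
      then have "F v = 0" using b(2) q self_in_pt[of v] by auto
      then show ?thesis by (simp add: K_def)
    qed (simp add: K_def)
    have v0': "v0 \<in> coords n" "v0 \<noteq> 0"
      using proj_coords p X v0 pointlike_in(2)[OF p' v0] by blast+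
    have "K v0 = 0" using K0[OF v0'] False by auto
    obtain e where e: "\<And>j. j < Suc m \<Longrightarrow> e j \<in> coords n"
      "\<And>v i. v \<in> coords n \<Longrightarrow> i < Suc m \<Longrightarrow> form_fun m l i (retract (Suc m) (form_fun m l) e v) = 0"
      using retract_exists[of "form_fun m l" "Suc m" n, OF ff] by blast
    note ret = is_form_retract[of "form_fun m l" "D + E" K "Suc m" e, OF ff K]
    \<comment> \<open>The factor \<open>v i\<close> raises the coefficients to the degree
      \<open>D + E\<close> of the denominator. If that degree is 0, then \<open>K\<close> is
      constant, hence zero because it vanishes at \<open>v0\<close>.\<close>
    have "\<exists>G. (\<forall>j. is_form (D + E) (\<lambda>v. v i * G j v)) \<and>
        (\<forall>v\<in>coords n. K v = (\<Sum>j\<le>m. form_fun m l j v * G j v))"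
    proof (cases "D + E")
      case 0
      have "K v = 0" for v using ret[THEN conjunct1] 0 \<open>K v0 = 0\<close> by metis
      then show ?thesis by (intro exI[of _ "\<lambda>j v. 0"]) simp
    next
      case (Suc D')
      obtain G where G: "\<And>j. is_form D' (G j)"
        "\<And>v. K v - K (retract (Suc m) (form_fun m l) e v) = (\<Sum>j<Suc m. form_fun m l j v * G j v)"
        using ret[THEN conjunct2] Suc by blast
      have "K (retract (Suc m) (form_fun m l) e v) = 0" if v: "v \<in> coords n" for v
      proof (cases "retract (Suc m) (form_fun m l) e v = 0")
        case True
        have "K (scale_vec 0 v) = 0" unfolding is_form_scale[OF K] Suc by simp
        then show ?thesis unfolding True by (simp add: scale_vec_def zero_fun_def)
      next
        case False
        show ?thesis
          by (rule K0[OF retract_coords[OF e(1) v] False]) (use e(2)[OF v] in simp_all)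
      qed
      then have "\<forall>v\<in>coords n. K v = (\<Sum>j\<le>m. form_fun m l j v * G j v)"
        using G(2) by (metis diff_zero lessThan_Suc_atMost)
      then show ?thesis
        using is_form_mult[OF is_form_var[of i] G(1)] Suc by (intro exI[of _ G]) simp
    qed
    then obtain G where G: "\<And>j. is_form (D + E) (\<lambda>v. v i * G j v)"
      "\<And>v. v \<in> coords n \<Longrightarrow> K v = (\<Sum>j\<le>m. form_fun m l j v * G j v)"
      by blast
    have den: "is_form (D + E) (\<lambda>v. H v * S v)" by (rule is_form_mult[OF F(2) S(1)])
    have "\<exists>r. \<forall>q v. pointlike q \<longrightarrow> v \<in> q \<longrightarrow> r q = v i * G j v / (H v * S v)" for j
      using quotient_function[OF G(1)[of j] den] by metis
    then obtain r where r: "\<And>j q v. pointlike q \<Longrightarrow> v \<in> q \<Longrightarrow> r j q = v i * G j v / (H v * S v)"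
      by metis
    have "H v0 * S v0 \<noteq> 0"
      using S(2) v0 eventually_nhds_zariski_self[OF p F(3)] by simp
    show ?thesis
    proof (rule span_atI)
      show "reg_at X p (r j)" for j
        by (rule reg_at_quotient[OF pX p G(1)[of j] den v0 \<open>H v0 * S v0 \<noteq> 0\<close>]) (use r pX in auto)
      have "S v0 \<noteq> 0" using S(2) v0 by blast
      show "\<forall>\<^sub>F q in zariski_nhds X p. b q = (\<Sum>j\<le>m. r j q * ?c j q)"
        using eventually_nhds_zariski_basic[OF S(1) pX p v0 \<open>S v0 \<noteq> 0\<close>] eventually_nhds_zariski_open[OF openin_chart_dom pc]
      proof eventually_elim
        case (elim q)
        then have q: "q \<in> X" "pointlike q" using pX by (auto simp: chart_dom_def)
        then obtain v where v: "v \<in> q" using pointlike_ex by blast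
        have Sv: "S v \<noteq> 0" and vi: "v i \<noteq> 0" using elim v by (auto simp: chart_dom_def)
        have H: "H v \<noteq> 0" "b q = F v / H v" using S(3) q(1) v Sv by blast+
        have "v \<in> coords n" using q(1) X v proj_coords by blast
        have "(\<Sum>j\<le>m. r j q * ?c j q) = (\<Sum>j\<le>m. form_fun m l j v * G j v / (H v * S v))"
          using vi by (intro sum.cong refl) (simp add: r[OF q(2) v] chart_eq[OF ff q(2) v])
        also have "\<dots> = K v / (H v * S v)"
          unfolding G(2)[OF \<open>v \<in> coords n\<close>] by (rule sum_divide_distrib[symmetric])
        also have "\<dots> = b q" using Sv H by (simp add: K_def)
        finally show ?case by simp
      qed
    qed
  qed
qed

section \<open>Comparison of the two blowing-ups\<close>

lemma openin_zariski_subset: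
  assumes "openin (zariski X) U" "Y \<subseteq> X" shows "openin (zariski Y) (U \<inter> Y)"
proof -
  obtain S where S: "\<forall>F\<in>S. \<exists>d. homogeneous d F" "U = {p\<in>X. \<exists>F\<in>S. nonzero_at F p}"
    using assms(1) unfolding openin_zariski by (elim exE conjE)
  have "U \<inter> Y = {p\<in>Y. \<exists>F\<in>S. nonzero_at F p}" using S(2) assms(2) by auto
  then show ?thesis unfolding openin_zariski using S(1) by (intro exI[of _ S]) simp
qed

lemma openin_zariski_trans:
  assumes "openin (zariski X) V" "openin (zariski V) U" shows "openin (zariski X) U"
proof -
  obtain S where S: "\<forall>F\<in>S. \<exists>d. homogeneous d F" "U = {p\<in>V. \<exists>F\<in>S. nonzero_at F p}"
    using assms(2) unfolding openin_zariski by (elim exE conjE)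
  have "openin (zariski X) {p\<in>X. \<exists>F\<in>S. nonzero_at F p}"
    unfolding openin_zariski using S(1) by (intro exI[of _ S]) simp
  moreover have "U = V \<inter> {p\<in>X. \<exists>F\<in>S. nonzero_at F p}"
    using S(2) openin_subset[OF assms(1)] by auto
  ultimately show ?thesis using assms(1) by (simp add: openin_Int)
qed

text \<open>Nonempty open sets contain non-vanishing loci of forms, and two forms not identically
  zero on \<open>W\<close> have a common nonzero there, the field being infinite. This is
  irreducibility of a linear subspace.\<close>

lemma linear_opens_meet:
  fixes W :: "(nat \<Rightarrow> 'k::field_char_0) set"
  assumes W: "vec.subspace W" and Y: "Y = {pt v | v. v \<in> W \<and> v \<noteq> 0}"
    and U: "openin (zariski Y) U" "U \<noteq> {}" and V: "openin (zariski Y) V" "V \<noteq> {}"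
  shows "U \<inter> V \<noteq> {}"
proof -
  have Yp: "points Y" unfolding Y by auto
  have basic: "\<exists>d g v. is_form d g \<and> v \<in> W \<and> g v \<noteq> 0 \<and> (\<forall>w\<in>W. g w \<noteq> 0 \<longrightarrow> w \<noteq> 0 \<and> pt w \<in> U)"
    if U: "openin (zariski Y) U" "U \<noteq> {}" for U
  proof -
    obtain p where p: "p \<in> U" using U(2) by blast
    then have pY: "p \<in> Y" using openin_subset[OF U(1)] by auto
    then obtain v where v: "v \<in> W" "v \<noteq> 0" "p = pt v" unfolding Y by blast
    obtain i where i: "v i \<noteq> 0" using v(2) by (auto simp: fun_eq_iff)
    obtain d g where g: "is_form d g" "\<forall>v\<in>p. g v \<noteq> 0" "\<forall>q\<in>Y. \<forall>v\<in>q. g v \<noteq> 0 \<longrightarrow> q \<in> U"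
      using zariski_nhds_basic[OF Yp pY eventually_nhds_zariski_open[OF U(1) p]] by blast
    show ?thesis
    proof (intro exI conjI ballI impI)
      \<comment> \<open>The factor \<open>v i\<close> forces \<open>w \<noteq> 0\<close>, which
        \<open>g\<close> alone need not do: a constant form is nonzero at the zero vector.\<close>
      show "is_form (Suc 0 + d) (\<lambda>v. v i * g v)" by (intro is_form_mult is_form_var g(1))
      show "v \<in> W" "v i * g v \<noteq> 0" using v i g(2) by auto
      fix w assume w: "w \<in> W" "w i * g w \<noteq> 0"
      then show "w \<noteq> 0" by auto
      then have "pt w \<in> Y" using w(1) unfolding Y by blast
      then show "pt w \<in> U" using g(3) w(2) self_in_pt by auto
    qed
  qed
  obtain d g u where g: "is_form d g" "u \<in> W" "g u \<noteq> 0" "\<forall>w\<in>W. g w \<noteq> 0 \<longrightarrow> w \<noteq> 0 \<and> pt w \<in> U"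
    using basic[OF U] by (elim exE conjE)
  obtain e h v where h: "is_form e h" "v \<in> W" "h v \<noteq> 0" "\<forall>w\<in>W. h w \<noteq> 0 \<longrightarrow> w \<noteq> 0 \<and> pt w \<in> V"
    using basic[OF V] by (elim exE conjE)
  obtain w where "w \<in> W" "g w \<noteq> 0" "h w \<noteq> 0"
    using is_form_common_nonzero[OF g(1) h(1) W g(2) h(2) g(3) h(3)] by blast
  then show ?thesis using g(4) h(4) by blast
qed

lemma irreducible_opens_meet:
  assumes "irreducible_in (zariski X) X" "openin (zariski X) U" "U \<noteq> {}" "openin (zariski X) V" "V \<noteq> {}"
  shows "U \<inter> V \<noteq> {}"
proof
  assume "U \<inter> V = {}"
  have c: "closedin (zariski X) (X - U)" if "openin (zariski X) U" for U
    using closedin_diff[OF closedin_topspace that] by simp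
  have "X \<subseteq> (X - U) \<union> (X - V)" using \<open>U \<inter> V = {}\<close> by blast
  then have "X \<subseteq> X - U \<or> X \<subseteq> X - V"
    using assms(1) c[OF assms(2)] c[OF assms(4)] unfolding irreducible_in_def by metis
  moreover have "U \<subseteq> X" "V \<subseteq> X"
    using openin_subset[OF assms(2)] openin_subset[OF assms(4)] by simp_all
  ultimately show False using assms(3,5) by blast
qed

lemma linear_irreducible:
  fixes W :: "(nat \<Rightarrow> 'k::field_char_0) set"
  assumes "vec.subspace W" "L = {pt v | v. v \<in> W \<and> v \<noteq> 0}" "L \<noteq> {}" "L \<subseteq> X"
  shows "irreducible_in (zariski X) L"
  unfolding irreducible_in_def
proof (intro conjI allI impI)
  fix A B assume AB: "closedin (zariski X) A \<and> closedin (zariski X) B \<and> L \<subseteq> A \<union> B"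
  have o: "openin (zariski L) ((X - C) \<inter> L)" if "closedin (zariski X) C" for C
    using that openin_zariski_subset[OF _ assms(4)] unfolding closedin_def by simp
  show "L \<subseteq> A \<or> L \<subseteq> B"
  proof (rule ccontr)
    assume "\<not> (L \<subseteq> A \<or> L \<subseteq> B)"
    then have "(X - A) \<inter> L \<noteq> {}" "(X - B) \<inter> L \<noteq> {}" using assms(4) by blast+
    then have "(X - A) \<inter> L \<inter> ((X - B) \<inter> L) \<noteq> {}"
      using linear_opens_meet[OF assms(1,2) o _ o] AB by blast
    then show False using AB by blast
  qed
qed (use assms in simp_all)

lemma proj_line_nonempty:
  assumes "vec.dim W = 2" shows "\<exists>v\<in>W. v \<noteq> (0 :: nat \<Rightarrow> 'k::field)"
proof (rule ccontr)
  assume "\<not> ?thesis"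
  then have "W \<subseteq> {0}" by blast
  then have "vec.dim W \<le> card ({} :: (nat \<Rightarrow> 'k) set)"
    by (intro vec.dim_le_card) simp_all
  then show False using assms by simp
qed

lemma form_map_pt:
  assumes "\<And>i. i \<le> m \<Longrightarrow> f i \<in> forms n d" "v \<noteq> 0"
  shows "form_map m f (pt v) = pt (\<lambda>j. form_fun m f j v)"
  using form_map_eq[of m d f "pt v" v] assms by (simp add: forms_def form_fun_def)

text \<open>Blowing-ups are determined only up to isomorphism, so the claim is made for each of
  them; the first conjunct keeps this quantification from being vacuous.\<close>

theorem theorem2p6:
  fixes X L V :: "'k::{alg_closed_field, field_char_0} point set"
    and l f :: "nat \<Rightarrow> 'k mpol" and d :: nat
    and \<psi> :: "'k point \<Rightarrow> 'k point"
  assumes "closedin (zariski (proj 5)) X"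
    and "irreducible_in (zariski X) X"
    and "krull_dim (zariski X) = 3"
    and "smooth 5 X"
    and "nondegenerate 5 X"
    and "proj_line 5 L" and "L \<subseteq> X"
    and "projection_forms 5 3 L l"
    and "birational X (proj 3) (X - L) (form_map 3 l)"
    and "rational_inverse X (proj 3) (X - L) (form_map 3 l) V \<psi>"
    and "defined_by_forms 3 5 d f V \<psi>"
  shows "(\<exists>P \<beta>. is_blowup (proj 3) (base_ideal 3 (linear_system 5 f)) P \<beta>) \<and>
    (\<forall>P \<beta>. is_blowup (proj 3) (base_ideal 3 (linear_system 5 f)) P \<beta> \<longrightarrow>
       (\<exists>X'. isomorphic X X' \<and> blowing_down X' P))"
proof -
  let ?\<pi> = "form_map 3 l"
  have l: "\<And>i. i \<le> 3 \<Longrightarrow> l i \<in> forms 5 1" and L_eq: "L = {p\<in>proj 5. \<forall>i\<le>3. zero_at (l i) p}"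
    using assms(8) unfolding projection_forms_def by auto
  have f: "\<And>i. i \<le> 5 \<Longrightarrow> f i \<in> forms 3 d"
    using assms(11) unfolding defined_by_forms_def by auto
  obtain U where U: "openin (zariski V) U" "U \<noteq> {}" "\<And>p. p \<in> U \<Longrightarrow> \<psi> p = form_map 5 f p"
    using assms(11) unfolding defined_by_forms_def by blast
  have \<pi>: "openin (zariski X) (X - L)" "regular_map (X - L) (proj 3) ?\<pi>"
    and \<psi>: "openin (zariski (proj 3)) V" "V \<noteq> {}" "regular_map V X \<psi>"
    and inv: "\<And>x. x \<in> X - L \<Longrightarrow> ?\<pi> x \<in> V \<Longrightarrow> \<psi> (?\<pi> x) = x"
      "\<exists>y\<in>V. \<psi> y \<in> X - L" "\<And>y. y \<in> V \<Longrightarrow> \<psi> y \<in> X - L \<Longrightarrow> ?\<pi> (\<psi> y) = y"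
    using assms(10) unfolding rational_inverse_def rational_map_def by simp_all
  have X: "X \<subseteq> proj 5" by (rule closedin_proj_subset[OF assms(1)])
  have Xp: "points X" "points (X - L)" using X points_proj by blast+
  have VP: "V \<subseteq> proj 3" using openin_subset[OF \<psi>(1)] by simp
  have Vp: "points V" using VP points_proj by blast
  have UV: "U \<subseteq> V" using openin_subset[OF U(1)] by simp
  have UP: "openin (zariski (proj 3)) U" by (rule openin_zariski_trans[OF \<psi>(1) U(1)])

  \<comment> \<open>One bound for both Segre embeddings: the index ranges 5, 3 and 3, 5 both fit
    into 5, 5, so both closures lie in the same projective space.\<close>
  define N where "N = Max (prod_encode ` ({..5} \<times> {..5::nat}))"
  have N: "prod_encode (i, j) \<le> N" if "i \<le> 5" "j \<le> 5" for i j
    unfolding N_def using that by (intro Max_ge) auto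
  interpret A: segre_graph "\<lambda>k. fst (prod_decode k)" "\<lambda>k. snd (prod_decode k)" "\<lambda>i j. prod_encode (i, j)"
    5 3 N 1 X "form_fun 3 l"
    by unfold_locales (use assms(1) is_form_form_fun[of 3 l 5 1, OF l] N in \<open>auto simp: form_fun_def\<close>)
  interpret B: segre_graph "\<lambda>k. snd (prod_decode k)" "\<lambda>k. fst (prod_decode k)" "\<lambda>i j. prod_encode (j, i)"
    3 5 N d "proj 3" "form_fun 5 f"
    by unfold_locales (use closedin_topspace[of "zariski (proj 3)"] is_form_form_fun[of 5 f 3 d, OF f] N in \<open>auto simp: form_fun_def\<close>)
  have swap: "B.segre y x = A.segre x y" for x y
    by (simp add: A.segre_def B.segre_def mult.commute)
  have \<pi>_pt: "?\<pi> (pt x) = pt (A.form_vec x)" if "x \<noteq> 0" for x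
    using form_map_pt[of 3 l 5 1, OF l that] by (simp add: A.form_vec_def)
  have \<psi>_pt: "\<psi> (pt y) = pt (B.form_vec y)" if "pt y \<in> U" for y
  proof -
    have "y \<noteq> 0" using that UV VP B.pt_in_X by blast
    then show ?thesis using form_map_pt[of 5 f 3 d, OF f] U(3)[OF that] by (simp add: B.form_vec_def)
  qed
  have notL: "pt x \<in> X - L \<longleftrightarrow> A.form_vec x \<noteq> 0" if "pt x \<in> X" for x
  proof -
    have x: "x \<noteq> 0" using A.pt_in_X[OF that] by simp
    have "zero_at (l i) (pt x) \<longleftrightarrow> A.form_vec x i = 0" if "i \<le> 3" for i
      using zero_at_iff(1)[of 1 "l i" "pt x" x] l[OF that] that x by (simp add: A.form_vec_def form_fun_def forms_def)
    then have "pt x \<in> L \<longleftrightarrow> (\<forall>i\<le>3. A.form_vec x i = 0)" using that X by (auto simp: L_eq)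
    also have "\<dots> \<longleftrightarrow> A.form_vec x = 0" by (auto simp: A.form_vec_def form_fun_def fun_eq_iff)
    finally show ?thesis using that by blast
  qed
  have proj3: "proj 3 = {pt v | v. v \<in> coords 3 \<and> v \<noteq> (0 :: nat \<Rightarrow> 'k)}"
    by (rule proj_def)
  note P3_meet = linear_opens_meet[OF subspace_coords proj3]

  \<comment> \<open>On \<open>U\<close> the map \<open>\<psi>\<close> is given by the
    \<open>f i\<close>, on \<open>U1\<close> its values avoid \<open>L\<close>; over the
    intersection, points of the graph of \<open>\<psi>\<close> are points of the graph of the
    projection.\<close>
  define U1 where "U1 = {y\<in>V. \<psi> y \<in> X - L}"
  have U1: "openin (zariski (proj 3)) U1" "U1 \<noteq> {}"
    using openin_zariski_trans[OF \<psi>(1) openin_preimage[OF Vp Xp(1) \<psi>(3) \<pi>(1)]] inv(2)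
    by (auto simp: U1_def)
  have U': "openin (zariski (proj 3)) (U \<inter> U1)" "U \<inter> U1 \<noteq> {}"
    using UP U1 P3_meet[OF UP U(2) U1] by (simp_all add: openin_Int)
  \<comment> \<open>The counterpart on \<open>X\<close>: here the projection is defined with values
    in \<open>U\<close>, and \<open>\<psi>\<close> leads back.\<close>
  define U2 where "U2 = {x\<in>X - L. ?\<pi> x \<in> U}"
  have "openin (zariski X) U2"
    using openin_zariski_trans[OF \<pi>(1) openin_preimage[OF Xp(2) points_proj \<pi>(2) UP]] by (simp add: U2_def)
  moreover have "U2 \<noteq> {}"
  proof -
    obtain y where "y \<in> U" "y \<in> U1" using U'(2) by blast
    then have "\<psi> y \<in> U2" using inv(3)[of y] UV by (auto simp: U1_def U2_def)
    then show ?thesis by blast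
  qed
  ultimately have U2: "openin (zariski X) U2" "U2 \<noteq> {}" .

  \<comment> \<open>A form vanishing on one graph is pulled back to the source of the other map.
    Were it nonzero somewhere, its non-vanishing locus would meet the dense open set where the two
    maps are mutually inverse, and there a point of one graph is a point of the other.\<close>
  have van: "(\<forall>q\<in>A.graph. \<forall>z\<in>q. F z = 0) \<longleftrightarrow> (\<forall>q\<in>B.graph. \<forall>z\<in>q. F z = 0)" if F: "is_form D F" for D F
  proof
    have zero: "F z = 0" if "F z' = 0" "z \<in> pt z'" for z z'
      using that is_form_scale[OF F] by (auto simp: in_pt)
    show "\<forall>q\<in>B.graph. \<forall>z\<in>q. F z = 0" if A0: "\<forall>q\<in>A.graph. \<forall>z\<in>q. F z = 0"
    proof (intro ballI)
      fix q z assume "q \<in> B.graph" "z \<in> q"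
      then obtain y where y: "z \<in> pt (B.segre y (B.form_vec y))" "pt y \<in> proj 3" "B.form_vec y \<noteq> 0"
        unfolding B.graph_def by blast
      have g: "is_form (D * (1 + d)) (\<lambda>y. F (B.segre y (B.form_vec y)))"
        unfolding B.segre_def B.form_vec_def
        by (intro is_form_subst[OF F] is_form_mult B.f_form) simp
      have "F (B.segre y (B.form_vec y)) = 0"
      proof (rule ccontr)
        assume nz: "F (B.segre y (B.form_vec y)) \<noteq> 0"
        let ?O = "{p\<in>proj 3. \<forall>v\<in>p. F (B.segre v (B.form_vec v)) \<noteq> 0}"
        have "F (B.segre v (B.form_vec v)) \<noteq> 0" if v: "v \<in> pt y" for v
          using is_form_zero_iff[OF g B.X_points[rule_format, OF y(2)] v self_in_pt] nz by simp
        then have "pt y \<in> ?O" using y(2) by simp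
        then have "?O \<inter> (U \<inter> U1) \<noteq> {}"
          by (intro P3_meet[OF openin_zariski_basic[OF g] _ U']) blast
        then obtain p where p: "p \<in> ?O" "p \<in> U" "p \<in> U1" by blast
        then obtain w where w: "p = pt w" "w \<noteq> 0" unfolding proj3 by blast
        let ?x = "B.form_vec w"
        have \<psi>w: "\<psi> (pt w) = pt ?x" using \<psi>_pt p(2) w(1) by simp
        have x: "pt ?x \<in> X - L" using p(3) \<psi>w w(1) by (simp add: U1_def)
        then have xA: "A.form_vec ?x \<noteq> 0" and x0: "?x \<noteq> 0" using notL A.pt_in_X by blast+
        have "pt w = ?\<pi> (pt ?x)" using inv(3)[of "pt w"] p(3) \<psi>w w(1) x UV by (simp add: U1_def)
        also have "\<dots> = pt (A.form_vec ?x)" by (rule \<pi>_pt[OF x0])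
        finally have "pt (B.segre w ?x) = pt (A.segre ?x (A.form_vec ?x))"
          unfolding swap by (intro A.segre_cong refl)
        moreover have "pt (A.segre ?x (A.form_vec ?x)) \<in> A.graph" using x xA unfolding A.graph_def by blast
        ultimately have "F (B.segre w ?x) = 0" using A0 self_in_pt[of "B.segre w ?x"] by simp
        then show False using p(1) w(1) self_in_pt by blast
      qed
      then show "F z = 0" using zero y(1) by blast
    qed
    show "\<forall>q\<in>A.graph. \<forall>z\<in>q. F z = 0" if B0: "\<forall>q\<in>B.graph. \<forall>z\<in>q. F z = 0"
    proof (intro ballI)
      fix q z assume "q \<in> A.graph" "z \<in> q"
      then obtain x where x: "z \<in> pt (A.segre x (A.form_vec x))" "pt x \<in> X" "A.form_vec x \<noteq> 0"
        unfolding A.graph_def by blast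
      have g: "is_form (D * (1 + 1)) (\<lambda>x. F (A.segre x (A.form_vec x)))"
        unfolding A.segre_def A.form_vec_def
        by (intro is_form_subst[OF F] is_form_mult A.f_form) simp
      have "F (A.segre x (A.form_vec x)) = 0"
      proof (rule ccontr)
        assume nz: "F (A.segre x (A.form_vec x)) \<noteq> 0"
        let ?O = "{p\<in>X. \<forall>v\<in>p. F (A.segre v (A.form_vec v)) \<noteq> 0}"
        have "F (A.segre v (A.form_vec v)) \<noteq> 0" if v: "v \<in> pt x" for v
          using is_form_zero_iff[OF g A.X_points[rule_format, OF x(2)] v self_in_pt] nz by simp
        then have "pt x \<in> ?O" using x(2) by simp
        \<comment> \<open>Irreducibility of \<open>X\<close> does here what common nonzeros of forms
          do on P^3.\<close>
        then have "?O \<inter> U2 \<noteq> {}"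
          by (intro irreducible_opens_meet[OF assms(2) openin_zariski_basic[OF g] _ U2]) blast
        then obtain p where p: "p \<in> ?O" "p \<in> U2" by blast
        then obtain w where w: "p = pt w" "w \<noteq> 0" using Xp(1) unfolding pointlike_def by blast
        let ?y = "A.form_vec w"
        have \<pi>w: "?\<pi> p = pt ?y" using \<pi>_pt w by simp
        have y: "pt ?y \<in> U" "p \<in> X - L" using p(2) \<pi>w by (simp_all add: U2_def)
        then have "p = \<psi> (pt ?y)" using inv(1)[of p] \<pi>w UV by auto
        also have "\<dots> = pt (B.form_vec ?y)" by (rule \<psi>_pt[OF y(1)])
        finally have eq: "pt w = pt (B.form_vec ?y)" using w(1) by simp
        then have "B.form_vec ?y \<noteq> 0" using w(2) pointlike_pt by metis
        then have "pt (B.segre ?y (B.form_vec ?y)) \<in> B.graph"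
          using y(1) UV VP unfolding B.graph_def by blast
        moreover have "pt (A.segre w ?y) = pt (B.segre ?y (B.form_vec ?y))"
          unfolding swap using eq by (intro A.segre_cong refl)
        ultimately have "F (A.segre w ?y) = 0" using B0 self_in_pt[of "A.segre w ?y"] by simp
        then show False using p(1) w(1) self_in_pt by blast
      qed
      then show "F z = 0" using zero x(1) by blast
    qed
  qed
  have same: "A.graph_closure = B.graph_closure"
    unfolding A.graph_closure_def B.graph_closure_def
    by (intro Collect_cong conj_cong refl all_cong1 imp_cong) (auto simp only: van)

  have blowup_P3: "is_blowup (proj 3) (base_ideal 3 (linear_system 5 f)) B.graph_closure B.fst_proj"
    by (rule B.graph_closure_blowup[OF base_ideal_generated[of 5 f 3 d, OF f]])
  have blowup_X: "is_blowup X (ideal_of_subvariety X L) A.graph_closure A.fst_proj"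
    by (rule A.graph_closure_blowup[OF linear_ideal_generated[of X 5 3 l L, OF X l L_eq assms(7)]])
  have L_closed: "closedin (zariski X) L"
    using \<pi>(1) assms(7) by (simp add: closedin_def)
  obtain W where W: "vec.subspace W" "vec.dim W = 2" "L = {pt v | v. v \<in> W \<and> v \<noteq> 0}"
    using assms(6) unfolding proj_line_def by blast
  have "L \<noteq> {}" using proj_line_nonempty[OF W(2)] W(3) by blast
  then have L_irr: "irreducible_in (zariski X) L"
    by (rule linear_irreducible[OF W(1,3) _ assms(7)])
  \<comment> \<open>\<open>X\<close> itself serves as \<open>X'\<close>. Any \<open>P\<close> is
    isomorphic to the graph closure by uniqueness of the blowing-up of P^3, and this closure is also
    the blowing-up of \<open>X\<close> along \<open>L\<close>.\<close>
  have "blowing_down X P"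
    if "is_blowup (proj 3) (base_ideal 3 (linear_system 5 f)) P \<beta>" for P \<beta>
    unfolding blowing_down_def
    by (intro exI[of _ L] exI[of _ A.graph_closure] exI[of _ A.fst_proj] conjI L_closed L_irr blowup_X)
      (use blowup_unique[OF that blowup_P3] same in simp)
  then show ?thesis
    using blowup_P3 isomorphic_refl[OF closed_quasi_projective[OF assms(1)]] by blast
qed

end
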